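(* Let $\beta\in\mathbb R$. (1) Let $1<p<\infty$ and $\Omega\subset\mathbb R^N$ open; if $\beta+Q<0$ assume also $0\notin\Omega$. Then for every $u\in D^{1,p}_L(\Omega,\|\xi\|_\gamma^{p+\beta})$, $$\Big(\frac{|Q+\beta|}{p}\Big)^p\int_\Omega|u|^p\|\xi\|_\gamma^\beta\frac{|x|^{\gamma p}}{\|\xi\|_\gamma^{\gamma p}}d\xi\le\int_\Omega|\nabla_\gamma u|^p\|\xi\|_\gamma^{p+\beta}d\xi,$$ in particular $\big(\frac{|Q-p|}{p}\big)^p\int_\Omega\frac{|u|^p}{\|\xi\|_\gamma^p}\frac{|x|^{\gamma p}}{\|\xi\|_\gamma^{\gamma p}}d\xi\le\int_\Omega|\nabla_\gamma u|^pd\xi$ for $u\in D^{1,p}_L(\Omega)$. If $\Omega\cup\{0\}$ is a neighbourhood of the origin, the constant $(|Q+\beta|/p)^p$ is sharp. (2) Let $p=Q>1$, $R>0$, $\Omega=\{\xi:\|\xi\|_\gamma<R\}$ and $\beta<-1$. Then for every $u\in D^{1,p}_L(\Omega,(\ln(R/\|\xi\|_\gamma))^{p+\beta})$, $$\Big(\frac{|\beta+1|}{p}\Big)^p\int_\Omega\frac{|u|^p}{\|\xi\|_\gamma^p}\Big(\ln\frac R{\|\xi\|_\gamma}\Big)^\beta\frac{|x|^{\gamma p}}{\|\xi\|_\gamma^{\gamma p}}d\xi\le\int_\Omega|\nabla_\gamma u|^p\Big(\ln\frac R{\|\xi\|_\gamma}\Big)^{p+\beta}d\xi,$$ in particular $\big(\frac{p-1}{p}\big)^p\int_\Omega\frac{|u|^p}{(\|\xi\|_\gamma\ln(R/\|\xi\|_\gamma))^p}\frac{|x|^{\gamma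 p}}{\|\xi\|_\gamma^{\gamma p}}d\xi\le\int_\Omega|\nabla_\gamma u|^pd\xi$ for $u\in D^{1,p}_L(\Omega)$; the constant $(|\beta+1|/p)^p$ is sharp.
   Context: $\mathbb R^N$ is split as $\xi=(x,y)\in\mathbb R^n\times\mathbb R^k$, $\gamma\ge0$, and $\nabla_\gamma=(\nabla_x,|x|^\gamma\nabla_y)$ (the vector field associated to the matrix $\mu=\mathrm{diag}(I_n,|x|^\gamma I_k)$; for $p=2$ the associated operator is the Baouendi–Grushin operator $\Delta_x+|x|^{2\gamma}\Delta_y$). $\|\xi\|_\gamma:=\big(|x|^{2(1+\gamma)}+(1+\gamma)^2|y|^2\big)^{1/(2+2\gamma)}$ and $Q:=n+(1+\gamma)k$. For a weight $w\in L^1_{loc}(\Omega)$, $w>0$ a.e., $D^{1,p}_L(\Omega,w)$ is the closure of $C^\infty_0(\Omega)$ in the norm $(\int_\Omega|\nabla_\gamma u|^pw\,d\xi)^{1/p}$, and $D^{1,p}_L(\Omega)=D^{1,p}_L(\Omega,1)$. "Sharp" means the constant cannot be replaced by any larger one. *)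

theory Defs
  imports "HOL-Analysis.Analysis"
begin

text \<open>Points of R^N = R^n x R^k are pairs (x,y) with x :: real^'n, y :: real^'k;
  n = CARD('n), k = CARD('k).\<close>

text \<open>Power with the convention a^0 = 1 (Isabelle's powr has 0 powr 0 = 0).\<close>
definition rpow :: "real \<Rightarrow> real \<Rightarrow> real" where
  "rpow a t = (if t = 0 then 1 else a powr t)"

definition gnorm :: "real \<Rightarrow> (real^'n::finite) \<times> (real^'k::finite) \<Rightarrow> real" where
  "gnorm \<gamma> \<xi> = (norm (fst \<xi>) powr (2 * (1 + \<gamma>)) + (1 + \<gamma>)\<^sup>2 * (norm (snd \<xi>))\<^sup>2)
                  powr (1 / (2 + 2 * \<gamma>))"

definition smooth :: "('a::real_normed_vector \<Rightarrow> real) \<Rightarrow> bool" where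
  "smooth f \<longleftrightarrow> (\<exists>S. f \<in> S \<and>
     (\<forall>g\<in>S. (\<forall>z. g differentiable (at z)) \<and>
             (\<forall>v. (\<lambda>z. frechet_derivative g (at z) v) \<in> S)))"

definition test_fun :: "'a::real_normed_vector set \<Rightarrow> ('a \<Rightarrow> real) \<Rightarrow> bool" where
  "test_fun \<Omega> \<phi> \<longleftrightarrow> smooth \<phi> \<and> compact (closure {z. \<phi> z \<noteq> 0})
                      \<and> closure {z. \<phi> z \<noteq> 0} \<subseteq> \<Omega>"

definition grad_gamma :: "real \<Rightarrow> ((real^'n::finite) \<times> (real^'k::finite) \<Rightarrow> real)
      \<Rightarrow> (real^'n) \<times> (real^'k) \<Rightarrow> (real^'n) \<times> (real^'k)" where
  "grad_gamma \<gamma> \<phi> \<xi> =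
     ((\<chi> i. frechet_derivative \<phi> (at \<xi>) (axis i 1, 0)),
      rpow (norm (fst \<xi>)) \<gamma> *\<^sub>R (\<chi> j. frechet_derivative \<phi> (at \<xi>) (0, axis j 1)))"

text \<open>Concrete description of the completion D^{1,p}_L(Omega,w) of C_0^infinity(Omega) in the
  norm (int_Omega |nabla_gamma u|^p w)^(1/p): an element is a pair (u, G) of a function u and its
  generalised gradient G (both Borel measurable) such that some sequence of test functions
  phi_j satisfies  int_Omega |nabla_gamma phi_j - G|^p w -> 0  and  phi_j -> u  a.e. in Omega.\<close>
definition DL :: "real \<Rightarrow> real \<Rightarrow> ((real^'n::finite) \<times> (real^'k::finite)) set
     \<Rightarrow> ((real^'n) \<times> (real^'k) \<Rightarrow> real)
     \<Rightarrow> (((real^'n) \<times> (real^'k) \<Rightarrow> real) \<times> ((real^'n) \<times> (real^'k) \<Rightarrow> (real^'n) \<times> (real^'k))) set"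
  where
  "DL \<gamma> p \<Omega> w = {(u, G). u \<in> borel_measurable lborel \<and> G \<in> borel_measurable lborel \<and>
      (\<integral>\<^sup>+\<xi>\<in>\<Omega>. ennreal (norm (G \<xi>) powr p * w \<xi>) \<partial>lborel) < \<infinity> \<and>
      (\<exists>\<phi> :: nat \<Rightarrow> (real^'n) \<times> (real^'k) \<Rightarrow> real.
         (\<forall>j. test_fun \<Omega> (\<phi> j)) \<and>
         ((\<lambda>j. \<integral>\<^sup>+\<xi>\<in>\<Omega>. ennreal (norm (grad_gamma \<gamma> (\<phi> j) \<xi> - G \<xi>) powr p * w \<xi>) \<partial>lborel)
            \<longlonglongrightarrow> 0) \<and>
         (AE \<xi> in lborel. \<xi> \<in> \<Omega> \<longrightarrow> (\<lambda>j. \<phi> j \<xi>) \<longlonglongrightarrow> u \<xi>))}"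

end

theory Submission
  imports Defs
begin

text \<open>Inequalities: both sides are governed by the dilations \<open>(x, y) \<mapsto> (e\<^sup>t x, e\<^bsup>(1+\<gamma>)t\<^esup> y)\<close>, for which
  the measure with density \<open>\<rho>\<^sup>-\<^sup>Q (\<bar>x\<bar>/\<rho>)\<^bsup>\<gamma>p\<^esup>\<close> is invariant, where \<open>\<rho>\<close> is the homogeneous norm. The
  derivative \<open>Z\<phi>\<close> of a test function along this flow satisfies
  \<open>\<bar>Z\<phi>\<bar> (\<bar>x\<bar>/\<rho>)\<^sup>\<gamma> \<le> \<rho> \<bar>\<nabla>\<^sub>\<gamma>\<phi>\<bar>\<close> by Cauchy-Schwarz. Writing \<open>\<phi>\<close> as an integral of \<open>Z\<phi>\<close> along its
  orbit, applying Jensen's inequality with a suitable probability density in the flow time, and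
  exchanging the order of integration gives the one-dimensional Hardy inequality with the sharp
  constant; no divergence theorem and no integrability assumption is needed. The density is
  exponential in the power case and a power of the remaining time in the logarithmic case.

  Sharpness: truncations of the virtual extremals \<open>\<rho>\<^bsup>-(Q+\<beta>)/p\<^esup>\<close> and \<open>(ln (R/\<rho>))\<^bsup>-(\<beta>+1)/p\<^esup>\<close> have
  Rayleigh quotients tending to the constant, because the unit shells in \<open>ln \<rho>\<close> all have the same
  invariant mass: the plateau carries unbounded mass, the transition zones bounded mass.\<close>

section \<open>Smooth functions\<close>

text \<open>The density in Jensen's inequality is dictated by the virtual extremal: along an orbit
  it is the rate of change of the extremal, divided by its initial value. With
  \<open>r = ln \<rho>\<close> and \<open>s = ln R - r\<close>, the extremal
  \<open>exp (- a * r)\<close> yields \<open>|a| * exp (- a * t)\<close>, and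
  \<open>s powr \<theta>\<close> yields
  \<open>\<theta> * (s - t) powr (\<theta> - 1) * s powr (- \<theta>)\<close>. Formally Jensen is
  then an equality on the extremal, which is why the constant comes out sharp. The sign of
  \<open>a = (Q + \<beta>) / p\<close> decides the direction of the flow. Outward orbits always
  leave the support of a test function; inward orbits do so only if the support avoids the origin,
  whence the hypothesis on \<open>\<Omega>\<close> for \<open>\<beta> + Q < 0\<close>. Two obstacles
  shape the rest. Integrals may be infinite, so every estimate is arranged without subtraction and
  without \<open>p\<close>-th roots in \<open>ennreal\<close>. The extremals are neither smooth nor
  compactly supported, so sharpness is first proved as a strict inequality between integrals of
  one-variable profiles, and only the strictness is carried over to smooth functions.\<close>

lemma smooth_differentiable: "smooth f \<Longrightarrow> f differentiable (at z)"
  unfolding smooth_def by blast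

lemma smooth_frechet_derivative: "smooth f \<Longrightarrow> smooth (\<lambda>z. frechet_derivative f (at z) v)"
  unfolding smooth_def by blast

lemma smooth_has_derivative: "smooth f \<Longrightarrow> (f has_derivative frechet_derivative f (at z)) (at z)"
  using smooth_differentiable frechet_derivative_works by blast

lemma smooth_continuous_on: "smooth f \<Longrightarrow> continuous_on S f"
  by (meson continuous_at_imp_continuous_on differentiable_imp_continuous_within smooth_differentiable)

text \<open>The set demanded by \<open>smooth\<close> may be any class closed under directional
  derivatives, so an invariant \<open>P\<close> serves as witness. Derivatives are supplied as
  arbitrary \<open>g'\<close>; uniqueness identifies them with
  \<open>frechet_derivative\<close>.\<close>

lemma smooth_coinduct:
  assumes "P f"
    and "\<And>g. P g \<Longrightarrow> \<exists>g'. (\<forall>z. (g has_derivative g' z) (at z)) \<and> (\<forall>v. P (\<lambda>z. g' z v))"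
  shows "smooth f"
  unfolding smooth_def
proof (intro exI[of _ "Collect P"] conjI ballI)
  fix g assume "g \<in> Collect P"
  then obtain g' where g': "\<forall>z. (g has_derivative g' z) (at z)" "\<forall>v. P (\<lambda>z. g' z v)"
    using assms(2) by blast
  then have "frechet_derivative g (at z) = g' z" for z
    by (metis frechet_derivative_at)
  with g' show "\<forall>z. g differentiable at z"
    and "\<forall>v. (\<lambda>z. frechet_derivative g (at z) v) \<in> Collect P"
    by (auto simp: differentiable_def)
qed (use assms in auto)

text \<open>Being closed under directional derivatives, this class consists of smooth functions; this
  yields all the closure properties of smoothness at once.\<close>

inductive smooth_expr :: "('a::real_normed_vector \<Rightarrow> real) \<Rightarrow> bool" where
  base: "smooth f \<Longrightarrow> smooth_expr f"
| const: "smooth_expr (\<lambda>_. c)"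
| linear: "bounded_linear f \<Longrightarrow> smooth_expr f"
| add: "smooth_expr f \<Longrightarrow> smooth_expr g \<Longrightarrow> smooth_expr (\<lambda>z. f z + g z)"
| mult: "smooth_expr f \<Longrightarrow> smooth_expr g \<Longrightarrow> smooth_expr (\<lambda>z. f z * g z)"
| powr: "smooth_expr f \<Longrightarrow> (\<And>z. f z > 0) \<Longrightarrow> smooth_expr (\<lambda>z. f z powr a)"
| ln: "smooth_expr f \<Longrightarrow> (\<And>z. f z > 0) \<Longrightarrow> smooth_expr (\<lambda>z. ln (f z))"
| exp: "smooth_expr f \<Longrightarrow> smooth_expr (\<lambda>z. exp (f z))"
| comp: "smooth (h :: real \<Rightarrow> real) \<Longrightarrow> smooth_expr f \<Longrightarrow> smooth_expr (\<lambda>z. h (f z))"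

lemma frechet_derivative_real:
  assumes "(h::real \<Rightarrow> real) differentiable at x"
  shows "frechet_derivative h (at x) v = v * frechet_derivative h (at x) 1"
proof -
  have "linear (frechet_derivative h (at x))"
    using assms by (rule linear_frechet_derivative)
  from linear_scale[OF this, of v 1] show ?thesis by simp
qed

text \<open>The derivative of each constructor is again built from the constructors, so
  \<open>smooth_expr\<close> is an invariant for the coinduction.\<close>

lemma smooth_expr_smooth: "smooth_expr f \<Longrightarrow> smooth f"
proof (erule smooth_coinduct[where P = smooth_expr])
  fix g :: "'a \<Rightarrow> real"
  assume "smooth_expr g"
  then show "\<exists>g'. (\<forall>z. (g has_derivative g' z) (at z)) \<and> (\<forall>v. smooth_expr (\<lambda>z. g' z v))"
  proof induction
    case (base f)
    then show ?case
      by (intro exI[of _ "\<lambda>z. frechet_derivative f (at z)"])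
        (auto intro!: smooth_has_derivative smooth_expr.base smooth_frechet_derivative)
  next
    case (const c)
    show ?case by (intro exI[of _ "\<lambda>_ _. 0"]) (auto intro: smooth_expr.const)
  next
    case (linear f)
    then show ?case
      by (intro exI[of _ "\<lambda>_. f"]) (auto intro: bounded_linear_imp_has_derivative smooth_expr.const)
  next
    case (add f g)
    then obtain f' g' where "\<forall>z. (f has_derivative f' z) (at z)" "\<forall>v. smooth_expr (\<lambda>z. f' z v)"
      "\<forall>z. (g has_derivative g' z) (at z)" "\<forall>v. smooth_expr (\<lambda>z. g' z v)" by blast
    then show ?case
      by (intro exI[of _ "\<lambda>z v. f' z v + g' z v"]) (auto intro!: has_derivative_add smooth_expr.add)
  next
    case (mult f g)
    then obtain f' g' where "\<forall>z. (f has_derivative f' z) (at z)" "\<forall>v. smooth_expr (\<lambda>z. f' z v)"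
      "\<forall>z. (g has_derivative g' z) (at z)" "\<forall>v. smooth_expr (\<lambda>z. g' z v)" by blast
    with mult.hyps show ?case
      by (intro exI[of _ "\<lambda>z v. f z * g' z v + f' z v * g z"])
        (auto intro!: has_derivative_mult smooth_expr.add smooth_expr.mult)
  next
    case (powr f a)
    then obtain f' where "\<forall>z. (f has_derivative f' z) (at z)" "\<forall>v. smooth_expr (\<lambda>z. f' z v)"
      by blast
    moreover have "((\<lambda>z. f z powr a) has_derivative (\<lambda>v. a * (f z powr (a - 1) * f' z v))) (at z)"
      if "(f has_derivative f' z) (at z)" for z
      using has_derivative_powr[OF that has_derivative_const[of a]] powr(2)[of z]
      by (simp add: powr_diff field_simps)
    ultimately show ?case
      using powr.hyps
      by (intro exI[of _ "\<lambda>z v. a * (f z powr (a - 1) * f' z v)"])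
        (auto intro!: smooth_expr.mult smooth_expr.powr smooth_expr.const)
  next
    case (ln f)
    then obtain f' where "\<forall>z. (f has_derivative f' z) (at z)" "\<forall>v. smooth_expr (\<lambda>z. f' z v)"
      by blast
    \<comment> \<open>The reciprocal is written as the power \<open>-1\<close>, because the class
      has no constructor for division.\<close>
    moreover have "((\<lambda>z. ln (f z)) has_derivative (\<lambda>v. f z powr (-1) * f' z v)) (at z)"
      if "(f has_derivative f' z) (at z)" for z
      using has_derivative_ln[OF ln(2) that] ln(2)[of z]
      by (simp add: powr_minus mult.commute)
    ultimately show ?case
      using ln.hyps
      by (intro exI[of _ "\<lambda>z v. f z powr (-1) * f' z v"])
        (auto intro!: smooth_expr.mult smooth_expr.powr simp del: powr_neg_one')
  next
    case (exp f)
    then obtain f' where "\<forall>z. (f has_derivative f' z) (at z)" "\<forall>v. smooth_expr (\<lambda>z. f' z v)"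
      by blast
    with exp.hyps show ?case
      by (intro exI[of _ "\<lambda>z v. exp (f z) * f' z v"])
        (auto intro!: smooth_expr.mult smooth_expr.exp derivative_eq_intros)
  next
    case (comp h f)
    then obtain f' where f': "\<forall>z. (f has_derivative f' z) (at z)" "\<forall>v. smooth_expr (\<lambda>z. f' z v)"
      by blast
    \<comment> \<open>A linear map on the reals is multiplication by its value at 1; this turns the
      chain rule into a product of two expressions.\<close>
    have "((\<lambda>z. h (f z)) has_derivative (\<lambda>v. frechet_derivative h (at (f z)) 1 * f' z v)) (at z)" for z
    proof -
      have "((\<lambda>z. h (f z)) has_derivative (\<lambda>v. frechet_derivative h (at (f z)) (f' z v))) (at z)"
        using f' has_derivative_compose smooth_has_derivative[OF comp(1)] by blast
      then show ?thesis
        using frechet_derivative_real[OF smooth_differentiable[OF comp(1)]]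
        by (metis (no_types, lifting) ext mult.commute)
    qed
    with f' comp show ?case
      by (intro exI[of _ "\<lambda>z v. frechet_derivative h (at (f z)) 1 * f' z v"])
        (auto intro!: smooth_expr.mult smooth_expr.comp[OF smooth_frechet_derivative])
  qed
qed

lemmas smooth_const = smooth_expr.const[THEN smooth_expr_smooth]
  and smooth_linear = smooth_expr.linear[THEN smooth_expr_smooth]
  and smooth_add = smooth_expr.add[OF smooth_expr.base smooth_expr.base, THEN smooth_expr_smooth]
  and smooth_mult = smooth_expr.mult[OF smooth_expr.base smooth_expr.base, THEN smooth_expr_smooth]
  and smooth_powr = smooth_expr.powr[OF smooth_expr.base, THEN smooth_expr_smooth]
  and smooth_ln = smooth_expr.ln[OF smooth_expr.base, THEN smooth_expr_smooth]
  and smooth_exp = smooth_expr.exp[OF smooth_expr.base, THEN smooth_expr_smooth]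
  and smooth_comp = smooth_expr.comp[OF _ smooth_expr.base, THEN smooth_expr_smooth]

lemma smooth_diff: "smooth f \<Longrightarrow> smooth g \<Longrightarrow> smooth (\<lambda>z. f z - g z)"
  using smooth_add[OF _ smooth_mult[OF smooth_const[of "-1"]], of f g] by simp

lemma smooth_sum: "(\<And>i. i \<in> I \<Longrightarrow> smooth (f i)) \<Longrightarrow> smooth (\<lambda>z. \<Sum>i\<in>I. f i z)"
proof (induction I rule: infinite_finite_induct)
  case (insert i I)
  then show ?case using smooth_add[of "f i" "\<lambda>z. \<Sum>i\<in>I. f i z"] by simp
qed (auto intro: smooth_const)

lemma smooth_real_deriv:
  assumes "smooth (h :: real \<Rightarrow> real)"
  shows "(h has_real_derivative deriv h x) (at x)" "smooth (deriv h)" "continuous_on S (deriv h)"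
proof -
  show d: "(h has_real_derivative deriv h x) (at x)" for x
    using smooth_differentiable[OF assms] DERIV_deriv_iff_real_differentiable by blast
  have "deriv h = (\<lambda>x. frechet_derivative h (at x) 1)"
    using frechet_derivative_at[OF d[unfolded has_field_derivative_def]] by (metis mult.right_neutral)
  then show "smooth (deriv h)"
    using smooth_frechet_derivative[OF assms] by simp
  then show "continuous_on S (deriv h)"
    by (rule smooth_continuous_on)
qed

section \<open>A smooth step built from the flat function \<open>exp (- 1 / x)\<close>\<close>

definition exp_flat :: "nat \<Rightarrow> real \<Rightarrow> real" where
  "exp_flat k x = (if x > 0 then (1 / x) ^ k * exp (- (1 / x)) else 0)"

lemma exp_flat_tendsto_0: "(exp_flat k \<longlongrightarrow> 0) (at 0)"
proof -
  have "((\<lambda>x. (1 / x) ^ k / exp (1 / x)) \<longlongrightarrow> 0) (at_right (0::real))"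
    using filterlim_compose[OF tendsto_power_div_exp_0 filterlim_inverse_at_top_right]
    by (simp add: inverse_eq_divide)
  then have "(exp_flat k \<longlongrightarrow> 0) (at_right 0)"
    by (rule Lim_transform_eventually)
      (auto simp: eventually_at_filter exp_flat_def exp_minus field_simps)
  moreover have "(exp_flat k \<longlongrightarrow> 0) (at_left 0)"
    by (rule Lim_transform_eventually[OF tendsto_const])
      (auto simp: eventually_at_filter exp_flat_def)
  ultimately show ?thesis by (simp add: filterlim_at_split)
qed

lemma exp_flat_has_real_derivative:
  "(exp_flat k has_real_derivative - real k * exp_flat (Suc k) x + exp_flat (Suc (Suc k)) x) (at x)"
proof -
  consider "x < 0" | "x = 0" | "x > 0" by linarith
  then show ?thesis
  proof cases
    case 1
    have "((\<lambda>_. 0) has_real_derivative 0) (at x)" by simp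
    then have "(exp_flat k has_real_derivative 0) (at x)"
      by (rule has_field_derivative_transform_within_open[where S = "{..<0}"])
        (use 1 in \<open>auto simp: exp_flat_def\<close>)
    then show ?thesis using 1 by (simp add: exp_flat_def)
  next
    case 2
    \<comment> \<open>The difference quotient of \<open>exp_flat k\<close> at 0 is
      \<open>exp_flat (Suc k)\<close> itself.\<close>
    have "((\<lambda>h. (exp_flat k (0 + h) - exp_flat k 0) / h) \<longlongrightarrow> 0) (at 0)"
      by (rule Lim_transform_eventually[OF exp_flat_tendsto_0[of "Suc k"]])
        (auto simp: exp_flat_def eventually_at_filter)
    then show ?thesis using 2 by (simp add: DERIV_def exp_flat_def)
  next
    case 3
    have "((\<lambda>x. inverse x ^ k * exp (- inverse x)) has_real_derivative
        - real k * exp_flat (Suc k) x + exp_flat (Suc (Suc k)) x) (at x)"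
    proof (rule DERIV_cong)
      show "((\<lambda>x. inverse x ^ k * exp (- inverse x)) has_real_derivative
          inverse x ^ k * (exp (- inverse x) * (inverse x * inverse x))
          + real k * inverse x ^ (k - 1) * (- (inverse x * inverse x)) * exp (- inverse x)) (at x)"
        using 3 by (auto intro!: derivative_eq_intros)
      \<comment> \<open>For \<open>k = 0\<close> the truncated exponent \<open>k - 1\<close> is
        harmless, since the factor \<open>real k\<close> vanishes.\<close>
      have "real k * inverse x ^ (k - 1) * (inverse x * inverse x) = real k * inverse x ^ Suc k"
        by (cases k) auto
      then show "inverse x ^ k * (exp (- inverse x) * (inverse x * inverse x))
          + real k * inverse x ^ (k - 1) * (- (inverse x * inverse x)) * exp (- inverse x)
          = - real k * exp_flat (Suc k) x + exp_flat (Suc (Suc k)) x"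
        using 3 by (simp add: exp_flat_def flip: inverse_eq_divide)
    qed
    then show ?thesis
      by (rule has_field_derivative_transform_within_open[where S = "{0<..}"])
        (use 3 in \<open>auto simp: exp_flat_def inverse_eq_divide\<close>)
  qed
qed

text \<open>Differentiation raises the index by one or two, so no single \<open>exp_flat k\<close>
  is closed under it, but the linear span of the whole family is.\<close>

inductive exp_flat_span :: "(real \<Rightarrow> real) \<Rightarrow> bool" where
  base: "exp_flat_span (exp_flat k)"
| add: "exp_flat_span f \<Longrightarrow> exp_flat_span g \<Longrightarrow> exp_flat_span (\<lambda>x. f x + g x)"
| cmult: "exp_flat_span f \<Longrightarrow> exp_flat_span (\<lambda>x. c * f x)"

lemma smooth_exp_flat: "smooth (exp_flat k)"
proof (rule smooth_coinduct[where P = exp_flat_span])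
  fix g assume "exp_flat_span g"
  then have "\<exists>g'. (\<forall>x. (g has_real_derivative g' x) (at x)) \<and> exp_flat_span g'"
  proof induction
    case (base k)
    have "exp_flat_span (\<lambda>x. - real k * exp_flat (Suc k) x + exp_flat (Suc (Suc k)) x)"
      by (intro exp_flat_span.intros)
    then show ?case using exp_flat_has_real_derivative[of k]
      by (intro exI[of _ "\<lambda>x. - real k * exp_flat (Suc k) x + exp_flat (Suc (Suc k)) x"]) simp
  next
    case (add f g)
    then obtain f' g' where "\<forall>x. (f has_real_derivative f' x) (at x)" "exp_flat_span f'"
      "\<forall>x. (g has_real_derivative g' x) (at x)" "exp_flat_span g'" by blast
    then show ?case
      by (intro exI[of _ "\<lambda>x. f' x + g' x"]) (auto intro: DERIV_add exp_flat_span.add)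
  next
    case (cmult f c)
    then obtain f' where "\<forall>x. (f has_real_derivative f' x) (at x)" "exp_flat_span f'" by blast
    then show ?case
      by (intro exI[of _ "\<lambda>x. c * f' x"]) (auto intro: DERIV_cmult exp_flat_span.cmult)
  qed
  then obtain g' where "\<forall>x. (g has_real_derivative g' x) (at x)" "exp_flat_span g'" by blast
  then show "\<exists>g'. (\<forall>z. (g has_derivative g' z) (at z)) \<and> (\<forall>v. exp_flat_span (\<lambda>z. g' z v))"
    by (intro exI[of _ "\<lambda>x v. v * g' x"])
      (auto simp: has_field_derivative_def mult_commute_abs intro: exp_flat_span.cmult)
qed (rule exp_flat_span.base)

text \<open>The usual quotient \<open>f x / (f x + f (1 - x))\<close>, with the power
  \<open>-1\<close> in place of division so that \<open>smooth_powr\<close> applies.\<close>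

definition smooth_step :: "real \<Rightarrow> real" where
  "smooth_step x = exp_flat 0 x * (exp_flat 0 x + exp_flat 0 (1 - x)) powr (-1)"

lemma exp_flat_0: "exp_flat 0 x \<ge> 0" "x > 0 \<Longrightarrow> exp_flat 0 x > 0" "x \<le> 0 \<Longrightarrow> exp_flat 0 x = 0"
  by (auto simp: exp_flat_def)

lemma smooth_step_denom: "exp_flat 0 x + exp_flat 0 (1 - x) > 0"
  using exp_flat_0[of x] exp_flat_0[of "1 - x"] by (cases "x > 0") auto

lemma smooth_step_eq: "smooth_step x = exp_flat 0 x / (exp_flat 0 x + exp_flat 0 (1 - x))"
  using smooth_step_denom[of x] by (simp add: smooth_step_def powr_minus_divide)

lemma smooth_step_bounds: "0 \<le> smooth_step x" "smooth_step x \<le> 1"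
  using exp_flat_0(1)[of x] exp_flat_0(1)[of "1 - x"]
  by (auto simp: smooth_step_eq divide_le_eq_1)

lemma smooth_step_0: "x \<le> 0 \<Longrightarrow> smooth_step x = 0"
  by (simp add: smooth_step_eq exp_flat_0)

lemma smooth_step_1: "x \<ge> 1 \<Longrightarrow> smooth_step x = 1"
  using exp_flat_0(2)[of x] by (simp add: smooth_step_eq exp_flat_0(3)[of "1 - x"])

lemma smooth_real_affine: "smooth (\<lambda>x::real. c * x + d)"
  by (intro smooth_add smooth_const smooth_linear bounded_linear_mult_right)

lemma smooth_smooth_step: "smooth smooth_step"
  unfolding smooth_step_def[abs_def]
proof (intro smooth_mult smooth_powr smooth_add)
  have "smooth (\<lambda>x. exp_flat 0 ((-1) * x + 1))"
    by (intro smooth_comp[OF smooth_exp_flat] smooth_real_affine)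
  then show "smooth (\<lambda>x. exp_flat 0 (1 - x))" by simp
qed (auto intro: smooth_exp_flat smooth_step_denom)

text \<open>At these points the step attains its global minimum 0 or maximum 1; the argument covers
  the endpoints 0 and 1 without one-sided derivatives.\<close>

lemma deriv_smooth_step_0: "x \<le> 0 \<or> x \<ge> 1 \<Longrightarrow> deriv smooth_step x = 0"
proof (elim disjE)
  note d = smooth_real_deriv(1)[OF smooth_smooth_step, of x]
  show "deriv smooth_step x = 0" if "x \<le> 0"
    by (rule DERIV_local_min[OF d, of 1]) (use that smooth_step_bounds smooth_step_0 in auto)
  show "deriv smooth_step x = 0" if "x \<ge> 1"
    by (rule DERIV_local_max[OF d, of 1]) (use that smooth_step_bounds smooth_step_1 in auto)
qed

lemma deriv_smooth_step_bounded: obtains M where "M \<ge> 0" "\<And>x. \<bar>deriv smooth_step x\<bar> \<le> M"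
proof -
  have "compact (deriv smooth_step ` {0..1})"
    by (intro compact_continuous_image smooth_real_deriv smooth_smooth_step) auto
  then obtain M where M: "\<And>x. x \<in> {0..1} \<Longrightarrow> \<bar>deriv smooth_step x\<bar> \<le> M"
    using compact_imp_bounded by (fastforce simp: bounded_iff)
  from M[of 0] have "M \<ge> 0" by force
  moreover have "\<bar>deriv smooth_step x\<bar> \<le> M" for x
    using M[of x] deriv_smooth_step_0[of x] \<open>M \<ge> 0\<close> by (cases "x \<in> {0..1}") auto
  ultimately show ?thesis using that by blast
qed

text \<open>Unlike the identity, this is positive everywhere and so has smooth real powers.\<close>

definition pos_id :: "real \<Rightarrow> real" where
  "pos_id s = 1 + smooth_step s * (s - 1)"

lemma pos_id_eq: "s \<ge> 1 \<Longrightarrow> pos_id s = s"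
  by (simp add: pos_id_def smooth_step_1)

lemma pos_id_pos: "pos_id s > 0"
proof -
  consider "s \<le> 0" | "s \<ge> 1" | "0 < s" "s < 1" by linarith
  then show ?thesis
  proof cases
    case 3
    then have "smooth_step s * (1 - s) \<le> 1 * (1 - s)"
      using smooth_step_bounds[of s] by (intro mult_right_mono) auto
    then show ?thesis using 3 by (simp add: pos_id_def algebra_simps)
  qed (simp_all add: pos_id_def smooth_step_0 smooth_step_1)
qed

lemma smooth_pos_id: "smooth pos_id"
proof -
  have "smooth (\<lambda>s. 1 + smooth_step s * (1 * s + (- 1)))"
    by (intro smooth_add smooth_const smooth_mult smooth_smooth_step smooth_real_affine)
  then show ?thesis by (simp add: pos_id_def[abs_def])
qed

section \<open>The homogeneous norm and the dilations\<close>

lemma nn_integral_lborel_scaleR: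
  fixes f :: "'a::euclidean_space \<Rightarrow> ennreal"
  assumes [measurable]: "f \<in> borel_measurable borel" and "c > 0"
  shows "(\<integral>\<^sup>+x. f (c *\<^sub>R x) \<partial>lborel) = ennreal (1 / c ^ DIM('a)) * (\<integral>\<^sup>+x. f x \<partial>lborel)"
proof -
  have "(\<integral>\<^sup>+x. f x \<partial>lborel)
      = (\<integral>\<^sup>+x. f x \<partial>density (distr lborel borel (\<lambda>x. 0 + c *\<^sub>R x)) (\<lambda>_. \<bar>c\<bar> ^ DIM('a)))"
    using lborel_affine[of c "0::'a"] assms by simp
  also have "\<dots> = ennreal (c ^ DIM('a)) * (\<integral>\<^sup>+x. f (c *\<^sub>R x) \<partial>lborel)"
    using assms by (simp add: nn_integral_density nn_integral_distr nn_integral_cmult)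
  finally show ?thesis
    using assms by (simp add: mult.assoc[symmetric] ennreal_mult[symmetric])
qed

lemma norm_axis_real: "norm (axis i (c::real)) = \<bar>c\<bar>"
  by (simp add: norm_eq_sqrt_inner inner_axis_axis flip: power2_eq_square)

text \<open>The degenerate set of the vector fields is a null set, so pointwise estimates may divide
  by powers of \<open>norm (fst z)\<close>.\<close>

lemma AE_fst_nonzero: "AE z in lborel. fst (z :: 'a::euclidean_space \<times> 'b::euclidean_space) \<noteq> 0"
proof (rule AE_I)
  show "{z \<in> space lborel. \<not> fst (z :: 'a \<times> 'b) \<noteq> 0} \<subseteq> {0} \<times> UNIV" by auto
  show "emeasure lborel ({0::'a} \<times> (UNIV :: 'b set)) = 0"
    unfolding lborel_prod[symmetric] by (subst lborel.emeasure_pair_measure_Times) auto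
  show "{0::'a} \<times> (UNIV :: 'b set) \<in> sets lborel"
    by (simp add: borel_closed closed_Times)
qed

lemma frechet_derivative_components:
  fixes \<phi> :: "(real^'n::finite) \<times> (real^'k::finite) \<Rightarrow> real"
  assumes "\<phi> differentiable (at z)"
  shows "frechet_derivative \<phi> (at z) (a, b) =
    a \<bullet> (\<chi> i. frechet_derivative \<phi> (at z) (axis i 1, 0)) + b \<bullet> (\<chi> j. frechet_derivative \<phi> (at z) (0, axis j 1))"
proof -
  let ?D = "frechet_derivative \<phi> (at z)"
  have lin: "linear ?D" using assms by (rule linear_frechet_derivative)
  have "(a, b) = (\<Sum>i\<in>UNIV. a $ i *\<^sub>R (axis i 1, 0)) + (\<Sum>j\<in>UNIV. b $ j *\<^sub>R (0, axis j 1))"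
    using basis_expansion[of a] basis_expansion[of b]
    by (simp add: prod_eq_iff fst_sum snd_sum scalar_mult_eq_scaleR)
  then have "?D (a, b) = (\<Sum>i\<in>UNIV. a $ i * ?D (axis i 1, 0)) + (\<Sum>j\<in>UNIV. b $ j * ?D (0, axis j 1))"
    by (simp only: linear_add[OF lin] linear_sum[OF lin] linear_scale[OF lin] real_scaleR_def)
  then show ?thesis by (simp add: inner_vec_def)
qed

lemma borel_measurable_rpow[measurable]:
  assumes [measurable]: "f \<in> borel_measurable M"
  shows "(\<lambda>x. rpow (f x) t) \<in> borel_measurable M"
  unfolding rpow_def by simp

lemma rpow_nonneg: "rpow a t \<ge> 0"
  by (simp add: rpow_def)

lemma rpow_pos: "a > 0 \<Longrightarrow> rpow a t = a powr t"
  by (simp add: rpow_def)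

lemma rpow_le_1: "0 \<le> a \<Longrightarrow> a \<le> 1 \<Longrightarrow> 0 \<le> t \<Longrightarrow> rpow a t \<le> 1"
  by (simp add: rpow_def powr_le1)

lemma borel_measurable_smooth: "smooth f \<Longrightarrow> f \<in> borel_measurable borel"
  by (intro borel_measurable_continuous_onI smooth_continuous_on)

lemma borel_measurable_grad_gamma:
  fixes \<phi> :: "(real^'n::finite) \<times> (real^'k::finite) \<Rightarrow> real"
  assumes "smooth \<phi>"
  shows "grad_gamma \<gamma> \<phi> \<in> borel_measurable borel"
proof -
  have [measurable]: "(\<lambda>z. frechet_derivative \<phi> (at z) v) \<in> borel_measurable borel" for v
    using assms by (intro borel_measurable_smooth smooth_frechet_derivative)
  have [measurable]: "(\<lambda>z::(real^'n) \<times> (real^'k). norm (fst z)) \<in> borel_measurable borel"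
    by (intro borel_measurable_continuous_onI continuous_intros)
  have 1: "(\<lambda>z. \<chi> i. frechet_derivative \<phi> (at z) (axis i 1, 0)) \<in> borel_measurable borel"
    and 2: "(\<lambda>z. \<chi> j. frechet_derivative \<phi> (at z) (0, axis j 1)) \<in> borel_measurable borel"
    by (simp_all add: borel_measurable_euclidean_space[of "\<lambda>z. \<chi> i. _ z i"] Basis_vec_def
        inner_axis)
  show ?thesis
    unfolding grad_gamma_def[abs_def]
    by (intro borel_measurable_Pair borel_measurable_scaleR 1 2) measurable
qed

text \<open>The \<open>itself\<close> parameter pins down the two dimension types, on which
  \<open>Q\<close> depends.\<close>

locale grushin =
  fixes \<gamma> :: real
    and Ntype :: "((real^'n::finite) \<times> (real^'k::finite)) itself"
  assumes gamma_nonneg: "\<gamma> \<ge> 0"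
begin

abbreviation \<rho> :: "(real^'n) \<times> (real^'k) \<Rightarrow> real" where "\<rho> \<equiv> gnorm \<gamma>"

definition Q :: real where "Q = real CARD('n) + (1 + \<gamma>) * real CARD('k)"

lemma Q_pos: "Q > 0"
  using gamma_nonneg by (simp add: Q_def add_pos_nonneg)

definition gsq :: "(real^'n) \<times> (real^'k) \<Rightarrow> real" where
  "gsq z = norm (fst z) powr (2 * (1 + \<gamma>)) + (1 + \<gamma>)\<^sup>2 * (norm (snd z))\<^sup>2"

lemma gnorm_gsq: "\<rho> z = gsq z powr (1 / (2 + 2 * \<gamma>))"
  by (simp add: gnorm_def gsq_def)

lemma gsq_nonneg: "gsq z \<ge> 0"
  by (simp add: gsq_def)

lemma gnorm_nonneg: "\<rho> z \<ge> 0"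
  by (simp add: gnorm_gsq)

lemma gnorm_powr: "\<rho> z powr (2 + 2 * \<gamma>) = gsq z"
  using gamma_nonneg gsq_nonneg by (simp add: gnorm_gsq powr_powr)

lemma gsq_eq_0_iff: "gsq z = 0 \<longleftrightarrow> z = 0"
  using gamma_nonneg by (auto simp: gsq_def add_nonneg_eq_0_iff prod_eq_iff)

lemma gnorm_eq_0_iff: "\<rho> z = 0 \<longleftrightarrow> z = 0"
  by (simp add: gnorm_gsq gsq_eq_0_iff)

lemma gnorm_pos: "z \<noteq> 0 \<Longrightarrow> \<rho> z > 0"
  using gnorm_eq_0_iff gnorm_nonneg by (metis less_eq_real_def)

lemma norm_fst_le_gnorm: "norm (fst z) \<le> \<rho> z"
proof -
  have "norm (fst z) powr (2 + 2 * \<gamma>) \<le> \<rho> z powr (2 + 2 * \<gamma>)"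
    unfolding gnorm_powr by (simp add: gsq_def algebra_simps)
  then show ?thesis
    using gamma_nonneg gnorm_nonneg[of z] powr_less_mono2[of "2 + 2 * \<gamma>" "\<rho> z" "norm (fst z)"] by force
qed

lemma norm_snd_le_gnorm: "norm (snd z) \<le> \<rho> z powr (1 + \<gamma>)"
proof -
  have "(norm (snd z))\<^sup>2 \<le> (1 + \<gamma>)\<^sup>2 * (norm (snd z))\<^sup>2"
    using gamma_nonneg mult_right_mono[of 1 "(1 + \<gamma>)\<^sup>2" "(norm (snd z))\<^sup>2"] by (simp add: one_le_power)
  also have "\<dots> \<le> \<rho> z powr (2 + 2 * \<gamma>)"
    unfolding gnorm_powr by (simp add: gsq_def)
  also have "\<dots> = (\<rho> z powr (1 + \<gamma>))\<^sup>2"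
    by (simp add: powr_add[symmetric] power2_eq_square)
  finally show ?thesis by (rule power2_le_imp_le) simp
qed

lemma bounded_gnorm_le: "bounded {z. \<rho> z \<le> r}"
proof (rule boundedI)
  fix z assume "z \<in> {z. \<rho> z \<le> r}"
  then have r: "\<rho> z \<le> r" by simp
  have "norm z \<le> norm (fst z) + norm (snd z)"
    using norm_Pair_le[of "fst z" "snd z"] by simp
  also have "\<dots> \<le> r + r powr (1 + \<gamma>)"
    using r norm_fst_le_gnorm[of z] norm_snd_le_gnorm[of z] gamma_nonneg gnorm_nonneg[of z]
      powr_mono2[of "1 + \<gamma>" "\<rho> z" r] by linarith
  finally show "norm z \<le> r + r powr (1 + \<gamma>)" .
qed

text \<open>Below radius 1 the bound \<open>\<rho> powr (1 + \<gamma>)\<close> for the second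
  component is at most \<open>\<rho>\<close>. This places small gauge balls inside the Euclidean
  ball in the sharpness hypothesis.\<close>

lemma norm_le_gnorm: "\<rho> z \<le> 1 \<Longrightarrow> norm z \<le> 2 * \<rho> z"
  using norm_Pair_le[of "fst z" "snd z"] norm_fst_le_gnorm[of z] norm_snd_le_gnorm[of z]
    powr_mono'[of 1 "1 + \<gamma>" "\<rho> z"] gamma_nonneg gnorm_nonneg[of z] by simp

lemma continuous_on_gnorm: "continuous_on S \<rho>"
  unfolding gnorm_def using gamma_nonneg
  by (intro continuous_on_powr' continuous_intros) (auto simp: add_nonneg_eq_0_iff)

lemma borel_measurable_gnorm[measurable]: "\<rho> \<in> borel_measurable borel"
  by (intro borel_measurable_continuous_onI continuous_on_gnorm)

lemma borel_measurable_norm_fst[measurable]: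
  "(\<lambda>z::(real^'n) \<times> (real^'k). norm (fst z)) \<in> borel_measurable borel"
  by (intro borel_measurable_continuous_onI continuous_intros)

section \<open>Anisotropic dilations in additive time and the measure they preserve\<close>

definition dil :: "real \<Rightarrow> (real^'n) \<times> (real^'k) \<Rightarrow> (real^'n) \<times> (real^'k)" where
  "dil t z = (exp t *\<^sub>R fst z, exp ((1 + \<gamma>) * t) *\<^sub>R snd z)"

lemma dil_0[simp]: "dil 0 z = z"
  by (simp add: dil_def)

lemma dil_eq_0_iff[simp]: "dil t z = 0 \<longleftrightarrow> z = 0"
  by (simp add: dil_def prod_eq_iff)

lemma gsq_dil: "gsq (dil t z) = exp ((2 + 2 * \<gamma>) * t) * gsq z"
proof -
  have "(exp t * norm (fst z)) powr (2 * (1 + \<gamma>)) = exp ((2 + 2 * \<gamma>) * t) * norm (fst z) powr (2 * (1 + \<gamma>))"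
    by (simp add: powr_mult exp_powr_real algebra_simps)
  moreover have "(exp ((1 + \<gamma>) * t))\<^sup>2 = exp ((2 + 2 * \<gamma>) * t)"
    by (simp add: exp_double[symmetric] algebra_simps)
  ultimately show ?thesis
    by (simp add: gsq_def dil_def power_mult_distrib algebra_simps)
qed

lemma gnorm_dil: "\<rho> (dil t z) = exp t * \<rho> z"
  using gamma_nonneg by (simp add: gnorm_gsq gsq_dil powr_mult exp_powr_real gsq_nonneg)

lemma ln_gnorm_dil: "z \<noteq> 0 \<Longrightarrow> ln (\<rho> (dil t z)) = ln (\<rho> z) + t"
  using gnorm_pos[of z] by (simp add: gnorm_dil ln_mult)

lemma continuous_on_dil: "continuous_on S (\<lambda>z. dil (fst z) (snd z))"
  unfolding dil_def by (intro continuous_intros)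

lemma measurable_dil2[measurable]:
  "(\<lambda>z. dil (fst z) (snd z)) \<in> borel \<Otimes>\<^sub>M borel \<rightarrow>\<^sub>M borel"
  unfolding borel_prod by (intro borel_measurable_continuous_onI continuous_on_dil)

lemma measurable_dil[measurable]: "dil t \<in> borel_measurable borel"
  unfolding dil_def[abs_def] by (intro borel_measurable_continuous_onI continuous_intros)

text \<open>After Fubini each factor is rescaled separately; the exponents \<open>n\<close> and
  \<open>(1 + \<gamma>) * k\<close> add up to \<open>Q\<close>, which is why \<open>Q\<close> is the
  homogeneous dimension.\<close>

lemma nn_integral_dil:
  fixes f :: "(real^'n) \<times> (real^'k) \<Rightarrow> ennreal"
  assumes [measurable]: "f \<in> borel_measurable borel"
  shows "(\<integral>\<^sup>+z. f (dil t z) \<partial>lborel) = ennreal (exp (- Q * t)) * (\<integral>\<^sup>+z. f z \<partial>lborel)"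
proof -
  let ?a = "1 / exp t ^ CARD('n)" and ?b = "1 / exp ((1 + \<gamma>) * t) ^ CARD('k)"
  have [measurable]: "f \<in> borel_measurable (borel \<Otimes>\<^sub>M borel)" by (simp add: borel_prod)
  have "(\<integral>\<^sup>+z. f (dil t z) \<partial>lborel)
      = (\<integral>\<^sup>+x. \<integral>\<^sup>+y. f (exp t *\<^sub>R x, exp ((1 + \<gamma>) * t) *\<^sub>R y) \<partial>lborel \<partial>lborel)"
    unfolding lborel_prod[symmetric]
    by (subst lborel.nn_integral_fst[symmetric]) (simp_all add: dil_def)
  also have "\<dots> = (\<integral>\<^sup>+x. ennreal ?b * (\<integral>\<^sup>+y. f (exp t *\<^sub>R x, y) \<partial>lborel) \<partial>lborel)"
  proof (intro nn_integral_cong)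
    fix x :: "real^'n"
    show "(\<integral>\<^sup>+y. f (exp t *\<^sub>R x, exp ((1 + \<gamma>) * t) *\<^sub>R y) \<partial>lborel)
        = ennreal ?b * (\<integral>\<^sup>+y. f (exp t *\<^sub>R x, y) \<partial>lborel)"
      using nn_integral_lborel_scaleR[of "\<lambda>y. f (exp t *\<^sub>R x, y)" "exp ((1 + \<gamma>) * t)"] by simp
  qed
  also have "\<dots> = ennreal ?b * (ennreal ?a * (\<integral>\<^sup>+x. \<integral>\<^sup>+y. f (x, y) \<partial>lborel \<partial>lborel))"
    by (simp add: nn_integral_cmult nn_integral_lborel_scaleR[where c = "exp t" and
          f = "\<lambda>x. \<integral>\<^sup>+y. f (x, y) \<partial>lborel"])
  also have "(\<integral>\<^sup>+x. \<integral>\<^sup>+y. f (x, y) \<partial>lborel \<partial>lborel) = (\<integral>\<^sup>+z. f z \<partial>lborel)"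
    unfolding lborel_prod[symmetric] by (subst lborel.nn_integral_fst[symmetric]) simp_all
  also have "ennreal ?b * (ennreal ?a * (\<integral>\<^sup>+z. f z \<partial>lborel)) = ennreal (?b * ?a) * (\<integral>\<^sup>+z. f z \<partial>lborel)"
    by (subst ennreal_mult'') (simp_all only: mult.assoc zero_le_divide_1_iff zero_le_power exp_ge_zero)
  also have "?b * ?a = exp (- Q * t)"
  proof -
    have "?b = exp (- (real CARD('k) * ((1 + \<gamma>) * t)))" and "?a = exp (- (real CARD('n) * t))"
      by (simp_all only: exp_minus exp_of_nat_mult divide_inverse mult_1_left)
    then show ?thesis
      using exp_add[of "- (real CARD('k) * ((1 + \<gamma>) * t))" "- (real CARD('n) * t)"]
      by (simp add: Q_def algebra_simps)
  qed
  finally show ?thesis .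
qed

text \<open>Homogeneous of degree \<open>- Q\<close>: the measure with this density is dilation invariant.\<close>

definition dens :: "real \<Rightarrow> (real^'n) \<times> (real^'k) \<Rightarrow> real" where
  "dens p z = \<rho> z powr (- Q) * rpow (norm (fst z) / \<rho> z) (\<gamma> * p)"

lemma borel_measurable_dens[measurable]: "dens p \<in> borel_measurable borel"
  unfolding dens_def[abs_def] by measurable

lemma dens_nonneg: "dens p z \<ge> 0"
  by (simp add: dens_def rpow_nonneg)

lemma dens_0[simp]: "dens p 0 = 0"
  by (simp add: dens_def gnorm_eq_0_iff[THEN iffD2])

lemma dens_dil: "dens p (dil t z) = exp (- Q * t) * dens p z"
proof -
  have "norm (fst (dil t z)) / \<rho> (dil t z) = norm (fst z) / \<rho> z"
    by (simp add: gnorm_dil) (simp add: dil_def)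
  then show ?thesis
    by (simp add: dens_def gnorm_dil powr_mult gnorm_nonneg exp_powr_real mult.commute)
qed

text \<open>The Jacobian of the dilation cancels against the homogeneity of
  \<open>dens\<close>.\<close>

lemma nn_integral_dens_dil:
  assumes [measurable]: "f \<in> borel_measurable borel"
  shows "(\<integral>\<^sup>+z. ennreal (dens p z) * f (dil t z) \<partial>lborel) = (\<integral>\<^sup>+z. ennreal (dens p z) * f z \<partial>lborel)"
proof -
  have "ennreal (dens p z) * f (dil t z)
      = ennreal (exp (Q * t)) * (ennreal (dens p (dil t z)) * f (dil t z))" for z
  proof -
    have "dens p z = exp (Q * t) * dens p (dil t z)"
      by (simp add: dens_dil mult.assoc[symmetric] exp_add[symmetric])
    then show ?thesis
      by (simp only: ennreal_mult dens_nonneg mult.assoc exp_ge_zero)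
  qed
  then have "(\<integral>\<^sup>+z. ennreal (dens p z) * f (dil t z) \<partial>lborel)
      = ennreal (exp (Q * t)) * (\<integral>\<^sup>+z. ennreal (dens p (dil t z)) * f (dil t z) \<partial>lborel)"
    by (simp add: nn_integral_cmult)
  also have "\<dots> = ennreal (exp (Q * t)) * (ennreal (exp (- Q * t)) * (\<integral>\<^sup>+z. ennreal (dens p z) * f z \<partial>lborel))"
    by (subst nn_integral_dil[of "\<lambda>z. ennreal (dens p z) * f z"]) auto
  also have "\<dots> = ennreal (exp (Q * t) * exp (- Q * t)) * (\<integral>\<^sup>+z. ennreal (dens p z) * f z \<partial>lborel)"
    by (simp add: ennreal_mult mult.assoc)
  also have "exp (Q * t) * exp (- Q * t) = 1" by (simp add: exp_add[symmetric])
  finally show ?thesis by simp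
qed

section \<open>Invariant mass of logarithmic shells\<close>

definition shell :: "real \<Rightarrow> real \<Rightarrow> ((real^'n) \<times> (real^'k)) set" where
  "shell a b = {z. a < ln (\<rho> z) \<and> ln (\<rho> z) \<le> b}"

lemma sets_shell[measurable]: "shell a b \<in> sets borel"
  unfolding shell_def by measurable

definition shell_mass :: "real \<Rightarrow> ennreal" where
  "shell_mass p = (\<integral>\<^sup>+z\<in>shell 0 1. ennreal (dens p z) \<partial>lborel)"

text \<open>The dilation \<open>dil a\<close> shifts \<open>ln \<rho>\<close> by \<open>a\<close>,
  so this is invariance of the measure. The value of \<open>ln \<rho>\<close> at the origin does not
  matter, since \<open>dens\<close> vanishes there.\<close>

lemma shell_mass_unit: "(\<integral>\<^sup>+z\<in>shell a (a + 1). ennreal (dens p z) \<partial>lborel) = shell_mass p"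
proof -
  have "(\<integral>\<^sup>+z\<in>shell 0 1. ennreal (dens p z) \<partial>lborel)
      = (\<integral>\<^sup>+z. ennreal (dens p z) * indicator (shell a (a + 1)) (dil a z) \<partial>lborel)"
  proof (rule nn_integral_cong)
    fix z show "ennreal (dens p z) * indicator (shell 0 1) z
        = ennreal (dens p z) * indicator (shell a (a + 1)) (dil a z)"
      by (cases "z = 0") (auto simp: shell_def ln_gnorm_dil indicator_def)
  qed
  then show ?thesis
    by (simp add: shell_mass_def nn_integral_dens_dil[of "indicator (shell a (a + 1))"])
qed

lemma shell_mass_nat:
  "(\<integral>\<^sup>+z\<in>shell a (a + real j). ennreal (dens p z) \<partial>lborel) = of_nat j * shell_mass p"
proof (induction j)
  case 0
  have "shell a a = {}" by (auto simp: shell_def)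
  then show ?case by simp
next
  case (Suc j)
  have "(\<integral>\<^sup>+z\<in>shell a (a + real (Suc j)). ennreal (dens p z) \<partial>lborel)
      = (\<integral>\<^sup>+z. ennreal (dens p z) * indicator (shell a (a + real j)) z
          + ennreal (dens p z) * indicator (shell (a + real j) (a + real j + 1)) z \<partial>lborel)"
    by (intro nn_integral_cong) (auto simp: shell_def indicator_def)
  also have "\<dots> = of_nat j * shell_mass p + shell_mass p"
    by (subst nn_integral_add) (auto simp: Suc shell_mass_unit)
  finally show ?case by (simp add: algebra_simps)
qed

lemma shell_mass_finite:
  assumes "p \<ge> 0" shows "shell_mass p < \<infinity>"
proof -
  have "shell_mass p \<le> (\<integral>\<^sup>+z. indicator {z. \<rho> z \<le> exp 1} z \<partial>lborel)"
    unfolding shell_mass_def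
  proof (rule nn_integral_mono)
    fix z :: "(real^'n) \<times> (real^'k)"
    show "ennreal (dens p z) * indicator (shell 0 1) z \<le> indicator {z. \<rho> z \<le> exp 1} z"
    proof (cases "z \<in> shell 0 1")
      case True
      then have r: "0 < ln (\<rho> z)" "ln (\<rho> z) \<le> 1"
        by (auto simp: shell_def)
      then have pos: "\<rho> z > 0"
        using gnorm_nonneg[of z] by (cases "\<rho> z = 0") auto
      have "\<rho> z powr (- Q) \<le> 1"
        using r pos Q_pos powr_mono[of "- Q" 0 "\<rho> z"] by (simp add: ln_gt_zero_iff)
      moreover have "rpow (norm (fst z) / \<rho> z) (\<gamma> * p) \<le> 1"
        using pos norm_fst_le_gnorm[of z] gamma_nonneg assms by (intro rpow_le_1) auto
      ultimately have "dens p z \<le> 1"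
        unfolding dens_def by (intro mult_le_one) (auto intro: rpow_nonneg)
      moreover have "\<rho> z \<le> exp 1"
        using r pos by (metis exp_le_cancel_iff exp_ln)
      ultimately show ?thesis by (simp add: indicator_def)
    qed simp
  qed
  also have "\<dots> = emeasure lborel {z. \<rho> z \<le> exp 1}"
    by (intro nn_integral_indicator) simp
  also have "\<dots> < \<infinity>"
    by (intro emeasure_bounded_finite bounded_gnorm_le)
  finally show ?thesis .
qed

text \<open>Positivity lets the mass of a long plateau grow without bound, while finiteness of the
  same quantity bounds the cost of the transition zones. It suffices that a nonempty open set with
  \<open>dens > 0\<close> lies in the shell.\<close>

lemma shell_mass_pos: "shell_mass p > 0"
proof -
  let ?U = "{z::(real^'n) \<times> (real^'k). 1 < \<rho> z \<and> \<rho> z < exp 1 \<and> 0 < norm (fst z)}"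
  have "open ?U"
    by (intro open_Collect_conj open_Collect_less continuous_on_gnorm continuous_intros)
  moreover have "?U \<noteq> {}"
  proof -
    \<comment> \<open>A point on the \<open>x\<close> axis at gauge radius
      \<open>exp (1 / 2)\<close>, hence strictly inside the shell and off the degenerate
      set.\<close>
    define z :: "(real^'n) \<times> (real^'k)" where "z = (axis undefined (exp (1 / 2)), 0)"
    have "\<rho> z = exp (1 / 2)"
      using gamma_nonneg by (simp add: gnorm_def z_def norm_axis_real powr_powr exp_powr_real)
    then have "z \<in> ?U" by (simp add: z_def norm_axis_real)
    then show ?thesis by blast
  qed
  ultimately have "\<not> negligible ?U"
    using open_not_negligible by blast
  then have "emeasure lborel ?U \<noteq> 0"
    using \<open>open ?U\<close> by (simp add: negligible_iff_emeasure0 borel_open)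
  moreover have "?U \<subseteq> {z \<in> space lborel. ennreal (dens p z) * indicator (shell 0 1) z \<noteq> 0}"
  proof
    fix z assume U: "z \<in> ?U"
    then have "dens p z > 0" by (auto simp: dens_def rpow_pos)
    moreover have "z \<in> shell 0 1"
      using U ln_less_cancel_iff[of "\<rho> z" "exp 1"] by (auto simp: shell_def simp del: ln_less_cancel_iff)
    ultimately show "z \<in> {z \<in> space lborel. ennreal (dens p z) * indicator (shell 0 1) z \<noteq> 0}"
      by simp
  qed
  ultimately have "emeasure lborel {z \<in> space lborel. ennreal (dens p z) * indicator (shell 0 1) z \<noteq> 0} \<noteq> 0"
    using emeasure_mono[of ?U "{z \<in> space lborel. ennreal (dens p z) * indicator (shell 0 1) z \<noteq> 0}" lborel]
    by (auto simp: le_zero_eq)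
  then have "shell_mass p \<noteq> 0"
    unfolding shell_mass_def by (subst nn_integral_0_iff) auto
  then show ?thesis by (simp add: zero_less_iff_neq_zero)
qed

section \<open>The derivative along the dilation flow\<close>

text \<open>The direction is the generator of \<open>dil\<close>, an anisotropic Euler
  field.\<close>

definition flow_deriv :: "((real^'n) \<times> (real^'k) \<Rightarrow> real) \<Rightarrow> (real^'n) \<times> (real^'k) \<Rightarrow> real" where
  "flow_deriv \<phi> z = frechet_derivative \<phi> (at z) (fst z, (1 + \<gamma>) *\<^sub>R snd z)"

lemma dil_has_derivative:
  "((\<lambda>t. dil t z) has_derivative (\<lambda>h. h *\<^sub>R (fst (dil t z), (1 + \<gamma>) *\<^sub>R snd (dil t z)))) (at t)"
proof -
  have "((\<lambda>t. exp t *\<^sub>R fst z) has_derivative (\<lambda>h. (h * exp t) *\<^sub>R fst z)) (at t)"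
    by (auto intro!: derivative_eq_intros)
  moreover have "((\<lambda>t. exp ((1 + \<gamma>) * t) *\<^sub>R snd z) has_derivative
      (\<lambda>h. (h * (1 + \<gamma>) * exp ((1 + \<gamma>) * t)) *\<^sub>R snd z)) (at t)"
    by (auto intro!: derivative_eq_intros simp: algebra_simps)
  ultimately have "((\<lambda>t. (exp t *\<^sub>R fst z, exp ((1 + \<gamma>) * t) *\<^sub>R snd z)) has_derivative
      (\<lambda>h. ((h * exp t) *\<^sub>R fst z, (h * (1 + \<gamma>) * exp ((1 + \<gamma>) * t)) *\<^sub>R snd z))) (at t)"
    by (rule has_derivative_Pair)
  then show ?thesis by (simp add: dil_def[abs_def] mult.assoc)
qed

lemma flow_has_real_derivative:
  assumes "smooth \<phi>"
  shows "((\<lambda>t. \<phi> (dil t z)) has_real_derivative flow_deriv \<phi> (dil t z)) (at t)"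
proof -
  let ?D = "frechet_derivative \<phi> (at (dil t z))"
  have "((\<lambda>t. \<phi> (dil t z)) has_derivative
      (\<lambda>h. ?D (h *\<^sub>R (fst (dil t z), (1 + \<gamma>) *\<^sub>R snd (dil t z))))) (at t)"
    by (rule has_derivative_compose[OF dil_has_derivative smooth_has_derivative[OF assms]])
  moreover have "linear ?D"
    using assms by (intro linear_frechet_derivative smooth_differentiable)
  ultimately show ?thesis
    by (simp only: linear_scale has_field_derivative_def flow_deriv_def mult_commute_abs real_scaleR_def)
qed

lemma flow_deriv_components:
  assumes "smooth \<phi>"
  shows "flow_deriv \<phi> z = fst z \<bullet> (\<chi> i. frechet_derivative \<phi> (at z) (axis i 1, 0))
    + (1 + \<gamma>) * (snd z \<bullet> (\<chi> j. frechet_derivative \<phi> (at z) (0, axis j 1)))"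
  unfolding flow_deriv_def
  by (subst frechet_derivative_components) (use assms in \<open>simp_all add: smooth_differentiable\<close>)

lemma continuous_on_flow_deriv:
  assumes "smooth \<phi>" shows "continuous_on S (flow_deriv \<phi>)"
proof -
  have [continuous_intros]: "continuous_on S (\<lambda>z. frechet_derivative \<phi> (at z) v)" for v
    using assms by (intro smooth_continuous_on smooth_frechet_derivative)
  show ?thesis
    unfolding flow_deriv_components[OF assms, abs_def]
    by (intro continuous_intros)
qed

text \<open>Multiplied by \<open>|x|^\<gamma>\<close>, the flow derivative is the inner product of
  \<open>grad_gamma\<close> with \<open>(|x|^\<gamma> x, (1 + \<gamma>) y)\<close>. The norm of this
  vector is exactly \<open>\<rho> powr (1 + \<gamma>)\<close>, which explains the factor
  \<open>(1 + \<gamma>)^2\<close> in \<open>gnorm\<close>.\<close>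

lemma flow_deriv_le:
  assumes "smooth \<phi>" "fst z \<noteq> 0"
  shows "\<bar>flow_deriv \<phi> z\<bar> * norm (fst z) powr \<gamma> \<le> norm (grad_gamma \<gamma> \<phi> z) * \<rho> z powr (1 + \<gamma>)"
proof -
  let ?A = "\<chi> i. frechet_derivative \<phi> (at z) (axis i 1, 0)"
    and ?B = "\<chi> j. frechet_derivative \<phi> (at z) (0, axis j 1)"
  let ?r = "norm (fst z) powr \<gamma>"
  have r: "rpow (norm (fst z)) \<gamma> = ?r" using assms by (simp add: rpow_pos)
  let ?v = "(?r *\<^sub>R fst z, (1 + \<gamma>) *\<^sub>R snd z)"
  have "flow_deriv \<phi> z * ?r = ?v \<bullet> grad_gamma \<gamma> \<phi> z"
    by (simp add: flow_deriv_components[OF assms(1)] grad_gamma_def r algebra_simps)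
  then have "\<bar>flow_deriv \<phi> z\<bar> * ?r \<le> norm ?v * norm (grad_gamma \<gamma> \<phi> z)"
    using Cauchy_Schwarz_ineq2[of ?v "grad_gamma \<gamma> \<phi> z"] by (simp add: abs_mult)
  moreover have "norm ?v = \<rho> z powr (1 + \<gamma>)"
  proof -
    have "norm ?v = sqrt (gsq z)"
    proof -
      have "(?r * norm (fst z))\<^sup>2 = norm (fst z) powr (2 * (1 + \<gamma>))"
        using assms(2) powr_add[of "norm (fst z)" "2 * \<gamma>" 2]
        by (simp add: power_mult_distrib powr_powr algebra_simps flip: powr_numeral)
      then show ?thesis
        using gamma_nonneg by (simp add: norm_Pair gsq_def power_mult_distrib)
    qed
    also have "\<dots> = sqrt ((\<rho> z powr (1 + \<gamma>))\<^sup>2)"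
      by (simp add: gnorm_powr[symmetric] power2_eq_square flip: powr_add)
    finally show ?thesis by simp
  qed
  ultimately show ?thesis by (simp add: mult.commute)
qed

text \<open>The factor \<open>(|x| / \<rho>) powr (\<gamma> * p)\<close> of the Hardy weight is
  precisely what Cauchy-Schwarz costs when the flow derivative is replaced by the gradient.\<close>

lemma dens_flow_deriv_le:
  assumes "smooth \<phi>" "fst z \<noteq> 0" "p > 0"
  shows "dens p z * \<bar>flow_deriv \<phi> z\<bar> powr p \<le> \<rho> z powr (p - Q) * norm (grad_gamma \<gamma> \<phi> z) powr p"
proof -
  let ?x = "norm (fst z)" and ?g = "norm (grad_gamma \<gamma> \<phi> z)"
  have x: "?x > 0" and r: "\<rho> z > 0"
    using assms(2) gnorm_pos[of z] by (auto simp: prod_eq_iff)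
  have "\<bar>flow_deriv \<phi> z\<bar> * (?x / \<rho> z) powr \<gamma> \<le> ?g * \<rho> z"
    using flow_deriv_le[OF assms(1,2)] x r by (simp add: powr_divide powr_add field_simps)
  then have "(\<bar>flow_deriv \<phi> z\<bar> * (?x / \<rho> z) powr \<gamma>) powr p \<le> (?g * \<rho> z) powr p"
    using assms(3) by (intro powr_mono2) auto
  then have "\<bar>flow_deriv \<phi> z\<bar> powr p * (?x / \<rho> z) powr (\<gamma> * p) \<le> ?g powr p * \<rho> z powr p"
    using x r by (simp add: powr_mult powr_powr)
  then have "\<rho> z powr (- Q) * (\<bar>flow_deriv \<phi> z\<bar> powr p * (?x / \<rho> z) powr (\<gamma> * p))
      \<le> \<rho> z powr (- Q) * (?g powr p * \<rho> z powr p)"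
    by (intro mult_left_mono) auto
  moreover have "\<rho> z powr (p - Q) = \<rho> z powr (- Q) * \<rho> z powr p"
    by (simp flip: powr_add)
  ultimately show ?thesis
    using x r by (simp add: dens_def rpow_pos mult_ac)
qed

end

section \<open>A Hardy inequality along the flow\<close>

text \<open>This is Young's inequality with conjugate exponents \<open>p\<close> and
  \<open>p / (p - 1)\<close>, arranged with only nonnegative terms so that it can be integrated in
  \<open>ennreal\<close>.\<close>

lemma powr_tangent_le:
  fixes p m f :: real
  assumes "1 < p" "0 \<le> m" "0 \<le> f"
  shows "p * m powr (p - 1) * f \<le> f powr p + (p - 1) * m powr p"
proof -
  let ?q = "p / (p - 1)"
  have "f * m powr (p - 1) \<le> f powr p / p + (m powr (p - 1)) powr ?q / ?q"
    using assms by (intro Youngs_inequality) (auto simp: field_simps)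
  also have "(m powr (p - 1)) powr ?q = m powr p"
    using assms by (simp add: powr_powr)
  finally have "p * (f * m powr (p - 1)) \<le> p * (f powr p / p + m powr p / ?q)"
    using assms by (intro mult_left_mono) auto
  also have "\<dots> = f powr p + (p - 1) * m powr p"
    using assms by (simp add: distrib_left)
  finally show ?thesis by (simp add: mult_ac)
qed

text \<open>Integrating the tangent inequality of \<open>x powr p\<close> at \<open>x = m\<close> against \<open>P\<close> gives Jensen's
  inequality without any integrability assumption.\<close>

lemma powr_le_nn_integral_powr:
  fixes g P :: "real \<Rightarrow> real"
  assumes "1 < p" "0 \<le> m"
    and [measurable]: "g \<in> borel_measurable borel" "P \<in> borel_measurable borel" "T \<in> sets borel"
    and pos: "\<And>t. t \<in> T \<Longrightarrow> P t > 0"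
    and g0: "\<And>t. g t \<ge> 0"
    and prob: "(\<integral>\<^sup>+t\<in>T. ennreal (P t) \<partial>lborel) \<le> 1"
    and le: "ennreal m \<le> (\<integral>\<^sup>+t\<in>T. ennreal (g t) \<partial>lborel)"
  shows "ennreal (m powr p) \<le> (\<integral>\<^sup>+t\<in>T. ennreal (g t powr p * P t powr (1 - p)) \<partial>lborel)"
proof (cases "m = 0")
  case False
  then have m: "m > 0" using assms by simp
  let ?X = "\<integral>\<^sup>+t\<in>T. ennreal (g t powr p * P t powr (1 - p)) \<partial>lborel"
  \<comment> \<open>The term \<open>?c\<close> is carried on both sides instead of being subtracted;
    it is finite, so it can be cancelled at the end.\<close>
  let ?c = "ennreal ((p - 1) * m powr p)"
  have "ennreal (m powr p) + ?c = ennreal (p * m powr (p - 1)) * ennreal m"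
  proof -
    have "p * m powr (p - 1) * m = m powr p + (p - 1) * m powr p"
      using m by (simp add: powr_diff field_simps)
    then show ?thesis using assms m by (simp flip: ennreal_mult ennreal_plus)
  qed
  also have "\<dots> \<le> ennreal (p * m powr (p - 1)) * (\<integral>\<^sup>+t\<in>T. ennreal (g t) \<partial>lborel)"
    using le by (rule mult_left_mono) simp
  also have "\<dots> = (\<integral>\<^sup>+t. ennreal (p * m powr (p - 1)) * (ennreal (g t) * indicator T t) \<partial>lborel)"
    by (simp add: nn_integral_cmult)
  also have "\<dots> \<le> (\<integral>\<^sup>+t. ennreal (g t powr p * P t powr (1 - p)) * indicator T t
      + ?c * (ennreal (P t) * indicator T t) \<partial>lborel)"
  proof (rule nn_integral_mono)
    fix t
    show "ennreal (p * m powr (p - 1)) * (ennreal (g t) * indicator T t)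
      \<le> ennreal (g t powr p * P t powr (1 - p)) * indicator T t + ?c * (ennreal (P t) * indicator T t)"
    proof (cases "t \<in> T")
      case True
      then have P: "P t > 0" by (rule pos)
      have "p * m powr (p - 1) * (g t / P t) \<le> (g t / P t) powr p + (p - 1) * m powr p"
        using assms g0[of t] P by (intro powr_tangent_le) auto
      then have "p * m powr (p - 1) * (g t / P t) * P t \<le> ((g t / P t) powr p + (p - 1) * m powr p) * P t"
        using P by (intro mult_right_mono) auto
      then have "p * m powr (p - 1) * g t \<le> g t powr p * P t powr (1 - p) + (p - 1) * m powr p * P t"
        using P g0[of t] by (simp add: powr_divide powr_diff algebra_simps)
      then show ?thesis
        using True P g0[of t] assms(1) by (simp add: less_imp_le flip: ennreal_mult ennreal_plus)
    qed simp
  qed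
  also have "\<dots> = ?X + ?c * (\<integral>\<^sup>+t\<in>T. ennreal (P t) \<partial>lborel)"
    by (subst nn_integral_add) (simp_all add: nn_integral_cmult)
  also have "\<dots> \<le> ?X + ?c"
    using mult_left_mono[OF prob, of ?c] by (intro add_left_mono) simp
  finally show ?thesis
    by (simp add: add.commute[of _ ?c] ennreal_add_left_cancel_le)
qed (use assms in simp)

context grushin
begin

text \<open>Jensen with the sub-probability \<open>P (r, _)\<close> bounds
  \<open>|\<phi> z|^p\<close> by an orbit integral of \<open>|Z|^p * P powr (1 - p)\<close>.
  Integrated against the invariant measure, the arrival point \<open>dil t z\<close> may be renamed
  \<open>z\<close>; the departure level then reads \<open>r - t\<close>. The remaining
  \<open>t\<close>-integral is the one bounded in \<open>dual\<close>, in the manner of a Schur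
  test.\<close>

lemma flow_hardy:
  fixes \<phi> Z :: "(real^'n) \<times> (real^'k) \<Rightarrow> real" and P :: "real \<times> real \<Rightarrow> real"
  assumes p: "1 < p"
    and [measurable]: "\<phi> \<in> borel_measurable borel" "Z \<in> borel_measurable borel"
      "T \<in> sets (borel \<Otimes>\<^sub>M borel)" "P \<in> borel_measurable (borel \<Otimes>\<^sub>M borel)"
      "w \<in> borel_measurable borel" "v \<in> borel_measurable borel"
    and w0: "\<And>r. w r \<ge> 0" and v0: "\<And>r. v r \<ge> 0"
    and le: "\<And>z. z \<noteq> 0 \<Longrightarrow>
      ennreal \<bar>\<phi> z\<bar> \<le> (\<integral>\<^sup>+t. ennreal \<bar>Z (dil t z)\<bar> * indicator T (ln (\<rho> z), t) \<partial>lborel)"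
    and pos: "\<And>r t. (r, t) \<in> T \<Longrightarrow> P (r, t) > 0"
    and prob: "\<And>r. (\<integral>\<^sup>+t. ennreal (P (r, t)) * indicator T (r, t) \<partial>lborel) \<le> 1"
    and dual: "\<And>r. (\<integral>\<^sup>+t. ennreal (P (r - t, t) powr (1 - p) * w (r - t)) * indicator T (r - t, t) \<partial>lborel)
        \<le> ennreal (v r)"
  shows "(\<integral>\<^sup>+z. ennreal (dens p z) * ennreal (\<bar>\<phi> z\<bar> powr p * w (ln (\<rho> z))) \<partial>lborel)
    \<le> (\<integral>\<^sup>+z. ennreal (dens p z) * ennreal (\<bar>Z z\<bar> powr p * v (ln (\<rho> z))) \<partial>lborel)"
proof -
  \<comment> \<open>\<open>F\<close> is written in terms of the arrival point, so
    \<open>ln (\<rho> z) - t\<close> is the level of departure and the change of variables applies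
    verbatim.\<close>
  define F where "F t z = ennreal (\<bar>Z z\<bar> powr p) *
    (ennreal (P (ln (\<rho> z) - t, t) powr (1 - p) * w (ln (\<rho> z) - t)) * indicator T (ln (\<rho> z) - t, t))" for t z
  have [measurable]: "case_prod F \<in> borel_measurable (borel \<Otimes>\<^sub>M borel)"
    unfolding F_def[abs_def] by measurable
  have [measurable]: "(\<lambda>z. F (snd z) (dil (snd z) (fst z))) \<in> borel_measurable (borel \<Otimes>\<^sub>M borel)"
    by (rule measurable_compose[of "\<lambda>z. (snd z, dil (snd z) (fst z))" _ "borel \<Otimes>\<^sub>M borel" "case_prod F",
          simplified])
      (auto intro!: measurable_Pair measurable_compose[OF _ measurable_dil2, of "\<lambda>z. (snd z, fst z)", simplified])
  have "(\<integral>\<^sup>+z. ennreal (dens p z) * ennreal (\<bar>\<phi> z\<bar> powr p * w (ln (\<rho> z))) \<partial>lborel)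
      \<le> (\<integral>\<^sup>+z. \<integral>\<^sup>+t. ennreal (dens p z) * F t (dil t z) \<partial>lborel \<partial>lborel)"
  proof (rule nn_integral_mono)
    fix z :: "(real^'n) \<times> (real^'k)"
    show "ennreal (dens p z) * ennreal (\<bar>\<phi> z\<bar> powr p * w (ln (\<rho> z)))
        \<le> (\<integral>\<^sup>+t. ennreal (dens p z) * F t (dil t z) \<partial>lborel)"
    proof (cases "z = 0")
      case False
      let ?r = "ln (\<rho> z)"
      let ?T = "{t. (?r, t) \<in> T}"
      have [measurable]: "?T \<in> sets borel" by measurable
      have [measurable]: "(\<lambda>t. dil t z) \<in> borel_measurable borel"
        by (rule measurable_compose[OF _ measurable_dil2, of "\<lambda>t. (t, z)", simplified]) simp
      have ind: "indicator T (?r, t) = (indicator ?T t :: ennreal)" for t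
        by (simp add: indicator_def)
      have "ennreal (\<bar>\<phi> z\<bar> powr p) \<le> (\<integral>\<^sup>+t\<in>?T. ennreal (\<bar>Z (dil t z)\<bar> powr p * P (?r, t) powr (1 - p)) \<partial>lborel)"
      proof (rule powr_le_nn_integral_powr[OF p])
        show "(\<lambda>t. \<bar>Z (dil t z)\<bar>) \<in> borel_measurable borel" by measurable
        show "(\<lambda>t. P (?r, t)) \<in> borel_measurable borel" by measurable
        show "ennreal \<bar>\<phi> z\<bar> \<le> (\<integral>\<^sup>+t\<in>?T. ennreal \<bar>Z (dil t z)\<bar> \<partial>lborel)"
          using le[OF False] by (simp add: ind)
        show "(\<integral>\<^sup>+t\<in>?T. ennreal (P (?r, t)) \<partial>lborel) \<le> 1"
          using prob[of ?r] by (simp add: ind)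
      qed (use pos in auto)
      then have "ennreal (w ?r) * ennreal (\<bar>\<phi> z\<bar> powr p)
          \<le> ennreal (w ?r) * (\<integral>\<^sup>+t\<in>?T. ennreal (\<bar>Z (dil t z)\<bar> powr p * P (?r, t) powr (1 - p)) \<partial>lborel)"
        by (rule mult_left_mono) simp
      also have "\<dots> = (\<integral>\<^sup>+t. F t (dil t z) \<partial>lborel)"
        using False w0
        by (subst nn_integral_cmult[symmetric])
          (measurable, simp add: F_def ln_gnorm_dil ind ennreal_mult mult_ac)
      finally have "ennreal (dens p z) * (ennreal (w ?r) * ennreal (\<bar>\<phi> z\<bar> powr p))
          \<le> ennreal (dens p z) * (\<integral>\<^sup>+t. F t (dil t z) \<partial>lborel)"
        by (rule mult_left_mono) simp
      also have "\<dots> = (\<integral>\<^sup>+t. ennreal (dens p z) * F t (dil t z) \<partial>lborel)"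
        by (rule nn_integral_cmult[symmetric])
          (rule measurable_compose[of "\<lambda>t. (z, t)" _ "borel \<Otimes>\<^sub>M borel" "\<lambda>z. F (snd z) (dil (snd z) (fst z))",
              simplified], auto)
      finally show ?thesis
        by (simp add: ennreal_mult'' w0 mult.commute)
    qed simp
  qed
  \<comment> \<open>The order is exchanged so that invariance can be used for each fixed
    \<open>t\<close>, and then exchanged back.\<close>
  also have "\<dots> = (\<integral>\<^sup>+t. \<integral>\<^sup>+z. ennreal (dens p z) * F t (dil t z) \<partial>lborel \<partial>lborel)"
    by (rule lborel_pair.Fubini') (simp add: case_prod_unfold)
  also have "\<dots> = (\<integral>\<^sup>+t. \<integral>\<^sup>+z. ennreal (dens p z) * F t z \<partial>lborel \<partial>lborel)"
    by (intro nn_integral_cong nn_integral_dens_dil) simp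
  also have "\<dots> = (\<integral>\<^sup>+z. \<integral>\<^sup>+t. ennreal (dens p z) * F t z \<partial>lborel \<partial>lborel)"
    by (rule lborel_pair.Fubini') simp
  also have "\<dots> \<le> (\<integral>\<^sup>+z. ennreal (dens p z) * ennreal (\<bar>Z z\<bar> powr p * v (ln (\<rho> z))) \<partial>lborel)"
  proof (rule nn_integral_mono)
    fix z :: "(real^'n) \<times> (real^'k)"
    have "(\<integral>\<^sup>+t. ennreal (dens p z) * F t z \<partial>lborel)
        = ennreal (dens p z) * (ennreal (\<bar>Z z\<bar> powr p) * (\<integral>\<^sup>+t. ennreal (P (ln (\<rho> z) - t, t) powr (1 - p)
          * w (ln (\<rho> z) - t)) * indicator T (ln (\<rho> z) - t, t) \<partial>lborel))"
      unfolding F_def by (subst nn_integral_cmult; (subst nn_integral_cmult)?; measurable)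
    also have "\<dots> \<le> ennreal (dens p z) * (ennreal (\<bar>Z z\<bar> powr p) * ennreal (v (ln (\<rho> z))))"
      by (intro mult_left_mono dual) auto
    finally show "(\<integral>\<^sup>+t. ennreal (dens p z) * F t z \<partial>lborel)
        \<le> ennreal (dens p z) * ennreal (\<bar>Z z\<bar> powr p * v (ln (\<rho> z)))"
      by (simp add: ennreal_mult v0)
  qed
  finally show ?thesis .
qed

end

section \<open>From test functions to the completion\<close>

text \<open>Convexity of \<open>x powr p\<close> with weights \<open>s\<close> and
  \<open>1 - s\<close>. It replaces Minkowski's inequality, which would need \<open>p\<close>-th
  roots of extended integrals; the first coefficient tends to 1 as \<open>s\<close> tends to
  1.\<close>

lemma powr_add_le:
  fixes a b s p :: real
  assumes "1 < p" "0 < s" "s < 1" "0 \<le> a" "0 \<le> b"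
  shows "(a + b) powr p \<le> s powr (1 - p) * a powr p + (1 - s) powr (1 - p) * b powr p"
proof -
  let ?c = "a + b" and ?q = "1 - s"
  \<comment> \<open>The tangent inequality at \<open>a + b\<close> for the argument
    \<open>x / r\<close>, times \<open>r\<close>. Used for \<open>(s, a)\<close> and
    \<open>(1 - s, b)\<close>, it leaves correction terms that sum to
    \<open>(p - 1) * (a + b) powr p\<close>.\<close>
  have le: "p * ?c powr (p - 1) * x \<le> r powr (1 - p) * x powr p + r * ((p - 1) * ?c powr p)"
    if "0 < r" "0 \<le> x" for r x
  proof -
    have "p * ?c powr (p - 1) * (x / r) * r \<le> ((x / r) powr p + (p - 1) * ?c powr p) * r"
      using assms that by (intro mult_right_mono powr_tangent_le) auto
    then show ?thesis
      using that by (simp add: powr_divide powr_diff algebra_simps)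
  qed
  have "?c powr (p - 1) * ?c = ?c powr p"
    using assms by (cases "?c = 0") (auto simp: powr_diff)
  then have "p * ?c powr p = p * ?c powr (p - 1) * a + p * ?c powr (p - 1) * b"
    by (simp flip: distrib_left add: mult.assoc)
  also have "\<dots> \<le> (s powr (1 - p) * a powr p + s * ((p - 1) * ?c powr p))
      + (?q powr (1 - p) * b powr p + ?q * ((p - 1) * ?c powr p))"
    using assms by (intro add_mono le) auto
  also have "\<dots> = s powr (1 - p) * a powr p + ?q powr (1 - p) * b powr p + (p - 1) * ?c powr p"
    by (simp add: algebra_simps)
  finally show ?thesis by (simp add: algebra_simps)
qed

text \<open>The left side passes to the limit by Fatou, using almost everywhere convergence. On the
  right the gradient of the test function is split into \<open>G\<close> and an error with weights
  \<open>s\<close> and \<open>1 - s\<close>; the error vanishes along the sequence, and then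
  \<open>s\<close> tends to 1 from below.\<close>

lemma DL_inequality:
  fixes u :: "(real^'n::finite) \<times> (real^'k::finite) \<Rightarrow> real"
  assumes p: "1 < p"
    and [measurable]: "A \<in> borel_measurable borel" "w \<in> borel_measurable borel" "\<Omega> \<in> sets borel"
    and A0: "\<And>z. A z \<ge> 0" and w0: "\<And>z. w z \<ge> 0"
    and test: "\<And>\<phi>. test_fun \<Omega> \<phi> \<Longrightarrow> ennreal c * (\<integral>\<^sup>+z\<in>\<Omega>. ennreal (\<bar>\<phi> z\<bar> powr p * A z) \<partial>lborel)
      \<le> (\<integral>\<^sup>+z\<in>\<Omega>. ennreal (norm (grad_gamma \<gamma> \<phi> z) powr p * w z) \<partial>lborel)"
    and uG: "(u, G) \<in> DL \<gamma> p \<Omega> w"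
  shows "ennreal c * (\<integral>\<^sup>+z\<in>\<Omega>. ennreal (\<bar>u z\<bar> powr p * A z) \<partial>lborel)
    \<le> (\<integral>\<^sup>+z\<in>\<Omega>. ennreal (norm (G z) powr p * w z) \<partial>lborel)"
proof -
  from uG obtain \<phi> where [measurable]: "u \<in> borel_measurable borel" "G \<in> borel_measurable borel"
    and fin: "(\<integral>\<^sup>+z\<in>\<Omega>. ennreal (norm (G z) powr p * w z) \<partial>lborel) < \<infinity>"
    and \<phi>: "\<And>j. test_fun \<Omega> (\<phi> j)"
    and E: "(\<lambda>j. \<integral>\<^sup>+z\<in>\<Omega>. ennreal (norm (grad_gamma \<gamma> (\<phi> j) z - G z) powr p * w z) \<partial>lborel)
      \<longlonglongrightarrow> 0"
    and ae: "AE z in lborel. z \<in> \<Omega> \<longrightarrow> (\<lambda>j. \<phi> j z) \<longlonglongrightarrow> u z"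
    unfolding DL_def by auto
  let ?I = "\<integral>\<^sup>+z\<in>\<Omega>. ennreal (norm (G z) powr p * w z) \<partial>lborel"
  let ?E = "\<lambda>j. \<integral>\<^sup>+z\<in>\<Omega>. ennreal (norm (grad_gamma \<gamma> (\<phi> j) z - G z) powr p * w z) \<partial>lborel"
  let ?X = "ennreal c * (\<integral>\<^sup>+z\<in>\<Omega>. ennreal (\<bar>u z\<bar> powr p * A z) \<partial>lborel)"
  have sm: "smooth (\<phi> j)" for j using \<phi> by (simp add: test_fun_def)
  have [measurable]: "\<phi> j \<in> borel_measurable borel" "grad_gamma \<gamma> (\<phi> j) \<in> borel_measurable borel" for j
    using sm by (auto intro: borel_measurable_smooth borel_measurable_grad_gamma)
  have "?X = (\<integral>\<^sup>+z. ennreal c * (ennreal (\<bar>u z\<bar> powr p * A z) * indicator \<Omega> z) \<partial>lborel)"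
    by (simp add: nn_integral_cmult)
  also have "\<dots> = (\<integral>\<^sup>+z. liminf (\<lambda>j. ennreal c * (ennreal (\<bar>\<phi> j z\<bar> powr p * A z) * indicator \<Omega> z)) \<partial>lborel)"
  proof (rule nn_integral_cong_AE)
    show "AE z in lborel. ennreal c * (ennreal (\<bar>u z\<bar> powr p * A z) * indicator \<Omega> z) =
        liminf (\<lambda>j. ennreal c * (ennreal (\<bar>\<phi> j z\<bar> powr p * A z) * indicator \<Omega> z))"
      using ae
    proof eventually_elim
      case (elim z)
      show ?case
      proof (cases "z \<in> \<Omega>")
        case True
        with elim have "(\<lambda>j. \<bar>\<phi> j z\<bar>) \<longlonglongrightarrow> \<bar>u z\<bar>" by (intro tendsto_rabs) simp
        then have "(\<lambda>j. \<bar>\<phi> j z\<bar> powr p) \<longlonglongrightarrow> \<bar>u z\<bar> powr p"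
          using p by (intro tendsto_powr') auto
        then have "(\<lambda>j. ennreal (\<bar>\<phi> j z\<bar> powr p * A z)) \<longlonglongrightarrow> ennreal (\<bar>u z\<bar> powr p * A z)"
          by (intro tendsto_ennrealI tendsto_mult tendsto_const)
        then have "(\<lambda>j. ennreal c * (ennreal (\<bar>\<phi> j z\<bar> powr p * A z) * indicator \<Omega> z))
            \<longlonglongrightarrow> ennreal c * (ennreal (\<bar>u z\<bar> powr p * A z) * indicator \<Omega> z)"
          using True by (intro ennreal_tendsto_cmult) auto
        then show ?thesis by (intro lim_imp_Liminf[symmetric]) auto
      qed (simp add: Liminf_const)
    qed
  qed
  also have "\<dots> \<le> liminf (\<lambda>j. \<integral>\<^sup>+z. ennreal c * (ennreal (\<bar>\<phi> j z\<bar> powr p * A z) * indicator \<Omega> z) \<partial>lborel)"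
    by (rule nn_integral_liminf) simp
  also have "\<dots> \<le> liminf (\<lambda>j. \<integral>\<^sup>+z\<in>\<Omega>. ennreal (norm (grad_gamma \<gamma> (\<phi> j) z) powr p * w z) \<partial>lborel)"
    using test[OF \<phi>] by (intro Liminf_mono always_eventually) (simp add: nn_integral_cmult)
  finally have X: "?X \<le> liminf (\<lambda>j. \<integral>\<^sup>+z\<in>\<Omega>. ennreal (norm (grad_gamma \<gamma> (\<phi> j) z) powr p * w z) \<partial>lborel)" .
  have Xs: "?X \<le> ennreal (s powr (1 - p)) * ?I" if s: "0 < s" "s < 1" for s
  proof -
    let ?d = "ennreal ((1 - s) powr (1 - p))"
    have "(\<integral>\<^sup>+z\<in>\<Omega>. ennreal (norm (grad_gamma \<gamma> (\<phi> j) z) powr p * w z) \<partial>lborel)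
        \<le> ennreal (s powr (1 - p)) * ?I + ?d * ?E j" for j
    proof -
      have "(\<integral>\<^sup>+z\<in>\<Omega>. ennreal (norm (grad_gamma \<gamma> (\<phi> j) z) powr p * w z) \<partial>lborel)
          \<le> (\<integral>\<^sup>+z. ennreal (s powr (1 - p)) * (ennreal (norm (G z) powr p * w z) * indicator \<Omega> z)
            + ?d * (ennreal (norm (grad_gamma \<gamma> (\<phi> j) z - G z) powr p * w z) * indicator \<Omega> z) \<partial>lborel)"
      proof (rule nn_integral_mono)
        fix z
        have "norm (grad_gamma \<gamma> (\<phi> j) z) powr p \<le> (norm (G z) + norm (grad_gamma \<gamma> (\<phi> j) z - G z)) powr p"
          using p norm_triangle_sub[of "grad_gamma \<gamma> (\<phi> j) z" "G z"] by (intro powr_mono2) auto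
        also have "\<dots> \<le> s powr (1 - p) * norm (G z) powr p
            + (1 - s) powr (1 - p) * norm (grad_gamma \<gamma> (\<phi> j) z - G z) powr p"
          using s p by (intro powr_add_le) auto
        finally have "norm (grad_gamma \<gamma> (\<phi> j) z) powr p * w z \<le> (s powr (1 - p) * norm (G z) powr p
            + (1 - s) powr (1 - p) * norm (grad_gamma \<gamma> (\<phi> j) z - G z) powr p) * w z"
          using w0 by (rule mult_right_mono)
        then show "ennreal (norm (grad_gamma \<gamma> (\<phi> j) z) powr p * w z) * indicator \<Omega> z
          \<le> ennreal (s powr (1 - p)) * (ennreal (norm (G z) powr p * w z) * indicator \<Omega> z)
            + ?d * (ennreal (norm (grad_gamma \<gamma> (\<phi> j) z - G z) powr p * w z) * indicator \<Omega> z)"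
          using w0[of z] s by (cases "z \<in> \<Omega>") (simp_all add: distrib_right mult.assoc
              flip: ennreal_mult ennreal_plus)
      qed
      also have "\<dots> = ennreal (s powr (1 - p)) * ?I + ?d * ?E j"
        by (subst nn_integral_add) (simp_all add: nn_integral_cmult)
      finally show ?thesis .
    qed
    \<comment> \<open>For fixed \<open>s\<close> the coefficient of the error is finite, so
      convergence of \<open>?E\<close> to 0 removes it.\<close>
    then have "?X \<le> liminf (\<lambda>j. ennreal (s powr (1 - p)) * ?I + ?d * ?E j)"
      by (intro order_trans[OF X] Liminf_mono always_eventually) simp
    also have "\<dots> = ennreal (s powr (1 - p)) * ?I + ?d * 0"
      by (intro lim_imp_Liminf tendsto_add tendsto_const ennreal_tendsto_cmult E) auto
    finally show ?thesis by simp
  qed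
  have "((\<lambda>s. ennreal (s powr (1 - p)) * ?I) \<longlongrightarrow> ennreal (1 powr (1 - p)) * ?I) (at_left 1)"
    using fin by (intro tendsto_mult_ennreal tendsto_ennrealI tendsto_intros) auto
  then have "?X \<le> ennreal (1 powr (1 - p)) * ?I"
  proof (rule tendsto_lowerbound)
    show "\<forall>\<^sub>F s in at_left 1. ?X \<le> ennreal (s powr (1 - p)) * ?I"
      using eventually_at_left_real[OF zero_less_one] by eventually_elim (use Xs in auto)
  qed simp
  then show ?thesis by simp
qed

section \<open>The inequalities for test functions\<close>

lemma test_fun_outside:
  assumes "test_fun \<Omega> \<phi>" "z \<notin> closure {z. \<phi> z \<noteq> 0}"
  shows "\<phi> z = 0" "frechet_derivative \<phi> (at z) = (\<lambda>_. 0)"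
proof -
  show "\<phi> z = 0"
    using assms(2) closure_subset[of "{z. \<phi> z \<noteq> 0}"] by auto
  have "(\<phi> has_derivative (\<lambda>_. 0)) (at z)"
  proof (rule has_derivative_transform_within_open)
    show "((\<lambda>_. 0) has_derivative (\<lambda>_. 0)) (at z)" by simp
    show "open (- closure {z. \<phi> z \<noteq> 0})" by blast
    show "z \<in> - closure {z. \<phi> z \<noteq> 0}" using assms(2) by simp
    show "0 = \<phi> y" if "y \<in> - closure {z. \<phi> z \<noteq> 0}" for y
      using that closure_subset[of "{z. \<phi> z \<noteq> 0}"] by auto
  qed
  then show "frechet_derivative \<phi> (at z) = (\<lambda>_. 0)"
    by (rule frechet_derivative_at[symmetric])
qed

context grushin
begin

lemma test_fun_outside_grad:
  assumes "test_fun \<Omega> \<phi>" "z \<notin> \<Omega>"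
  shows "\<phi> z = 0" "grad_gamma \<gamma> \<phi> z = 0" "flow_deriv \<phi> z = 0"
proof -
  have z: "z \<notin> closure {z. \<phi> z \<noteq> 0}" using assms by (auto simp: test_fun_def)
  note out = test_fun_outside[OF assms(1) z]
  show "\<phi> z = 0" "grad_gamma \<gamma> \<phi> z = 0" "flow_deriv \<phi> z = 0"
    by (auto simp: out grad_gamma_def flow_deriv_def prod_eq_iff vec_eq_iff)
qed

lemma flow_increment_le:
  assumes "smooth \<phi>" "a \<le> b"
  shows "ennreal \<bar>\<phi> (dil b z) - \<phi> (dil a z)\<bar>
    \<le> (\<integral>\<^sup>+t. ennreal \<bar>flow_deriv \<phi> (dil t z)\<bar> * indicator {a..b} t \<partial>lborel)"
proof -
  have "continuous_on {a..b} (\<lambda>t. flow_deriv \<phi> (dil t z))"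
    by (rule continuous_on_compose2[OF continuous_on_flow_deriv[OF assms(1), of UNIV]])
      (auto simp: dil_def intro!: continuous_intros)
  then have I: "has_bochner_integral lborel (\<lambda>t. indicator {a..b} t *\<^sub>R flow_deriv \<phi> (dil t z))
      (\<phi> (dil b z) - \<phi> (dil a z))"
    using assms
    by (intro has_bochner_integral_FTC_Icc)
      (auto intro!: has_field_derivative_at_within flow_has_real_derivative
        simp: has_real_derivative_iff_has_vector_derivative[symmetric])
  then have "ennreal (norm (\<phi> (dil b z) - \<phi> (dil a z)))
      \<le> (\<integral>\<^sup>+t. norm (indicator {a..b} t *\<^sub>R flow_deriv \<phi> (dil t z)) \<partial>lborel)"
    using integral_norm_bound_ennreal[of lborel "\<lambda>t. indicator {a..b} t *\<^sub>R flow_deriv \<phi> (dil t z)"]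
    by (simp add: has_bochner_integral_iff)
  also have "\<dots> = (\<integral>\<^sup>+t. ennreal \<bar>flow_deriv \<phi> (dil t z)\<bar> * indicator {a..b} t \<partial>lborel)"
    by (intro nn_integral_cong) (simp add: indicator_def)
  finally show ?thesis by simp
qed

text \<open>The orbit is followed from a zero of \<open>\<phi>\<close>, which may lie at positive or
  negative time. The alternative that the derivative vanishes permits \<open>T\<close> to omit an
  endpoint, as the logarithmic case requires.\<close>

lemma flow_le_from_zero:
  assumes "smooth \<phi>" "\<phi> (dil t0 z) = 0" "\<And>t. min 0 t0 \<le> t \<Longrightarrow> t \<le> max 0 t0 \<Longrightarrow> t \<in> T \<or> flow_deriv \<phi> (dil t z) = 0"
  shows "ennreal \<bar>\<phi> z\<bar> \<le> (\<integral>\<^sup>+t. ennreal \<bar>flow_deriv \<phi> (dil t z)\<bar> * indicator T t \<partial>lborel)"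
proof -
  have "ennreal \<bar>\<phi> z\<bar> \<le> (\<integral>\<^sup>+t. ennreal \<bar>flow_deriv \<phi> (dil t z)\<bar> * indicator {min 0 t0..max 0 t0} t \<partial>lborel)"
    using flow_increment_le[OF assms(1), of "min 0 t0" "max 0 t0" z] assms(2) by (cases "t0 \<ge> 0") auto
  also have "\<dots> \<le> (\<integral>\<^sup>+t. ennreal \<bar>flow_deriv \<phi> (dil t z)\<bar> * indicator T t \<partial>lborel)"
    using assms(3) by (intro nn_integral_mono) (force simp: indicator_def)
  finally show ?thesis .
qed


lemma test_fun_gnorm_bounds:
  assumes "test_fun \<Omega> \<phi>"
  obtains M where "\<And>z. \<rho> z > M \<Longrightarrow> \<phi> z = 0"
proof -
  have "compact (\<rho> ` closure {z. \<phi> z \<noteq> 0})"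
    using assms by (intro compact_continuous_image continuous_on_gnorm) (simp add: test_fun_def)
  then obtain M where M: "\<And>z. z \<in> closure {z. \<phi> z \<noteq> 0} \<Longrightarrow> \<bar>\<rho> z\<bar> \<le> M"
    using compact_imp_bounded by (fastforce simp: bounded_iff)
  show ?thesis
  proof (rule that[of M])
    show "\<phi> z = 0" if "\<rho> z > M" for z
      using M[of z] that test_fun_outside(1)[OF assms] by fastforce
  qed
qed

text \<open>The gauge attains its minimum on the compact support, at a point other than the
  origin.\<close>

lemma test_fun_gnorm_lower:
  assumes "test_fun \<Omega> \<phi>" "0 \<notin> \<Omega>"
  obtains m where "m > 0" "\<And>z. \<rho> z < m \<Longrightarrow> \<phi> z = 0"
proof (cases "closure {z. \<phi> z \<noteq> 0} = {}")
  case True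
  then show ?thesis using that[of 1] by auto
next
  case False
  then obtain z0 where z0: "z0 \<in> closure {z. \<phi> z \<noteq> 0}"
    and min: "\<And>z. z \<in> closure {z. \<phi> z \<noteq> 0} \<Longrightarrow> \<rho> z0 \<le> \<rho> z"
    using continuous_attains_inf[OF _ False continuous_on_gnorm] assms(1) by (auto simp: test_fun_def)
  show ?thesis
  proof (rule that[of "\<rho> z0"])
    show "\<rho> z0 > 0" using assms z0 by (intro gnorm_pos) (auto simp: test_fun_def)
    show "\<phi> z = 0" if "\<rho> z < \<rho> z0" for z
      using min[of z] that test_fun_outside(1)[OF assms(1)] by fastforce
  qed
qed

text \<open>The domain is the positive half line for \<open>a > 0\<close> and the negative one for
  \<open>a < 0\<close>; substituting \<open>t / a\<close> for \<open>t\<close> treats both signs at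
  once.\<close>

lemma nn_integral_abs_exp:
  assumes "a \<noteq> 0"
  shows "(\<integral>\<^sup>+t. ennreal (\<bar>a\<bar> * exp (- a * t)) * indicator {t. 0 \<le> a * t} t \<partial>lborel) = 1"
proof -
  have "(\<integral>\<^sup>+t. ennreal (\<bar>a\<bar> * exp (- a * t)) * indicator {t. 0 \<le> a * t} t \<partial>lborel)
      = ennreal \<bar>1 / a\<bar> * (\<integral>\<^sup>+t. ennreal (\<bar>a\<bar> * exp (- a * (0 + 1 / a * t)))
        * indicator {t. 0 \<le> a * t} (0 + 1 / a * t) \<partial>lborel)"
    by (rule nn_integral_real_affine) (use assms in auto)
  also have "(\<integral>\<^sup>+t. ennreal (\<bar>a\<bar> * exp (- a * (0 + 1 / a * t))) * indicator {t. 0 \<le> a * t} (0 + 1 / a * t) \<partial>lborel)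
      = (\<integral>\<^sup>+t. ennreal \<bar>a\<bar> * (ennreal (exp (- t)) * indicator {0..} t) \<partial>lborel)"
    using assms by (intro nn_integral_cong) (simp add: ennreal_mult indicator_def)
  also have "\<dots> = ennreal \<bar>a\<bar> * (\<integral>\<^sup>+t. ennreal (exp (- t)) * indicator {0..} t \<partial>lborel)"
    by (rule nn_integral_cmult) simp
  also have "(\<integral>\<^sup>+t. ennreal (exp (- t)) * indicator {0..} t \<partial>lborel) = ennreal (0 - (- exp (- 0)))"
  proof (rule nn_integral_FTC_atLeast)
    have "((\<lambda>t::real. exp (- t)) \<longlongrightarrow> 0) at_top"
      by (rule filterlim_compose[OF exp_at_bot filterlim_uminus_at_bot_at_top])
    from tendsto_minus[OF this] show "((\<lambda>t::real. - exp (- t)) \<longlongrightarrow> 0) at_top" by simp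
  qed (auto intro!: derivative_eq_intros)
  finally show ?thesis
    using assms by (simp add: mult.assoc[symmetric] flip: ennreal_mult)
qed

text \<open>The density belongs to the extremal \<open>exp (- a * ln \<rho>)\<close>. For
  \<open>a > 0\<close> orbits run outward until they leave the support; for \<open>a < 0\<close>
  they run inward, and the support must keep away from the origin.\<close>

lemma hardy_test_power:
  assumes p: "1 < p" and \<phi>: "test_fun \<Omega> \<phi>" and a: "a \<noteq> 0" and \<Omega>: "a < 0 \<Longrightarrow> 0 \<notin> \<Omega>"
  shows "(\<integral>\<^sup>+z. ennreal (dens p z) * ennreal (\<bar>\<phi> z\<bar> powr p * exp (a * p * ln (\<rho> z))) \<partial>lborel)
    \<le> (\<integral>\<^sup>+z. ennreal (dens p z) * ennreal (\<bar>flow_deriv \<phi> z\<bar> powr p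
        * (\<bar>a\<bar> powr (- p) * exp (a * p * ln (\<rho> z)))) \<partial>lborel)"
proof -
  let ?T = "{z :: real \<times> real. 0 \<le> a * snd z}"
  have sm: "smooth \<phi>" using \<phi> by (simp add: test_fun_def)
  have ind: "indicator ?T (r, t) = (indicator {t. 0 \<le> a * t} t :: ennreal)" for r t
    by (simp add: indicator_def)
  show ?thesis
  proof (rule flow_hardy[where T = ?T and P = "\<lambda>z. \<bar>a\<bar> * exp (- a * snd z)"])
    show "\<phi> \<in> borel_measurable borel" "flow_deriv \<phi> \<in> borel_measurable borel"
      using sm by (auto intro: borel_measurable_smooth borel_measurable_continuous_onI continuous_on_flow_deriv)
    have "Measurable.pred (borel \<Otimes>\<^sub>M borel) (\<lambda>z::real \<times> real. 0 \<le> a * snd z)" by measurable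
    then show "?T \<in> sets (borel \<Otimes>\<^sub>M borel)"
      by (simp add: pred_def space_pair_measure)
  next
    fix z :: "(real^'n) \<times> (real^'k)" assume z: "z \<noteq> 0"
    have "\<exists>t0. 0 \<le> a * t0 \<and> \<phi> (dil t0 z) = 0"
    proof (cases "a > 0")
      case True
      obtain M where M: "\<And>z. \<rho> z > M \<Longrightarrow> \<phi> z = 0" using test_fun_gnorm_bounds[OF \<phi>] by blast
      \<comment> \<open>\<open>M\<close> may be negative; \<open>\<bar>M\<bar> + 1\<close> exceeds
        it and is positive, so its logarithm is meaningful.\<close>
      define t0 where "t0 = max 0 (ln ((\<bar>M\<bar> + 1) / \<rho> z))"
      have "(\<bar>M\<bar> + 1) / \<rho> z \<le> exp t0"
        using gnorm_pos[OF z] exp_ln[of "(\<bar>M\<bar> + 1) / \<rho> z"]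
        by (metis abs_ge_zero add_nonneg_pos divide_pos_pos exp_le_cancel_iff max.cobounded2 t0_def zero_less_one)
      then have "\<rho> (dil t0 z) > M"
        using gnorm_pos[OF z] by (simp add: gnorm_dil field_simps)
      then show ?thesis using M True by (intro exI[of _ t0]) (auto simp: t0_def)
    next
      case False
      then have "a < 0" using a by simp
      obtain m where m: "m > 0" "\<And>z. \<rho> z < m \<Longrightarrow> \<phi> z = 0"
        using test_fun_gnorm_lower[OF \<phi> \<Omega>[OF \<open>a < 0\<close>]] by blast
      \<comment> \<open>Half of \<open>m\<close> makes the gauge at time \<open>t0\<close> strictly
        smaller than \<open>m\<close>.\<close>
      define t0 where "t0 = min 0 (ln (m / 2 / \<rho> z))"
      have "exp t0 \<le> m / 2 / \<rho> z"
        using gnorm_pos[OF z] m(1) exp_ln[of "m / 2 / \<rho> z"]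
        by (metis divide_pos_pos exp_le_cancel_iff min.cobounded2 t0_def zero_less_numeral)
      then have "\<rho> (dil t0 z) < m"
        using gnorm_pos[OF z] m(1) by (simp add: gnorm_dil field_simps)
      then show ?thesis using m \<open>a < 0\<close>
        by (intro exI[of _ t0]) (auto simp: t0_def mult_nonpos_nonpos)
    qed
    then obtain t0 where t0: "0 \<le> a * t0" "\<phi> (dil t0 z) = 0" by blast
    have "ennreal \<bar>\<phi> z\<bar> \<le> (\<integral>\<^sup>+t. ennreal \<bar>flow_deriv \<phi> (dil t z)\<bar> * indicator {t. 0 \<le> a * t} t \<partial>lborel)"
    proof (rule flow_le_from_zero[OF sm t0(2)])
      show "t \<in> {t. 0 \<le> a * t} \<or> flow_deriv \<phi> (dil t z) = 0" if "min 0 t0 \<le> t" "t \<le> max 0 t0" for t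
        using t0(1) that a by (cases "t0 \<ge> 0"; cases "a > 0") (auto simp: zero_le_mult_iff)
    qed
    then show "ennreal \<bar>\<phi> z\<bar> \<le> (\<integral>\<^sup>+t. ennreal \<bar>flow_deriv \<phi> (dil t z)\<bar> * indicator ?T (ln (\<rho> z), t) \<partial>lborel)"
      by (simp only: ind)
  next
    fix r
    show "(\<integral>\<^sup>+t. ennreal (\<bar>a\<bar> * exp (- a * snd (r, t))) * indicator ?T (r, t) \<partial>lborel) \<le> 1"
      using nn_integral_abs_exp[OF a] by (simp only: ind snd_conv order_refl)
    \<comment> \<open>The dual integrand turns out to be \<open>?c\<close> times the density itself,
      so its integral is exactly \<open>?c\<close> and nothing is lost.\<close>
    let ?c = "\<bar>a\<bar> powr (- p) * exp (a * p * r)"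
    have "(\<bar>a\<bar> * exp (- a * t)) powr (1 - p) * exp (a * p * (r - t)) = ?c * (\<bar>a\<bar> * exp (- a * t))" for t
    proof -
      have "(\<bar>a\<bar> * exp (- a * t)) powr (1 - p) = \<bar>a\<bar> powr (- p) * \<bar>a\<bar> * exp (- a * t * (1 - p))"
        using a powr_add[of "\<bar>a\<bar>" "- p" 1] by (simp add: powr_mult exp_powr_real)
      moreover have "exp (- a * t * (1 - p)) * exp (a * p * (r - t)) = exp (a * p * r) * exp (- a * t)"
        by (simp add: algebra_simps flip: exp_add)
      ultimately show ?thesis by (simp add: mult_ac)
    qed
    then have "(\<integral>\<^sup>+t. ennreal ((\<bar>a\<bar> * exp (- a * t)) powr (1 - p) * exp (a * p * (r - t)))
          * indicator {t. 0 \<le> a * t} t \<partial>lborel)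
        = (\<integral>\<^sup>+t. ennreal ?c * (ennreal (\<bar>a\<bar> * exp (- a * t)) * indicator {t. 0 \<le> a * t} t) \<partial>lborel)"
      by (simp add: ennreal_mult mult.assoc)
    also have "\<dots> = ennreal ?c * (\<integral>\<^sup>+t. ennreal (\<bar>a\<bar> * exp (- a * t)) * indicator {t. 0 \<le> a * t} t \<partial>lborel)"
      by (rule nn_integral_cmult) simp
    also have "\<dots> = ennreal ?c"
      by (simp only: nn_integral_abs_exp[OF a] mult_1_right)
    finally show "(\<integral>\<^sup>+t. ennreal ((\<bar>a\<bar> * exp (- a * snd (r - t, t))) powr (1 - p) * exp (a * p * (r - t)))
        * indicator ?T (r - t, t) \<partial>lborel) \<le> ennreal ?c"
      by (simp only: ind snd_conv order_refl)
  qed (use p a in auto)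
qed

text \<open>The extremal is \<open>(ln R - ln \<rho>) powr \<theta>\<close>. Orbits run outward and
  reach the boundary of the ball after the finite time \<open>ln R - ln \<rho>\<close>, so the
  density lives on that bounded interval.\<close>

lemma hardy_test_log:
  assumes p: "1 < p" and \<phi>: "test_fun {z. \<rho> z < R} \<phi>" and R: "0 < R" and th: "0 < \<theta>"
  shows "(\<integral>\<^sup>+z. ennreal (dens p z) * ennreal (\<bar>\<phi> z\<bar> powr p * (ln R - ln (\<rho> z)) powr (- 1 - \<theta> * p)) \<partial>lborel)
    \<le> (\<integral>\<^sup>+z. ennreal (dens p z) * ennreal (\<bar>flow_deriv \<phi> z\<bar> powr p
        * (\<theta> powr (- p) * (ln R - ln (\<rho> z)) powr (p - 1 - \<theta> * p))) \<partial>lborel)"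
proof -
  let ?L = "ln R"
  \<comment> \<open>The hitting time of the boundary is left out: \<open>?P\<close> is 0 there since
    \<open>0 powr _ = 0\<close>, whereas \<open>flow_hardy\<close> demands positivity on
    \<open>T\<close>.\<close>
  let ?T = "{z :: real \<times> real. 0 \<le> snd z \<and> snd z < ?L - fst z}"
  let ?P = "\<lambda>z :: real \<times> real. \<theta> * (?L - fst z - snd z) powr (\<theta> - 1) * (?L - fst z) powr (- \<theta>)"
  have sm: "smooth \<phi>" using \<phi> by (simp add: test_fun_def)
  show ?thesis
  proof (rule flow_hardy[where T = ?T and P = ?P])
    show "\<phi> \<in> borel_measurable borel" "flow_deriv \<phi> \<in> borel_measurable borel"
      using sm by (auto intro: borel_measurable_smooth borel_measurable_continuous_onI continuous_on_flow_deriv)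
    have "Measurable.pred (borel \<Otimes>\<^sub>M borel) (\<lambda>z::real \<times> real. 0 \<le> snd z \<and> snd z < ?L - fst z)" by measurable
    then show "?T \<in> sets (borel \<Otimes>\<^sub>M borel)"
      by (simp add: pred_def space_pair_measure)
  next
    fix z :: "(real^'n) \<times> (real^'k)" assume z: "z \<noteq> 0"
    let ?r = "ln (\<rho> z)"
    show "ennreal \<bar>\<phi> z\<bar> \<le> (\<integral>\<^sup>+t. ennreal \<bar>flow_deriv \<phi> (dil t z)\<bar> * indicator ?T (?r, t) \<partial>lborel)"
    proof (cases "\<rho> z < R")
      case False
      then show ?thesis using test_fun_outside_grad(1)[OF \<phi>, of z] by simp
    next
      case True
      then have r: "?r < ?L" using gnorm_pos[OF z] by simp
      have "\<rho> (dil (?L - ?r) z) = R"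
        using gnorm_pos[OF z] R by (simp add: gnorm_dil exp_diff)
      then have out: "\<phi> (dil (?L - ?r) z) = 0" "flow_deriv \<phi> (dil (?L - ?r) z) = 0"
        using test_fun_outside_grad[OF \<phi>, of "dil (?L - ?r) z"] by auto
      have "ennreal \<bar>\<phi> z\<bar> \<le> (\<integral>\<^sup>+t. ennreal \<bar>flow_deriv \<phi> (dil t z)\<bar> * indicator {0..<?L - ?r} t \<partial>lborel)"
      proof (rule flow_le_from_zero[OF sm out(1)])
        show "t \<in> {0..<?L - ?r} \<or> flow_deriv \<phi> (dil t z) = 0"
          if "min 0 (?L - ?r) \<le> t" "t \<le> max 0 (?L - ?r)" for t
          using that r out(2) by (cases "t = ?L - ?r") auto
      qed
      also have "\<dots> = (\<integral>\<^sup>+t. ennreal \<bar>flow_deriv \<phi> (dil t z)\<bar> * indicator ?T (?r, t) \<partial>lborel)"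
        by (intro nn_integral_cong) (simp add: indicator_def)
      finally show ?thesis .
    qed
  next
    fix r :: real
    let ?l = "?L - r"
    show "(\<integral>\<^sup>+t. ennreal (?P (r, t)) * indicator ?T (r, t) \<partial>lborel) \<le> 1"
    proof (cases "?l > 0")
      case True
      define f where "f t = ennreal (\<theta> * (?l - t) powr (\<theta> - 1) * ?l powr (- \<theta>)) * indicator {0..<?l} t" for t
      have [measurable]: "f \<in> borel_measurable borel" unfolding f_def[abs_def] by measurable
      have "(\<integral>\<^sup>+t. ennreal (?P (r, t)) * indicator ?T (r, t) \<partial>lborel) = (\<integral>\<^sup>+t. f t \<partial>lborel)"
        by (intro nn_integral_cong) (simp add: f_def indicator_def)
      also have "\<dots> = ennreal \<bar>-1\<bar> * (\<integral>\<^sup>+s. f (?l + (-1) * s) \<partial>lborel)"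
        by (rule nn_integral_real_affine) auto
      also have "\<dots> = (\<integral>\<^sup>+s. f (?l - s) \<partial>lborel)" by simp
      also have "\<dots> \<le> (\<integral>\<^sup>+s. ennreal (\<theta> * ?l powr (- \<theta>)) * (ennreal (s powr (\<theta> - 1)) * indicator {0..?l} s) \<partial>lborel)"
        using th by (intro nn_integral_mono) (auto simp: f_def indicator_def mult_ac simp flip: ennreal_mult)
      also have "\<dots> = ennreal (\<theta> * ?l powr (- \<theta>)) * (\<integral>\<^sup>+s. ennreal (s powr (\<theta> - 1)) * indicator {0..?l} s \<partial>lborel)"
        by (rule nn_integral_cmult) simp
      also have "(\<integral>\<^sup>+s. ennreal (s powr (\<theta> - 1)) * indicator {0..?l} s \<partial>lborel)
          = ennreal (?l powr (\<theta> - 1 + 1) / (\<theta> - 1 + 1))"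
        using th True by (intro nn_integral_has_integral_lebesgue' has_integral_powr_from_0) auto
      also have "ennreal (\<theta> * ?l powr (- \<theta>)) * ennreal (?l powr (\<theta> - 1 + 1) / (\<theta> - 1 + 1)) = 1"
        using th True by (simp add: powr_minus field_simps flip: ennreal_mult)
      finally show ?thesis .
    next
      case False
      then have "indicator ?T (r, t) = (0::ennreal)" for t by (simp add: indicator_def)
      then show ?thesis by simp
    qed
    let ?v = "\<theta> powr (- p) * ?l powr (p - 1 - \<theta> * p)"
    show "(\<integral>\<^sup>+t. ennreal (?P (r - t, t) powr (1 - p) * (?L - (r - t)) powr (- 1 - \<theta> * p))
        * indicator ?T (r - t, t) \<partial>lborel) \<le> ennreal ?v"
    proof (cases "?l > 0")
      case True
      \<comment> \<open>The remaining time is \<open>?l\<close> on arrival and \<open>?l + t\<close>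
        on departure. The powers of \<open>?l\<close> leave the integral as \<open>?c\<close>; what
        remains is \<open>(?l + t) powr (- 1 - \<theta>)\<close>, with integral
        \<open>?l powr (- \<theta>) / \<theta>\<close> over \<open>t \<ge> 0\<close>.\<close>
      let ?c = "\<theta> powr (1 - p) * ?l powr ((\<theta> - 1) * (1 - p))"
      have "(\<integral>\<^sup>+t. ennreal (?P (r - t, t) powr (1 - p) * (?L - (r - t)) powr (- 1 - \<theta> * p))
          * indicator ?T (r - t, t) \<partial>lborel)
        \<le> (\<integral>\<^sup>+t. ennreal ?c * (ennreal ((?l + t) powr (- 1 - \<theta>)) * indicator {?l..} (?l + t)) \<partial>lborel)"
      proof (rule nn_integral_mono)
        fix t
        have eq: "?P (r - t, t) powr (1 - p) * (?L - (r - t)) powr (- 1 - \<theta> * p) = ?c * (?l + t) powr (- 1 - \<theta>)"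
        proof -
          have "?P (r - t, t) = \<theta> * ?l powr (\<theta> - 1) * (?l + t) powr (- \<theta>)"
            by (simp add: algebra_simps)
          then have "?P (r - t, t) powr (1 - p) = ?c * (?l + t) powr (- \<theta> * (1 - p))"
            by (simp only: powr_mult powr_powr)
          moreover have "(?l + t) powr (- \<theta> * (1 - p)) * (?l + t) powr (- 1 - \<theta> * p) = (?l + t) powr (- 1 - \<theta>)"
            by (simp add: algebra_simps flip: powr_add)
          moreover have "?L - (r - t) = ?l + t" by simp
          ultimately show ?thesis by (simp only: mult.assoc)
        qed
        show "ennreal (?P (r - t, t) powr (1 - p) * (?L - (r - t)) powr (- 1 - \<theta> * p)) * indicator ?T (r - t, t)
            \<le> ennreal ?c * (ennreal ((?l + t) powr (- 1 - \<theta>)) * indicator {?l..} (?l + t))"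
          unfolding eq by (simp add: indicator_def ennreal_mult)
      qed
      also have "\<dots> = ennreal ?c * (\<integral>\<^sup>+t. ennreal ((?l + t) powr (- 1 - \<theta>)) * indicator {?l..} (?l + t) \<partial>lborel)"
        by (rule nn_integral_cmult) simp
      also have "(\<integral>\<^sup>+t. ennreal ((?l + t) powr (- 1 - \<theta>)) * indicator {?l..} (?l + t) \<partial>lborel)
          = (\<integral>\<^sup>+s. ennreal (s powr (- 1 - \<theta>)) * indicator {?l..} s \<partial>lborel)"
        by (subst nn_integral_real_affine[where c = 1 and t = ?l]) auto
      also have "\<dots> = ennreal (- (?l powr (- 1 - \<theta> + 1)) / (- 1 - \<theta> + 1))"
        using th True by (intro nn_integral_has_integral_lebesgue' has_integral_powr_to_inf) auto
      also have "ennreal ?c * \<dots> = ennreal ?v"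
      proof -
        have "\<theta> powr (1 - p) / \<theta> = \<theta> powr (- p)"
          using th by (simp add: powr_diff powr_minus field_simps)
        moreover have "?l powr ((\<theta> - 1) * (1 - p)) * ?l powr (- \<theta>) = ?l powr (p - 1 - \<theta> * p)"
          by (simp add: algebra_simps flip: powr_add)
        moreover have "?c * (?l powr (- \<theta>) / \<theta>)
            = \<theta> powr (1 - p) / \<theta> * (?l powr ((\<theta> - 1) * (1 - p)) * ?l powr (- \<theta>))"
          by simp
        ultimately have "?c * (?l powr (- \<theta>) / \<theta>) = ?v"
          by (simp only:)
        then show ?thesis
          using th by (simp flip: ennreal_mult)
      qed
      finally show ?thesis .
    next
      case False
      then have "indicator ?T (r - t, t) = (0::ennreal)" for t by (simp add: indicator_def)
      then show ?thesis by simp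
    qed
  qed (use p th in auto)
qed


section \<open>The power and logarithmic inequalities in their stated form\<close>

lemma exp_ln_gnorm: "z \<noteq> 0 \<Longrightarrow> exp (c * ln (\<rho> z)) = \<rho> z powr c"
  using gnorm_pos[of z] by (simp add: powr_def)

text \<open>With \<open>a = (Q + \<beta>) / p\<close> the weight on the left is \<open>dens\<close>
  times \<open>\<rho> powr (a * p)\<close>. Off the null set \<open>x = 0\<close> the flow
  derivative is then traded for the gradient. If \<open>Q + \<beta> = 0\<close> the constant is
  0.\<close>

lemma hardy_power_test:
  assumes p: "1 < p" and \<phi>: "test_fun \<Omega> \<phi>" and [measurable]: "\<Omega> \<in> sets borel"
    and \<Omega>: "Q + \<beta> < 0 \<Longrightarrow> 0 \<notin> \<Omega>"
  shows "ennreal ((\<bar>Q + \<beta>\<bar> / p) powr p) *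
      (\<integral>\<^sup>+z\<in>\<Omega>. ennreal (\<bar>\<phi> z\<bar> powr p * (\<rho> z powr \<beta> * rpow (norm (fst z) / \<rho> z) (\<gamma> * p))) \<partial>lborel)
    \<le> (\<integral>\<^sup>+z\<in>\<Omega>. ennreal (norm (grad_gamma \<gamma> \<phi> z) powr p * \<rho> z powr (p + \<beta>)) \<partial>lborel)"
proof (cases "Q + \<beta> = 0")
  case False
  define a where "a = (Q + \<beta>) / p"
  have a: "a \<noteq> 0" "a * p = Q + \<beta>" "\<bar>Q + \<beta>\<bar> / p = \<bar>a\<bar>"
    using False p by (auto simp: a_def)
  have a0: "a < 0 \<Longrightarrow> 0 \<notin> \<Omega>" using \<Omega> p by (auto simp: a_def divide_less_0_iff)
  have sm: "smooth \<phi>" using \<phi> by (simp add: test_fun_def)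
  have [measurable]: "\<phi> \<in> borel_measurable borel" "flow_deriv \<phi> \<in> borel_measurable borel"
    "grad_gamma \<gamma> \<phi> \<in> borel_measurable borel"
    using sm by (auto intro: borel_measurable_smooth borel_measurable_continuous_onI
        continuous_on_flow_deriv borel_measurable_grad_gamma)
  have "(\<integral>\<^sup>+z\<in>\<Omega>. ennreal (\<bar>\<phi> z\<bar> powr p * (\<rho> z powr \<beta> * rpow (norm (fst z) / \<rho> z) (\<gamma> * p))) \<partial>lborel)
    \<le> (\<integral>\<^sup>+z. ennreal (dens p z) * ennreal (\<bar>\<phi> z\<bar> powr p * exp (a * p * ln (\<rho> z))) \<partial>lborel)"
  proof (rule nn_integral_mono)
    fix z :: "(real^'n) \<times> (real^'k)"
    show "ennreal (\<bar>\<phi> z\<bar> powr p * (\<rho> z powr \<beta> * rpow (norm (fst z) / \<rho> z) (\<gamma> * p))) * indicator \<Omega> z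
      \<le> ennreal (dens p z) * ennreal (\<bar>\<phi> z\<bar> powr p * exp (a * p * ln (\<rho> z)))"
    proof (cases "z = 0")
      case True
      then show ?thesis by (simp add: gnorm_eq_0_iff[THEN iffD2])
    next
      case False
      have "\<rho> z powr \<beta> = \<rho> z powr (- Q) * \<rho> z powr (Q + \<beta>)"
        by (simp flip: powr_add)
      then show ?thesis
        unfolding a(2) exp_ln_gnorm[OF False]
        by (auto simp: dens_def rpow_nonneg indicator_def mult_ac simp flip: ennreal_mult)
    qed
  qed
  also have "\<dots> \<le> (\<integral>\<^sup>+z. ennreal (dens p z) * ennreal (\<bar>flow_deriv \<phi> z\<bar> powr p
        * (\<bar>a\<bar> powr (- p) * exp (a * p * ln (\<rho> z)))) \<partial>lborel)"
    by (rule hardy_test_power[OF p \<phi> a(1) a0])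
  also have "\<dots> \<le> (\<integral>\<^sup>+z. ennreal (\<bar>a\<bar> powr (- p)) *
      (ennreal (norm (grad_gamma \<gamma> \<phi> z) powr p * \<rho> z powr (p + \<beta>)) * indicator \<Omega> z) \<partial>lborel)"
  proof (rule nn_integral_mono_AE)
    show "AE z in lborel. ennreal (dens p z) * ennreal (\<bar>flow_deriv \<phi> z\<bar> powr p
        * (\<bar>a\<bar> powr (- p) * exp (a * p * ln (\<rho> z))))
      \<le> ennreal (\<bar>a\<bar> powr (- p)) * (ennreal (norm (grad_gamma \<gamma> \<phi> z) powr p * \<rho> z powr (p + \<beta>)) * indicator \<Omega> z)"
      using AE_fst_nonzero
    proof eventually_elim
      case (elim z)
      then have z: "z \<noteq> 0" by auto
      show ?case
      proof (cases "z \<in> \<Omega>")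
        case True
        have "dens p z * \<bar>flow_deriv \<phi> z\<bar> powr p * (\<bar>a\<bar> powr (- p) * \<rho> z powr (Q + \<beta>))
            \<le> \<rho> z powr (p - Q) * norm (grad_gamma \<gamma> \<phi> z) powr p * (\<bar>a\<bar> powr (- p) * \<rho> z powr (Q + \<beta>))"
          using dens_flow_deriv_le[OF sm elim, of p] p by (intro mult_right_mono) auto
        moreover have "\<rho> z powr (p + \<beta>) = \<rho> z powr (p - Q) * \<rho> z powr (Q + \<beta>)"
          by (simp flip: powr_add)
        ultimately show ?thesis
          unfolding a(2) exp_ln_gnorm[OF z]
          using True by (simp add: dens_nonneg mult_ac flip: ennreal_mult)
      next
        case False
        then show ?thesis using test_fun_outside_grad(3)[OF \<phi>, of z] p by simp
      qed
    qed
  qed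
  also have "\<dots> = ennreal (\<bar>a\<bar> powr (- p)) *
      (\<integral>\<^sup>+z\<in>\<Omega>. ennreal (norm (grad_gamma \<gamma> \<phi> z) powr p * \<rho> z powr (p + \<beta>)) \<partial>lborel)"
    by (rule nn_integral_cmult) simp
  finally have "ennreal (\<bar>a\<bar> powr p) *
      (\<integral>\<^sup>+z\<in>\<Omega>. ennreal (\<bar>\<phi> z\<bar> powr p * (\<rho> z powr \<beta> * rpow (norm (fst z) / \<rho> z) (\<gamma> * p))) \<partial>lborel)
    \<le> ennreal (\<bar>a\<bar> powr p) * (ennreal (\<bar>a\<bar> powr (- p)) *
      (\<integral>\<^sup>+z\<in>\<Omega>. ennreal (norm (grad_gamma \<gamma> \<phi> z) powr p * \<rho> z powr (p + \<beta>)) \<partial>lborel))"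
    by (rule mult_left_mono) simp
  also have "ennreal (\<bar>a\<bar> powr p) * (ennreal (\<bar>a\<bar> powr (- p)) * X) = X" for X
    using a(1) by (simp add: mult.assoc[symmetric] flip: ennreal_mult powr_add)
  finally show ?thesis by (simp only: a(3))
qed simp

lemma hardy_power:
  assumes p: "1 < p" and \<Omega>: "open \<Omega>" "Q + \<beta> < 0 \<Longrightarrow> 0 \<notin> \<Omega>"
    and uG: "(u, G) \<in> DL \<gamma> p \<Omega> (\<lambda>z. \<rho> z powr (p + \<beta>))"
  shows "ennreal ((\<bar>Q + \<beta>\<bar> / p) powr p) *
      (\<integral>\<^sup>+z\<in>\<Omega>. ennreal (\<bar>u z\<bar> powr p * \<rho> z powr \<beta> * rpow (norm (fst z) / \<rho> z) (\<gamma> * p)) \<partial>lborel)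
    \<le> (\<integral>\<^sup>+z\<in>\<Omega>. ennreal (norm (G z) powr p * \<rho> z powr (p + \<beta>)) \<partial>lborel)"
  unfolding mult.assoc
  by (rule DL_inequality[OF p _ _ _ _ _ _ uG])
    (use \<Omega> in \<open>auto intro!: hardy_power_test p mult_nonneg_nonneg rpow_nonneg\<close>)

text \<open>Not a literal instance of \<open>\<beta> = - p\<close>: the weight
  \<open>\<rho> z powr 0\<close> is 0 at the origin, not 1, so the spaces differ formally. The
  inequality for test functions is therefore extended anew, using
  \<open>\<rho> z powr 0 \<le> 1\<close>.\<close>

lemma hardy_power_unweighted:
  assumes p: "1 < p" and \<Omega>: "open \<Omega>" "Q - p < 0 \<Longrightarrow> 0 \<notin> \<Omega>"
    and uG: "(u, G) \<in> DL \<gamma> p \<Omega> (\<lambda>z. 1)"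
  shows "ennreal ((\<bar>Q - p\<bar> / p) powr p) *
      (\<integral>\<^sup>+z\<in>\<Omega>. ennreal (\<bar>u z\<bar> powr p / \<rho> z powr p * rpow (norm (fst z) / \<rho> z) (\<gamma> * p)) \<partial>lborel)
    \<le> (\<integral>\<^sup>+z\<in>\<Omega>. ennreal (norm (G z) powr p) \<partial>lborel)"
proof -
  have "ennreal ((\<bar>Q - p\<bar> / p) powr p) *
      (\<integral>\<^sup>+z\<in>\<Omega>. ennreal (\<bar>u z\<bar> powr p * (\<rho> z powr (- p) * rpow (norm (fst z) / \<rho> z) (\<gamma> * p))) \<partial>lborel)
    \<le> (\<integral>\<^sup>+z\<in>\<Omega>. ennreal (norm (G z) powr p * 1) \<partial>lborel)"
  proof (rule DL_inequality[OF p _ _ _ _ _ _ uG])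
    fix \<phi> :: "(real^'n) \<times> (real^'k) \<Rightarrow> real" assume \<phi>: "test_fun \<Omega> \<phi>"
    have "ennreal ((\<bar>Q - p\<bar> / p) powr p) *
        (\<integral>\<^sup>+z\<in>\<Omega>. ennreal (\<bar>\<phi> z\<bar> powr p * (\<rho> z powr (- p) * rpow (norm (fst z) / \<rho> z) (\<gamma> * p))) \<partial>lborel)
      \<le> (\<integral>\<^sup>+z\<in>\<Omega>. ennreal (norm (grad_gamma \<gamma> \<phi> z) powr p * \<rho> z powr (p + - p)) \<partial>lborel)"
      using hardy_power_test[OF p \<phi>, of "- p"] \<Omega> by simp
    also have "\<dots> \<le> (\<integral>\<^sup>+z\<in>\<Omega>. ennreal (norm (grad_gamma \<gamma> \<phi> z) powr p * 1) \<partial>lborel)"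
      by (intro nn_integral_mono mult_right_mono ennreal_leI mult_left_mono) auto
    finally show "ennreal ((\<bar>Q - p\<bar> / p) powr p) *
        (\<integral>\<^sup>+z\<in>\<Omega>. ennreal (\<bar>\<phi> z\<bar> powr p * (\<rho> z powr (- p) * rpow (norm (fst z) / \<rho> z) (\<gamma> * p))) \<partial>lborel)
      \<le> (\<integral>\<^sup>+z\<in>\<Omega>. ennreal (norm (grad_gamma \<gamma> \<phi> z) powr p * 1) \<partial>lborel)" .
  qed (use \<Omega> in \<open>auto intro: mult_nonneg_nonneg rpow_nonneg\<close>)
  then show ?thesis by (simp add: powr_minus_divide)
qed

lemma hardy_log_test:
  assumes p: "1 < p" "p = Q" and R: "0 < R" and \<beta>: "\<beta> < -1"
    and \<phi>: "test_fun {z. \<rho> z < R} \<phi>"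
  shows "ennreal ((\<bar>\<beta> + 1\<bar> / p) powr p) * (\<integral>\<^sup>+z\<in>{z. \<rho> z < R}. ennreal (\<bar>\<phi> z\<bar> powr p *
        (1 / \<rho> z powr p * ln (R / \<rho> z) powr \<beta> * rpow (norm (fst z) / \<rho> z) (\<gamma> * p))) \<partial>lborel)
    \<le> (\<integral>\<^sup>+z\<in>{z. \<rho> z < R}. ennreal (norm (grad_gamma \<gamma> \<phi> z) powr p * ln (R / \<rho> z) powr (p + \<beta>)) \<partial>lborel)"
proof -
  let ?\<Omega> = "{z. \<rho> z < R}"
  \<comment> \<open>This choice turns the exponents of \<open>hardy_test_log\<close> into
    \<open>\<beta>\<close> and \<open>p + \<beta>\<close>; it is positive exactly because
    \<open>\<beta> < -1\<close>. The hypothesis \<open>p = Q\<close> removes the power of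
    \<open>\<rho>\<close> on the gradient side.\<close>
  define \<theta> where "\<theta> = - (\<beta> + 1) / p"
  have th: "0 < \<theta>" "- 1 - \<theta> * p = \<beta>" "p - 1 - \<theta> * p = p + \<beta>" "\<bar>\<beta> + 1\<bar> / p = \<theta>"
    using \<beta> p(1) by (auto simp: \<theta>_def field_simps)
  have sm: "smooth \<phi>" using \<phi> by (simp add: test_fun_def)
  have [measurable]: "\<phi> \<in> borel_measurable borel" "flow_deriv \<phi> \<in> borel_measurable borel"
    "grad_gamma \<gamma> \<phi> \<in> borel_measurable borel"
    using sm by (auto intro: borel_measurable_smooth borel_measurable_continuous_onI
        continuous_on_flow_deriv borel_measurable_grad_gamma)
  have ln: "ln (R / \<rho> z) = ln R - ln (\<rho> z)" if "z \<noteq> 0" for z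
    using gnorm_pos[OF that] R by (simp add: ln_div)
  have "(\<integral>\<^sup>+z\<in>?\<Omega>. ennreal (\<bar>\<phi> z\<bar> powr p *
        (1 / \<rho> z powr p * ln (R / \<rho> z) powr \<beta> * rpow (norm (fst z) / \<rho> z) (\<gamma> * p))) \<partial>lborel)
    \<le> (\<integral>\<^sup>+z. ennreal (dens p z) * ennreal (\<bar>\<phi> z\<bar> powr p * (ln R - ln (\<rho> z)) powr (- 1 - \<theta> * p)) \<partial>lborel)"
  proof (rule nn_integral_mono)
    fix z :: "(real^'n) \<times> (real^'k)"
    show "ennreal (\<bar>\<phi> z\<bar> powr p *
        (1 / \<rho> z powr p * ln (R / \<rho> z) powr \<beta> * rpow (norm (fst z) / \<rho> z) (\<gamma> * p))) * indicator ?\<Omega> z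
      \<le> ennreal (dens p z) * ennreal (\<bar>\<phi> z\<bar> powr p * (ln R - ln (\<rho> z)) powr (- 1 - \<theta> * p))"
    proof (cases "z = 0")
      case True
      then show ?thesis by (simp add: gnorm_eq_0_iff[THEN iffD2])
    next
      case False
      then show ?thesis
        by (auto simp: th(2) ln dens_def rpow_nonneg powr_minus_divide p(2)[symmetric] indicator_def mult_ac
            simp flip: ennreal_mult)
    qed
  qed
  also have "\<dots> \<le> (\<integral>\<^sup>+z. ennreal (dens p z) * ennreal (\<bar>flow_deriv \<phi> z\<bar> powr p
        * (\<theta> powr (- p) * (ln R - ln (\<rho> z)) powr (p - 1 - \<theta> * p))) \<partial>lborel)"
    by (rule hardy_test_log[OF p(1) \<phi> R th(1)])
  also have "\<dots> \<le> (\<integral>\<^sup>+z. ennreal (\<theta> powr (- p)) *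
      (ennreal (norm (grad_gamma \<gamma> \<phi> z) powr p * ln (R / \<rho> z) powr (p + \<beta>)) * indicator ?\<Omega> z) \<partial>lborel)"
  proof (rule nn_integral_mono_AE)
    show "AE z in lborel. ennreal (dens p z) * ennreal (\<bar>flow_deriv \<phi> z\<bar> powr p
        * (\<theta> powr (- p) * (ln R - ln (\<rho> z)) powr (p - 1 - \<theta> * p)))
      \<le> ennreal (\<theta> powr (- p)) * (ennreal (norm (grad_gamma \<gamma> \<phi> z) powr p * ln (R / \<rho> z) powr (p + \<beta>)) * indicator ?\<Omega> z)"
      using AE_fst_nonzero
    proof eventually_elim
      case (elim z)
      then have z: "z \<noteq> 0" by auto
      show ?case
      proof (cases "z \<in> ?\<Omega>")
        case True
        have "dens p z * \<bar>flow_deriv \<phi> z\<bar> powr p * (\<theta> powr (- p) * ln (R / \<rho> z) powr (p + \<beta>))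
            \<le> norm (grad_gamma \<gamma> \<phi> z) powr p * (\<theta> powr (- p) * ln (R / \<rho> z) powr (p + \<beta>))"
          using dens_flow_deriv_le[OF sm elim, of p] p gnorm_pos[OF z] by (intro mult_right_mono) auto
        then show ?thesis
          using True by (simp add: th(3) ln[OF z] dens_nonneg mult_ac flip: ennreal_mult)
      next
        case False
        then show ?thesis using test_fun_outside_grad(3)[OF \<phi>, of z] p by simp
      qed
    qed
  qed
  also have "\<dots> = ennreal (\<theta> powr (- p)) *
      (\<integral>\<^sup>+z\<in>?\<Omega>. ennreal (norm (grad_gamma \<gamma> \<phi> z) powr p * ln (R / \<rho> z) powr (p + \<beta>)) \<partial>lborel)"
    by (rule nn_integral_cmult) simp
  finally have "ennreal (\<theta> powr p) * (\<integral>\<^sup>+z\<in>?\<Omega>. ennreal (\<bar>\<phi> z\<bar> powr p *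
        (1 / \<rho> z powr p * ln (R / \<rho> z) powr \<beta> * rpow (norm (fst z) / \<rho> z) (\<gamma> * p))) \<partial>lborel)
    \<le> ennreal (\<theta> powr p) * (ennreal (\<theta> powr (- p)) *
      (\<integral>\<^sup>+z\<in>?\<Omega>. ennreal (norm (grad_gamma \<gamma> \<phi> z) powr p * ln (R / \<rho> z) powr (p + \<beta>)) \<partial>lborel))"
    by (rule mult_left_mono) simp
  also have "ennreal (\<theta> powr p) * (ennreal (\<theta> powr (- p)) * X) = X" for X
    using th(1) by (simp add: mult.assoc[symmetric] flip: ennreal_mult powr_add)
  finally show ?thesis by (simp only: th(4))
qed

lemma hardy_log:
  assumes p: "1 < p" "p = Q" and R: "0 < R" and \<beta>: "\<beta> < -1"
    and uG: "(u, G) \<in> DL \<gamma> p {z. \<rho> z < R} (\<lambda>z. ln (R / \<rho> z) powr (p + \<beta>))"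
  shows "ennreal ((\<bar>\<beta> + 1\<bar> / p) powr p) * (\<integral>\<^sup>+z\<in>{z. \<rho> z < R}. ennreal (\<bar>u z\<bar> powr p /
        \<rho> z powr p * ln (R / \<rho> z) powr \<beta> * rpow (norm (fst z) / \<rho> z) (\<gamma> * p)) \<partial>lborel)
    \<le> (\<integral>\<^sup>+z\<in>{z. \<rho> z < R}. ennreal (norm (G z) powr p * ln (R / \<rho> z) powr (p + \<beta>)) \<partial>lborel)"
proof -
  have "ennreal ((\<bar>\<beta> + 1\<bar> / p) powr p) * (\<integral>\<^sup>+z\<in>{z. \<rho> z < R}. ennreal (\<bar>u z\<bar> powr p *
        (1 / \<rho> z powr p * ln (R / \<rho> z) powr \<beta> * rpow (norm (fst z) / \<rho> z) (\<gamma> * p))) \<partial>lborel)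
    \<le> (\<integral>\<^sup>+z\<in>{z. \<rho> z < R}. ennreal (norm (G z) powr p * ln (R / \<rho> z) powr (p + \<beta>)) \<partial>lborel)"
  proof (rule DL_inequality[OF p(1) _ _ _ _ _ _ uG])
    fix \<phi> :: "(real^'n) \<times> (real^'k) \<Rightarrow> real" assume "test_fun {z. \<rho> z < R} \<phi>"
    then show "ennreal ((\<bar>\<beta> + 1\<bar> / p) powr p) * (\<integral>\<^sup>+z\<in>{z. \<rho> z < R}. ennreal (\<bar>\<phi> z\<bar> powr p *
        (1 / \<rho> z powr p * ln (R / \<rho> z) powr \<beta> * rpow (norm (fst z) / \<rho> z) (\<gamma> * p))) \<partial>lborel)
      \<le> (\<integral>\<^sup>+z\<in>{z. \<rho> z < R}. ennreal (norm (grad_gamma \<gamma> \<phi> z) powr p * ln (R / \<rho> z) powr (p + \<beta>)) \<partial>lborel)"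
      by (rule hardy_log_test[OF p R \<beta>])
  qed (auto intro!: divide_nonneg_nonneg mult_nonneg_nonneg rpow_nonneg)
  then show ?thesis by (simp add: mult.assoc)
qed

text \<open>As in the power case, weight 1 is not literally the logarithm to the power 0, so the
  extension from test functions is repeated. Inside the ball the logarithm is positive away from the
  origin, which allows the power of the product to be split.\<close>

lemma hardy_log_unweighted:
  assumes p: "1 < p" "p = Q" and R: "0 < R" and uG: "(u, G) \<in> DL \<gamma> p {z. \<rho> z < R} (\<lambda>z. 1)"
  shows "ennreal (((p - 1) / p) powr p) * (\<integral>\<^sup>+z\<in>{z. \<rho> z < R}. ennreal (\<bar>u z\<bar> powr p /
        (\<rho> z * ln (R / \<rho> z)) powr p * rpow (norm (fst z) / \<rho> z) (\<gamma> * p)) \<partial>lborel)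
    \<le> (\<integral>\<^sup>+z\<in>{z. \<rho> z < R}. ennreal (norm (G z) powr p) \<partial>lborel)"
proof -
  have w: "\<bar>v\<bar> powr p / (\<rho> z * ln (R / \<rho> z)) powr p * rpow (norm (fst z) / \<rho> z) (\<gamma> * p)
      = \<bar>v\<bar> powr p * (1 / \<rho> z powr p * ln (R / \<rho> z) powr (- p) * rpow (norm (fst z) / \<rho> z) (\<gamma> * p))"
    if "\<rho> z < R" for z v
  proof (cases "z = 0")
    case False
    then have "ln (R / \<rho> z) > 0" using that gnorm_pos[of z] by simp
    then show ?thesis by (simp add: powr_mult gnorm_nonneg powr_minus_divide)
  qed (simp add: gnorm_eq_0_iff[THEN iffD2])
  have "ennreal (((p - 1) / p) powr p) * (\<integral>\<^sup>+z\<in>{z. \<rho> z < R}. ennreal (\<bar>u z\<bar> powr p *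
        (1 / \<rho> z powr p * ln (R / \<rho> z) powr (- p) * rpow (norm (fst z) / \<rho> z) (\<gamma> * p))) \<partial>lborel)
    \<le> (\<integral>\<^sup>+z\<in>{z. \<rho> z < R}. ennreal (norm (G z) powr p * 1) \<partial>lborel)"
  proof (rule DL_inequality[OF p(1) _ _ _ _ _ _ uG])
    fix \<phi> :: "(real^'n) \<times> (real^'k) \<Rightarrow> real" assume \<phi>: "test_fun {z. \<rho> z < R} \<phi>"
    have "ennreal (((p - 1) / p) powr p) * (\<integral>\<^sup>+z\<in>{z. \<rho> z < R}. ennreal (\<bar>\<phi> z\<bar> powr p *
          (1 / \<rho> z powr p * ln (R / \<rho> z) powr (- p) * rpow (norm (fst z) / \<rho> z) (\<gamma> * p))) \<partial>lborel)
      \<le> (\<integral>\<^sup>+z\<in>{z. \<rho> z < R}. ennreal (norm (grad_gamma \<gamma> \<phi> z) powr p * ln (R / \<rho> z) powr (p + - p)) \<partial>lborel)"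
      using hardy_log_test[OF p R _ \<phi>, of "- p"] p(1) by simp
    also have "\<dots> \<le> (\<integral>\<^sup>+z\<in>{z. \<rho> z < R}. ennreal (norm (grad_gamma \<gamma> \<phi> z) powr p * 1) \<partial>lborel)"
      by (intro nn_integral_mono mult_right_mono ennreal_leI mult_left_mono) auto
    finally show "ennreal (((p - 1) / p) powr p) * (\<integral>\<^sup>+z\<in>{z. \<rho> z < R}. ennreal (\<bar>\<phi> z\<bar> powr p *
          (1 / \<rho> z powr p * ln (R / \<rho> z) powr (- p) * rpow (norm (fst z) / \<rho> z) (\<gamma> * p))) \<partial>lborel)
      \<le> (\<integral>\<^sup>+z\<in>{z. \<rho> z < R}. ennreal (norm (grad_gamma \<gamma> \<phi> z) powr p * 1) \<partial>lborel)" .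
  qed (auto intro!: divide_nonneg_nonneg mult_nonneg_nonneg rpow_nonneg)
  also have "(\<integral>\<^sup>+z\<in>{z. \<rho> z < R}. ennreal (\<bar>u z\<bar> powr p *
        (1 / \<rho> z powr p * ln (R / \<rho> z) powr (- p) * rpow (norm (fst z) / \<rho> z) (\<gamma> * p))) \<partial>lborel)
      = (\<integral>\<^sup>+z\<in>{z. \<rho> z < R}. ennreal (\<bar>u z\<bar> powr p /
        (\<rho> z * ln (R / \<rho> z)) powr p * rpow (norm (fst z) / \<rho> z) (\<gamma> * p)) \<partial>lborel)"
  proof (intro nn_integral_cong)
    fix z :: "(real^'n) \<times> (real^'k)"
    show "ennreal (\<bar>u z\<bar> powr p *
        (1 / \<rho> z powr p * ln (R / \<rho> z) powr (- p) * rpow (norm (fst z) / \<rho> z) (\<gamma> * p))) * indicator {z. \<rho> z < R} z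
      = ennreal (\<bar>u z\<bar> powr p /
        (\<rho> z * ln (R / \<rho> z)) powr p * rpow (norm (fst z) / \<rho> z) (\<gamma> * p)) * indicator {z. \<rho> z < R} z"
    proof (cases "\<rho> z < R")
      case True
      then show ?thesis by (simp only: w)
    qed simp
  qed
  finally show ?thesis by simp
qed

end

section \<open>Smooth approximation of radial functions\<close>

text \<open>The homogeneous norm is in general not smooth where \<open>x = 0\<close>; replacing \<open>\<bar>x\<bar>\<^sup>2\<close> by
  \<open>\<bar>x\<bar>\<^sup>2 + \<delta>\<^sup>2\<close> makes functions of its logarithm smooth without increasing the gradient in the limit.\<close>

context grushin
begin

definition reg :: "real \<Rightarrow> (real^'n) \<times> (real^'k) \<Rightarrow> real" where
  "reg \<delta> z = ((norm (fst z))\<^sup>2 + \<delta>\<^sup>2) powr (1 + \<gamma>) + (1 + \<gamma>)\<^sup>2 * (norm (snd z))\<^sup>2"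

definition lreg :: "real \<Rightarrow> (real^'n) \<times> (real^'k) \<Rightarrow> real" where
  "lreg \<delta> z = 1 / (2 + 2 * \<gamma>) * ln (reg \<delta> z)"

text \<open>An upper bound for the gradient norm of \<open>lreg \<delta>\<close>. As
  \<open>\<delta>\<close> tends to 0 it tends to
  \<open>|x|^\<gamma> / \<rho> powr (1 + \<gamma>)\<close>, the gradient norm of
  \<open>ln \<rho>\<close> where \<open>x\<close> is nonzero.\<close>

definition reg_slope :: "real \<Rightarrow> (real^'n) \<times> (real^'k) \<Rightarrow> real" where
  "reg_slope \<delta> z = sqrt (((norm (fst z))\<^sup>2 + \<delta>\<^sup>2) powr \<gamma> / reg \<delta> z)"

lemma reg_base_pos: "\<delta> > 0 \<Longrightarrow> (norm (fst z))\<^sup>2 + \<delta>\<^sup>2 > 0"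
  by (simp add: add_nonneg_pos)

lemma reg_pos: "\<delta> > 0 \<Longrightarrow> reg \<delta> z > 0"
  using reg_base_pos[of \<delta> z] by (simp add: reg_def add_pos_nonneg)

lemma smooth_norm_sq:
  assumes "bounded_linear (f :: 'a::real_normed_vector \<Rightarrow> real^'m)"
  shows "smooth (\<lambda>z. (norm (f z))\<^sup>2)"
proof -
  have "(norm (f z))\<^sup>2 = (\<Sum>i\<in>UNIV. f z $ i * f z $ i)" for z
    by (simp add: power2_norm_eq_inner inner_vec_def)
  moreover have "smooth (\<lambda>z. f z $ i)" for i
    using bounded_linear_compose[OF bounded_linear_vec_nth assms] by (rule smooth_linear)
  ultimately show ?thesis
    by (simp only:) (intro smooth_sum smooth_mult)
qed

lemma smooth_lreg: "\<delta> > 0 \<Longrightarrow> smooth (lreg \<delta>)"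
  using reg_pos unfolding lreg_def[abs_def] reg_def
  by (intro smooth_mult smooth_ln smooth_add smooth_powr smooth_norm_sq smooth_const)
    (auto simp: reg_base_pos bounded_linear_fst bounded_linear_snd)

lemma lreg_has_derivative:
  assumes "\<delta> > 0"
  shows "(lreg \<delta> has_derivative (\<lambda>h. (((norm (fst z))\<^sup>2 + \<delta>\<^sup>2) powr \<gamma> * (fst z \<bullet> fst h)
    + (1 + \<gamma>) * (snd z \<bullet> snd h)) / reg \<delta> z)) (at z)"
proof -
  let ?A = "\<lambda>z::(real^'n) \<times> (real^'k). fst z \<bullet> fst z + \<delta>\<^sup>2"
  have A: "?A z > 0" using reg_base_pos[OF assms, of z] by (simp add: power2_norm_eq_inner)
  have rA: "reg \<delta> = (\<lambda>z. ?A z powr (1 + \<gamma>) + (1 + \<gamma>)\<^sup>2 * (snd z \<bullet> snd z))"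
    by (simp add: reg_def power2_norm_eq_inner fun_eq_iff)
  have "(?A has_derivative (\<lambda>h. 2 * (fst z \<bullet> fst h))) (at z)"
    by (auto intro!: derivative_eq_intros simp: inner_commute)
  from has_derivative_powr[OF this has_derivative_const[of "1 + \<gamma>"] A]
  have d1: "((\<lambda>z. ?A z powr (1 + \<gamma>)) has_derivative (\<lambda>h. (2 + 2 * \<gamma>) * (?A z powr \<gamma> * (fst z \<bullet> fst h)))) (at z)"
  proof (rule has_derivative_eq_rhs)
    have "?A z powr (1 + \<gamma>) = ?A z * ?A z powr \<gamma>"
      using A by (simp add: powr_add)
    then show "(\<lambda>h. ?A z powr (1 + \<gamma>) * (0 * ln (?A z) + 2 * (fst z \<bullet> fst h) * (1 + \<gamma>) / ?A z))
        = (\<lambda>h. (2 + 2 * \<gamma>) * (?A z powr \<gamma> * (fst z \<bullet> fst h)))"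
      using A by (simp add: fun_eq_iff)
  qed simp
  have d2: "((\<lambda>z. (1 + \<gamma>)\<^sup>2 * (snd z \<bullet> snd z)) has_derivative
      (\<lambda>h. (2 + 2 * \<gamma>) * ((1 + \<gamma>) * (snd z \<bullet> snd h)))) (at z)"
    by (auto intro!: derivative_eq_intros simp: inner_commute power2_eq_square algebra_simps)
  define N where "N h = ?A z powr \<gamma> * (fst z \<bullet> fst h) + (1 + \<gamma>) * (snd z \<bullet> snd h)" for h
  have "(reg \<delta> has_derivative (\<lambda>h. (2 + 2 * \<gamma>) * N h)) (at z)"
    unfolding rA N_def using has_derivative_add[OF d1 d2] by (simp add: distrib_left)
  from has_derivative_mult_right[OF has_derivative_ln[OF reg_pos[OF assms] this], of "1 / (2 + 2 * \<gamma>)"]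
  have "(lreg \<delta> has_derivative (\<lambda>h. N h / reg \<delta> z)) (at z)"
    unfolding lreg_def[abs_def]
  proof (rule has_derivative_eq_rhs)
    have "2 + 2 * \<gamma> \<noteq> 0" using gamma_nonneg by simp
    then have "1 / (2 + 2 * \<gamma>) * ((2 + 2 * \<gamma>) * x) = x" for x :: real by simp
    then show "(\<lambda>h. 1 / (2 + 2 * \<gamma>) * ((2 + 2 * \<gamma>) * N h * inverse (reg \<delta> z))) = (\<lambda>h. N h / reg \<delta> z)"
      by (simp only: mult.assoc divide_inverse[of "N _"])
  qed
  then show ?thesis by (simp only: N_def power2_norm_eq_inner)
qed

lemma norm_Pair_scaleR_sq:
  "(norm (a *\<^sub>R x :: 'a::real_normed_vector, b *\<^sub>R y :: 'b::real_normed_vector))\<^sup>2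
    = a\<^sup>2 * (norm x)\<^sup>2 + b\<^sup>2 * (norm y)\<^sup>2"
  by (simp add: norm_Pair power_mult_distrib)

text \<open>Bounding \<open>|x|^2\<close> and \<open>|x|^(2\<gamma>)\<close> by the corresponding
  powers of \<open>|x|^2 + \<delta>^2\<close> makes the two components recombine into
  \<open>reg \<delta> z\<close>.\<close>

lemma norm_grad_radial_le:
  assumes "\<delta> > 0" "smooth G"
  shows "norm (grad_gamma \<gamma> (\<lambda>z. G (lreg \<delta> z)) z) \<le> \<bar>deriv G (lreg \<delta> z)\<bar> * reg_slope \<delta> z"
proof -
  let ?A = "(norm (fst z))\<^sup>2 + \<delta>\<^sup>2" and ?g = "deriv G (lreg \<delta> z)" and ?r = "rpow (norm (fst z)) \<gamma>"
  let ?k = "?g / reg \<delta> z"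
  have A: "?A > 0" and r: "reg \<delta> z > 0" using reg_base_pos reg_pos assms by auto
  have "((\<lambda>z. G (lreg \<delta> z)) has_derivative (\<lambda>h. ?g * ((?A powr \<gamma> * (fst z \<bullet> fst h)
    + (1 + \<gamma>) * (snd z \<bullet> snd h)) / reg \<delta> z))) (at z)"
    using has_derivative_compose[OF lreg_has_derivative[OF assms(1)]
        smooth_real_deriv(1)[OF assms(2), unfolded has_field_derivative_def]] by simp
  from frechet_derivative_at[OF this, symmetric]
  have "grad_gamma \<gamma> (\<lambda>z. G (lreg \<delta> z)) z = ((?k * ?A powr \<gamma>) *\<^sub>R fst z, (?k * ?r * (1 + \<gamma>)) *\<^sub>R snd z)"
    by (simp add: grad_gamma_def vec_eq_iff inner_axis prod_eq_iff)
  then have "(norm (grad_gamma \<gamma> (\<lambda>z. G (lreg \<delta> z)) z))\<^sup>2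
      = ?k\<^sup>2 * ((?A powr \<gamma>)\<^sup>2 * (norm (fst z))\<^sup>2 + ?r\<^sup>2 * ((1 + \<gamma>)\<^sup>2 * (norm (snd z))\<^sup>2))"
    by (simp only: norm_Pair_scaleR_sq power_mult_distrib distrib_left mult_ac)
  also have "\<dots> \<le> ?k\<^sup>2 * (?A powr \<gamma> * ?A powr (1 + \<gamma>) + ?A powr \<gamma> * ((1 + \<gamma>)\<^sup>2 * (norm (snd z))\<^sup>2))"
  proof (intro mult_left_mono add_mono mult_right_mono)
    have "(?A powr \<gamma>)\<^sup>2 * (norm (fst z))\<^sup>2 \<le> (?A powr \<gamma>)\<^sup>2 * ?A"
      by (intro mult_left_mono) auto
    also have "\<dots> = ?A powr \<gamma> * ?A powr (1 + \<gamma>)"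
      using A by (simp add: powr_add power2_eq_square)
    finally show "(?A powr \<gamma>)\<^sup>2 * (norm (fst z))\<^sup>2 \<le> ?A powr \<gamma> * ?A powr (1 + \<gamma>)" .
    show "?r\<^sup>2 \<le> ?A powr \<gamma>"
    proof (cases "\<gamma> = 0")
      case True
      then show ?thesis using assms(1) by (simp add: rpow_def)
    next
      case False
      have "?r\<^sup>2 = ((norm (fst z))\<^sup>2) powr \<gamma>"
        using False by (simp add: rpow_def power2_eq_square powr_mult)
      also have "\<dots> \<le> ?A powr \<gamma>"
        using gamma_nonneg by (intro powr_mono2) auto
      finally show ?thesis .
    qed
  qed auto
  also have "\<dots> = ?k\<^sup>2 * (?A powr \<gamma> * reg \<delta> z)"
    by (simp add: reg_def distrib_left)
  also have "\<dots> = (\<bar>?g\<bar> * reg_slope \<delta> z)\<^sup>2"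
  proof -
    have "(reg_slope \<delta> z)\<^sup>2 = ?A powr \<gamma> / reg \<delta> z"
      using r by (simp add: reg_slope_def)
    then show ?thesis
      using r by (simp add: power_mult_distrib power_divide) (simp add: power2_eq_square)
  qed
  finally show ?thesis
    by (rule power2_le_imp_le) (use r in \<open>simp add: reg_slope_def\<close>)
qed

lemma reg_slope_nonneg: "\<delta> > 0 \<Longrightarrow> reg_slope \<delta> z \<ge> 0"
  using reg_pos[of \<delta> z] by (simp add: reg_slope_def)

text \<open>A bound with no other dependence on \<open>\<delta>\<close> than through
  \<open>lreg\<close>: on the support of a profile, where \<open>lreg\<close> is bounded below, it
  dominates the gradients uniformly in \<open>\<delta>\<close>.\<close>

lemma reg_slope_le:
  assumes "\<delta> > 0" shows "reg_slope \<delta> z \<le> exp (- lreg \<delta> z)"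
proof -
  let ?A = "(norm (fst z))\<^sup>2 + \<delta>\<^sup>2" and ?B = "reg \<delta> z powr (1 / (1 + \<gamma>))"
  have A: "?A > 0" and r: "reg \<delta> z > 0" using reg_base_pos reg_pos assms by auto
  have "?A = (?A powr (1 + \<gamma>)) powr (1 / (1 + \<gamma>))"
    using gamma_nonneg A by (simp add: powr_powr)
  also have "\<dots> \<le> ?B"
    using gamma_nonneg by (intro powr_mono2) (auto simp: reg_def)
  finally have "?A powr \<gamma> * ?B \<le> ?B powr \<gamma> * ?B"
    using gamma_nonneg A by (intro mult_right_mono powr_mono2) auto
  also have "\<dots> = ?B powr (1 + \<gamma>)"
    using r by (simp add: powr_add)
  also have "\<dots> = reg \<delta> z"
    using r gamma_nonneg by (simp add: powr_powr)
  finally have "?A powr \<gamma> / reg \<delta> z \<le> 1 / ?B"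
    using r by (simp add: field_simps)
  also have "1 / ?B = (exp (- lreg \<delta> z))\<^sup>2"
  proof -
    have "1 / ?B = exp (- (1 / (1 + \<gamma>) * ln (reg \<delta> z)))"
      using r by (simp add: powr_def exp_minus inverse_eq_divide)
    also have "1 / (1 + \<gamma>) * ln (reg \<delta> z) = 2 * lreg \<delta> z"
      using gamma_nonneg by (simp add: lreg_def field_simps)
    finally show ?thesis by (simp add: exp_double[symmetric])
  qed
  finally have "sqrt (?A powr \<gamma> / reg \<delta> z) \<le> sqrt ((exp (- lreg \<delta> z))\<^sup>2)"
    by (rule real_sqrt_le_mono)
  then show ?thesis by (simp add: reg_slope_def)
qed

lemma ln_gnorm_eq: "z \<noteq> 0 \<Longrightarrow> ln (\<rho> z) = 1 / (2 + 2 * \<gamma>) * ln (gsq z)"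
  using gsq_eq_0_iff[of z] by (simp add: gnorm_gsq ln_powr)

lemma gsq_pos: "z \<noteq> 0 \<Longrightarrow> gsq z > 0"
  using gsq_nonneg[of z] gsq_eq_0_iff[of z] by simp

lemma gsq_alt: "gsq z = ((norm (fst z))\<^sup>2) powr (1 + \<gamma>) + (1 + \<gamma>)\<^sup>2 * (norm (snd z))\<^sup>2"
  using powr_powr[of "norm (fst z)" 2 "1 + \<gamma>"] by (simp add: gsq_def)

text \<open>Regularisation only increases the logarithm, so it cannot push the support of a radial
  profile outward.\<close>

lemma ln_gnorm_le_lreg:
  assumes "\<delta> > 0" "z \<noteq> 0" shows "ln (\<rho> z) \<le> lreg \<delta> z"
proof -
  have "gsq z \<le> reg \<delta> z"
    unfolding gsq_alt reg_def using gamma_nonneg by (intro add_right_mono powr_mono2) auto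
  then show ?thesis
    using gsq_pos[OF assms(2)] gamma_nonneg unfolding ln_gnorm_eq[OF assms(2)] lreg_def
    by (intro mult_left_mono) auto
qed

text \<open>Keeps regularised profiles away from the origin: near it, \<open>lreg\<close> stays low
  for all small \<open>\<delta>\<close>. Both summands of \<open>reg\<close> are at most
  \<open>(2 * c^2) powr (1 + \<gamma>)\<close>, and the resulting factor 2 is absorbed by
  \<open>2 powr (1 + \<gamma>)\<close>.\<close>

lemma lreg_le:
  assumes "0 < \<delta>" "\<delta> \<le> c" "\<rho> z \<le> c" shows "lreg \<delta> z \<le> ln (2 * c)"
proof -
  have c: "c > 0" using assms by simp
  have "(norm (fst z))\<^sup>2 \<le> c\<^sup>2" "\<delta>\<^sup>2 \<le> c\<^sup>2"
    using assms norm_fst_le_gnorm[of z] by (auto intro!: power_mono)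
  then have "((norm (fst z))\<^sup>2 + \<delta>\<^sup>2) powr (1 + \<gamma>) \<le> (2 * c\<^sup>2) powr (1 + \<gamma>)"
    using gamma_nonneg by (intro powr_mono2) auto
  moreover have "(1 + \<gamma>)\<^sup>2 * (norm (snd z))\<^sup>2 \<le> (2 * c\<^sup>2) powr (1 + \<gamma>)"
  proof -
    have "(1 + \<gamma>)\<^sup>2 * (norm (snd z))\<^sup>2 \<le> \<rho> z powr (2 + 2 * \<gamma>)"
      by (simp add: gnorm_powr gsq_def)
    also have "\<dots> \<le> c powr (2 + 2 * \<gamma>)"
      using assms gamma_nonneg gnorm_nonneg by (intro powr_mono2) auto
    also have "\<dots> = (c\<^sup>2) powr (1 + \<gamma>)"
      using c powr_powr[of c 2 "1 + \<gamma>"] by (simp add: powr_numeral)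
    also have "\<dots> \<le> (2 * c\<^sup>2) powr (1 + \<gamma>)"
      using gamma_nonneg by (intro powr_mono2) auto
    finally show ?thesis .
  qed
  ultimately have "reg \<delta> z \<le> 2 * (2 * c\<^sup>2) powr (1 + \<gamma>)"
    by (simp add: reg_def)
  also have "\<dots> \<le> 2 powr (1 + \<gamma>) * (2 * c\<^sup>2) powr (1 + \<gamma>)"
    using gamma_nonneg powr_mono[of 1 "1 + \<gamma>" 2] by (intro mult_right_mono) auto
  also have "\<dots> = ((2 * c)\<^sup>2) powr (1 + \<gamma>)"
    by (simp add: powr_mult[symmetric] power2_eq_square)
  also have "\<dots> = (2 * c) powr (2 + 2 * \<gamma>)"
    using c powr_powr[of "2 * c" 2 "1 + \<gamma>"] by (simp add: powr_numeral)
  finally have "ln (reg \<delta> z) \<le> (2 + 2 * \<gamma>) * ln (2 * c)"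
    using reg_pos[OF assms(1), of z] c ln_le_cancel_iff[of "reg \<delta> z" "(2 * c) powr (2 + 2 * \<gamma>)"]
    by (simp add: ln_powr)
  then show ?thesis using gamma_nonneg by (simp add: lreg_def field_simps)
qed

lemma lreg_tendsto:
  assumes "d \<longlonglongrightarrow> 0" "z \<noteq> 0"
  shows "(\<lambda>j. lreg (d j) z) \<longlonglongrightarrow> ln (\<rho> z)"
    and "(\<lambda>j. reg (d j) z) \<longlonglongrightarrow> gsq z"
proof -
  have "(\<lambda>j. (norm (fst z))\<^sup>2 + (d j)\<^sup>2) \<longlonglongrightarrow> (norm (fst z))\<^sup>2 + 0\<^sup>2"
    using assms(1) by (intro tendsto_intros)
  then have "(\<lambda>j. ((norm (fst z))\<^sup>2 + (d j)\<^sup>2) powr (1 + \<gamma>)) \<longlonglongrightarrow> ((norm (fst z))\<^sup>2 + 0\<^sup>2) powr (1 + \<gamma>)"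
    using gamma_nonneg by (intro tendsto_powr'[OF _ tendsto_const]) auto
  then show *: "(\<lambda>j. reg (d j) z) \<longlonglongrightarrow> gsq z"
    unfolding reg_def gsq_alt by (intro tendsto_add tendsto_const) simp
  show "(\<lambda>j. lreg (d j) z) \<longlonglongrightarrow> ln (\<rho> z)"
    unfolding lreg_def ln_gnorm_eq[OF assms(2)]
    using gsq_pos[OF assms(2)] by (intro tendsto_mult tendsto_const tendsto_ln *) auto
qed

lemma reg_slope_tendsto:
  assumes "d \<longlonglongrightarrow> 0" "fst z \<noteq> 0"
  shows "(\<lambda>j. reg_slope (d j) z) \<longlonglongrightarrow> norm (fst z) powr \<gamma> / \<rho> z powr (1 + \<gamma>)"
proof -
  have z: "z \<noteq> 0" using assms(2) by auto
  have "(\<lambda>j. (norm (fst z))\<^sup>2 + (d j)\<^sup>2) \<longlonglongrightarrow> (norm (fst z))\<^sup>2 + 0\<^sup>2"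
    using assms(1) by (intro tendsto_intros)
  then have "(\<lambda>j. ((norm (fst z))\<^sup>2 + (d j)\<^sup>2) powr \<gamma>) \<longlonglongrightarrow> ((norm (fst z))\<^sup>2 + 0\<^sup>2) powr \<gamma>"
    using assms(2) by (intro tendsto_powr[OF _ tendsto_const]) auto
  then have "(\<lambda>j. reg_slope (d j) z) \<longlonglongrightarrow> sqrt (((norm (fst z))\<^sup>2 + 0\<^sup>2) powr \<gamma> / gsq z)"
    unfolding reg_slope_def
    using gsq_pos[OF z] by (intro tendsto_real_sqrt tendsto_divide lreg_tendsto(2) assms z) auto
  also have "sqrt (((norm (fst z))\<^sup>2 + 0\<^sup>2) powr \<gamma> / gsq z)
      = sqrt ((norm (fst z) powr \<gamma> / \<rho> z powr (1 + \<gamma>))\<^sup>2)"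
    by (simp add: gnorm_powr[symmetric] power_divide power2_eq_square powr_mult flip: powr_add)
  finally show ?thesis by simp
qed

text \<open>The gradient of \<open>ln \<rho>\<close> to the power \<open>p\<close>, weighted by
  \<open>\<rho> powr (p - Q)\<close>, is the invariant density. Hence for radial functions both
  sides of the inequality are integrals against one measure, and the problem becomes
  one-dimensional.\<close>

lemma slope_powr_dens:
  assumes "fst z \<noteq> 0"
  shows "(norm (fst z) powr \<gamma> / \<rho> z powr (1 + \<gamma>)) powr p * \<rho> z powr (p - Q) = dens p z"
proof -
  have x: "norm (fst z) > 0" and r: "\<rho> z > 0" using assms gnorm_pos[of z] by (auto simp: prod_eq_iff)
  have "\<rho> z powr (- ((1 + \<gamma>) * p)) * \<rho> z powr (p - Q) = \<rho> z powr (- Q) * \<rho> z powr (- (\<gamma> * p))"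
  proof -
    have "- ((1 + \<gamma>) * p) + (p - Q) = - Q + - (\<gamma> * p)" by (simp add: algebra_simps)
    then show ?thesis by (simp only: powr_add[symmetric])
  qed
  moreover have "(norm (fst z) powr \<gamma> / \<rho> z powr (1 + \<gamma>)) powr p * \<rho> z powr (p - Q)
      = norm (fst z) powr (\<gamma> * p) * (\<rho> z powr (- ((1 + \<gamma>) * p)) * \<rho> z powr (p - Q))"
    using x r by (simp add: powr_divide powr_powr powr_minus_divide)
  moreover have "dens p z = norm (fst z) powr (\<gamma> * p) * (\<rho> z powr (- Q) * \<rho> z powr (- (\<gamma> * p)))"
    using x r by (simp add: dens_def rpow_pos powr_divide powr_minus_divide)
  ultimately show ?thesis by (simp only:)
qed

end

text \<open>The constant sequence approximates.\<close>

lemma test_fun_in_DL: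
  fixes \<phi> :: "(real^'n::finite) \<times> (real^'k::finite) \<Rightarrow> real"
  assumes "test_fun \<Omega> \<phi>"
    and "(\<integral>\<^sup>+z\<in>\<Omega>. ennreal (norm (grad_gamma \<gamma> \<phi> z) powr p * w z) \<partial>lborel) < \<infinity>"
  shows "(\<phi>, grad_gamma \<gamma> \<phi>) \<in> DL \<gamma> p \<Omega> w"
  unfolding DL_def
  using assms borel_measurable_smooth[of \<phi>] borel_measurable_grad_gamma[of \<phi> \<gamma>]
  by (auto simp: test_fun_def intro!: exI[of _ "\<lambda>_. \<phi>"])

lemma deriv_eq_0_outside:
  fixes G :: "real \<Rightarrow> real"
  assumes "\<And>l. l \<notin> {l0..l1} \<Longrightarrow> G l = 0" "l \<notin> {l0..l1}"
  shows "deriv G l = 0"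
proof (rule DERIV_imp_deriv)
  have "((\<lambda>_. 0) has_real_derivative 0) (at l)" by simp
  then show "(G has_real_derivative 0) (at l)"
    by (rule has_field_derivative_transform_within_open[where S = "- {l0..l1}"])
      (use assms in \<open>auto intro: open_Compl\<close>)
qed

lemma tendsto_ennreal_mult_powr:
  assumes "f \<longlonglongrightarrow> a" "p > 0" "\<And>j. f j \<ge> 0"
  shows "(\<lambda>j. ennreal (f j powr p * c)) \<longlonglongrightarrow> ennreal (a powr p * c)"
  using assms by (intro tendsto_ennrealI tendsto_mult tendsto_powr' tendsto_const) auto

context grushin
begin

text \<open>The profile is composed with \<open>lreg \<delta>\<close> in place of
  \<open>ln \<rho>\<close>. As \<open>\<delta>\<close> tends to 0 the gradient side converges by
  domination and the function side is lower semicontinuous by Fatou, so strictness persists for some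
  small \<open>\<delta>\<close>. Only a punctured gauge ball has to lie in \<open>\<Omega>\<close>,
  since the profile vanishes below \<open>l0\<close>.\<close>

lemma radial_sharp:
  fixes G w v :: "real \<Rightarrow> real"
  assumes p: "1 < p" and G: "smooth G" and supp: "\<And>l. l \<notin> {l0..l1} \<Longrightarrow> G l = 0"
    and \<Omega>: "\<And>z. z \<noteq> 0 \<Longrightarrow> ln (\<rho> z) \<le> l1 \<Longrightarrow> z \<in> \<Omega>"
    and [measurable]: "\<Omega> \<in> sets borel" "w \<in> borel_measurable borel" "v \<in> borel_measurable borel"
    and w0: "\<And>l. w l \<ge> 0" and v0: "\<And>l. v l \<ge> 0"
    and vb: "\<And>c. \<exists>K. \<forall>l\<in>{c..l1}. v l \<le> K"
    and less: "(\<integral>\<^sup>+z. ennreal (dens p z) * ennreal (\<bar>deriv G (ln (\<rho> z))\<bar> powr p * v (ln (\<rho> z))) \<partial>lborel)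
      < ennreal C * (\<integral>\<^sup>+z. ennreal (dens p z) * ennreal (\<bar>G (ln (\<rho> z))\<bar> powr p * w (ln (\<rho> z))) \<partial>lborel)"
  obtains \<phi> where "test_fun \<Omega> \<phi>"
    "(\<integral>\<^sup>+z\<in>\<Omega>. ennreal (norm (grad_gamma \<gamma> \<phi> z) powr p * (\<rho> z powr (p - Q) * v (ln (\<rho> z)))) \<partial>lborel)
      < ennreal C * (\<integral>\<^sup>+z\<in>\<Omega>. ennreal (\<bar>\<phi> z\<bar> powr p * (dens p z * w (ln (\<rho> z)))) \<partial>lborel)"
proof -
  \<comment> \<open>The factor 4 beats the 2 in \<open>lreg_le\<close>: for
    \<open>\<rho> z \<le> c\<close> and \<open>\<delta> \<le> c\<close> the regularised logarithm is
    at most \<open>l0 - ln 2\<close>, below the support of \<open>G\<close>.\<close>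
  define c where "c = exp l0 / 4"
  have c: "c > 0" by (simp add: c_def)
  define d where "d j = c / real (Suc j)" for j
  have d: "0 < d j" "d j \<le> c" for j using c by (auto simp: d_def field_simps)
  have d0: "d \<longlonglongrightarrow> 0"
    unfolding d_def using LIMSEQ_Suc[OF lim_const_over_n[of c]] by simp
  define u where "u j z = G (lreg (d j) z)" for j z
  \<comment> \<open>A compact annulus off the origin that contains the supports of all
    \<open>u j\<close>.\<close>
  define K where "K = {z. c \<le> \<rho> z \<and> \<rho> z \<le> exp l1}"
  have sl: "smooth (lreg (d j))" for j using d by (intro smooth_lreg)
  have su: "smooth (u j)" for j unfolding u_def[abs_def] by (rule smooth_comp[OF G sl])
  have [measurable]: "K \<in> sets borel" unfolding K_def by measurable
  have [measurable]: "lreg (d j) \<in> borel_measurable borel" "u j \<in> borel_measurable borel"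
    "grad_gamma \<gamma> (u j) \<in> borel_measurable borel" for j
    by (auto intro: borel_measurable_smooth borel_measurable_grad_gamma sl su)
  have [measurable]: "(\<lambda>z::(real^'n) \<times> (real^'k). norm (snd z)) \<in> borel_measurable borel"
    by (intro borel_measurable_continuous_onI continuous_intros)
  have [measurable]: "reg_slope (d j) \<in> borel_measurable borel" for j
    unfolding reg_slope_def[abs_def] reg_def by measurable
  have [measurable]: "G \<in> borel_measurable borel" "deriv G \<in> borel_measurable borel"
    by (auto intro: borel_measurable_smooth smooth_real_deriv(2) G)
  have supp': "deriv G l = 0" if "l \<notin> {l0..l1}" for l
    using supp that by (rule deriv_eq_0_outside)
  have inK: "z \<in> K" "z \<noteq> 0" if "lreg (d j) z \<in> {l0..l1}" for j z
  proof -
    have "\<not> \<rho> z \<le> c"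
    proof
      assume "\<rho> z \<le> c"
      then have "lreg (d j) z \<le> ln (2 * c)" using d by (intro lreg_le)
      also have "ln (2 * c) = l0 - ln 2"
        by (simp add: c_def ln_div)
      finally have "lreg (d j) z \<le> l0 - ln 2" .
      moreover have "ln 2 > (0::real)" by simp
      ultimately show False using that unfolding atLeastAtMost_iff by linarith
    qed
    then show "z \<noteq> 0" using c gnorm_eq_0_iff[of z] by auto
    then have "ln (\<rho> z) \<le> l1" using ln_gnorm_le_lreg[OF d(1), of z j] that by simp
    then have "\<rho> z \<le> exp l1"
      using gnorm_pos[OF \<open>z \<noteq> 0\<close>] by (metis exp_le_cancel_iff exp_ln)
    then show "z \<in> K" using \<open>\<not> \<rho> z \<le> c\<close> by (simp add: K_def)
  qed
  have K\<Omega>: "K \<subseteq> \<Omega>"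
  proof
    fix z assume z: "z \<in> K"
    then have "\<rho> z > 0" using c by (simp add: K_def)
    then have "z \<noteq> 0" "ln (\<rho> z) \<le> l1"
      using z gnorm_eq_0_iff[of z] ln_le_cancel_iff[of "\<rho> z" "exp l1"] by (auto simp: K_def)
    then show "z \<in> \<Omega>" by (rule \<Omega>)
  qed
  have "closed K"
    unfolding K_def by (intro closed_Collect_conj closed_Collect_le continuous_on_gnorm continuous_intros)
  moreover have "bounded K"
    by (rule bounded_subset[OF bounded_gnorm_le[of "exp l1"]]) (auto simp: K_def)
  ultimately have cK: "compact K" by (simp add: compact_eq_bounded_closed)
  have clu: "closure {z. u j z \<noteq> 0} \<subseteq> K" for j
  proof (rule closure_minimal)
    show "{z. u j z \<noteq> 0} \<subseteq> K"
    proof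
      fix z assume "z \<in> {z. u j z \<noteq> 0}"
      then have "lreg (d j) z \<in> {l0..l1}" using supp[of "lreg (d j) z"] by (auto simp: u_def)
      then show "z \<in> K" by (rule inK)
    qed
  qed fact
  have test: "test_fun \<Omega> (u j)" for j
    unfolding test_fun_def
    using su clu[of j] K\<Omega> compact_Int_closed[OF cK closed_closure, of "{z. u j z \<noteq> 0}"]
    by (auto simp: Int_absorb1)
  have "compact (deriv G ` {l0..l1})"
    by (intro compact_continuous_image smooth_real_deriv G) auto
  then obtain M where M: "\<And>l. l \<in> {l0..l1} \<Longrightarrow> \<bar>deriv G l\<bar> \<le> M"
    using compact_imp_bounded by (fastforce simp: bounded_iff)
  obtain V where V: "\<And>l. l \<in> {ln c..l1} \<Longrightarrow> v l \<le> V" using vb by blast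
  \<comment> \<open>A bound for \<open>F j\<close> on \<open>K\<close> uniform in \<open>j\<close>.
    The sign of \<open>p - Q\<close> is unknown, so the power of \<open>\<rho>\<close> is bounded by
    the sum of its values at both radii.\<close>
  define B where "B = (\<bar>M\<bar> * exp (- l0)) powr p * ((c powr (p - Q) + exp l1 powr (p - Q)) * \<bar>V\<bar>)"
  define F where "F j z = ennreal ((\<bar>deriv G (lreg (d j) z)\<bar> * reg_slope (d j) z) powr p *
    (\<rho> z powr (p - Q) * v (ln (\<rho> z))))" for j z
  have Fb: "F j z \<le> ennreal B * indicator K z" for j z
  proof (cases "lreg (d j) z \<in> {l0..l1}")
    case True
    note K = inK[OF True]
    have "reg_slope (d j) z \<le> exp (- l0)"
      using reg_slope_le[OF d(1), of j z] True by (auto elim: order_trans)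
    then have 1: "\<bar>deriv G (lreg (d j) z)\<bar> * reg_slope (d j) z \<le> \<bar>M\<bar> * exp (- l0)"
      using M[OF True] reg_slope_nonneg[OF d(1)] by (intro mult_mono) auto
    have r: "c \<le> \<rho> z" "\<rho> z \<le> exp l1" using K by (auto simp: K_def)
    have 2: "\<rho> z powr (p - Q) \<le> c powr (p - Q) + exp l1 powr (p - Q)"
    proof (cases "p \<ge> Q")
      case True
      then have "\<rho> z powr (p - Q) \<le> exp l1 powr (p - Q)"
        using r c by (intro powr_mono2) auto
      then show ?thesis using powr_ge_zero[of c "p - Q"] by linarith
    next
      case False
      then have "\<rho> z powr (p - Q) \<le> c powr (p - Q)"
        using r c by (intro powr_mono2') auto
      then show ?thesis using powr_ge_zero[of "exp l1" "p - Q"] by linarith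
    qed
    have "ln (\<rho> z) \<in> {ln c..l1}"
      using r c ln_le_cancel_iff[of "\<rho> z" "exp l1"] by auto
    then have 3: "v (ln (\<rho> z)) \<le> \<bar>V\<bar>" using V by fastforce
    have "(\<bar>deriv G (lreg (d j) z)\<bar> * reg_slope (d j) z) powr p * (\<rho> z powr (p - Q) * v (ln (\<rho> z))) \<le> B"
      unfolding B_def using p reg_slope_nonneg[OF d(1)] v0
      by (intro mult_mono[OF powr_mono2[OF _ _ 1] mult_mono[OF 2 3]]) auto
    then show ?thesis using K by (simp add: F_def ennreal_leI)
  next
    case False
    then show ?thesis using supp'[OF False] p by (simp add: F_def)
  qed
  have Flim: "(\<lambda>j. \<integral>\<^sup>+z. F j z \<partial>lborel) \<longlonglongrightarrow>
      (\<integral>\<^sup>+z. ennreal (dens p z) * ennreal (\<bar>deriv G (ln (\<rho> z))\<bar> powr p * v (ln (\<rho> z))) \<partial>lborel)"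
  proof (rule nn_integral_dominated_convergence[where w = "\<lambda>z. ennreal B * indicator K z"])
    show "F j \<in> borel_measurable lborel" for j unfolding F_def[abs_def] by measurable
    have "emeasure lborel K < \<infinity>" using \<open>bounded K\<close> by (rule emeasure_bounded_finite)
    then show "(\<integral>\<^sup>+z. ennreal B * indicator K z \<partial>lborel) < \<infinity>"
      by (simp add: nn_integral_cmult_indicator ennreal_mult_less_top)
    show "AE z in lborel. (\<lambda>j. F j z) \<longlonglongrightarrow> ennreal (dens p z) * ennreal (\<bar>deriv G (ln (\<rho> z))\<bar> powr p * v (ln (\<rho> z)))"
      using AE_fst_nonzero
    proof eventually_elim
      case (elim z)
      then have z: "z \<noteq> 0" by auto
      let ?s = "norm (fst z) powr \<gamma> / \<rho> z powr (1 + \<gamma>)"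
      have "(\<lambda>j. deriv G (lreg (d j) z)) \<longlonglongrightarrow> deriv G (ln (\<rho> z))"
        using continuous_on_tendsto_compose[OF smooth_real_deriv(3)[OF G, of UNIV] lreg_tendsto(1)[OF d0 z]] by simp
      then have "(\<lambda>j. \<bar>deriv G (lreg (d j) z)\<bar> * reg_slope (d j) z) \<longlonglongrightarrow> \<bar>deriv G (ln (\<rho> z))\<bar> * ?s"
        by (intro tendsto_mult tendsto_rabs reg_slope_tendsto[OF d0 elim])
      then have "(\<lambda>j. F j z) \<longlonglongrightarrow> ennreal ((\<bar>deriv G (ln (\<rho> z))\<bar> * ?s) powr p * (\<rho> z powr (p - Q) * v (ln (\<rho> z))))"
        unfolding F_def using p reg_slope_nonneg[OF d(1)] by (intro tendsto_ennreal_mult_powr) auto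
      also have "(\<bar>deriv G (ln (\<rho> z))\<bar> * ?s) powr p * (\<rho> z powr (p - Q) * v (ln (\<rho> z)))
          = (?s powr p * \<rho> z powr (p - Q)) * (\<bar>deriv G (ln (\<rho> z))\<bar> powr p * v (ln (\<rho> z)))"
        by (simp only: powr_mult mult_ac)
      finally show ?case
        by (simp only: slope_powr_dens[OF elim] ennreal_mult dens_nonneg mult_nonneg_nonneg powr_ge_zero v0)
    qed
  qed (use Fb in auto)
  have grad_le: "(\<integral>\<^sup>+z\<in>\<Omega>. ennreal (norm (grad_gamma \<gamma> (u j) z) powr p * (\<rho> z powr (p - Q) * v (ln (\<rho> z)))) \<partial>lborel)
      \<le> (\<integral>\<^sup>+z. F j z \<partial>lborel)" for j
  proof (rule nn_integral_mono)
    fix z :: "(real^'n) \<times> (real^'k)"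
    have "norm (grad_gamma \<gamma> (u j) z) powr p * (\<rho> z powr (p - Q) * v (ln (\<rho> z)))
        \<le> (\<bar>deriv G (lreg (d j) z)\<bar> * reg_slope (d j) z) powr p * (\<rho> z powr (p - Q) * v (ln (\<rho> z)))"
      using norm_grad_radial_le[OF d(1) G, of j z] p v0
      by (intro mult_right_mono powr_mono2) (auto simp: u_def[abs_def])
    then show "ennreal (norm (grad_gamma \<gamma> (u j) z) powr p * (\<rho> z powr (p - Q) * v (ln (\<rho> z)))) * indicator \<Omega> z \<le> F j z"
      by (simp add: F_def indicator_def ennreal_leI)
  qed
  let ?a = "\<lambda>j. ennreal C * (\<integral>\<^sup>+z\<in>\<Omega>. ennreal (\<bar>u j z\<bar> powr p * (dens p z * w (ln (\<rho> z)))) \<partial>lborel)"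
  have "ennreal C * (\<integral>\<^sup>+z. ennreal (dens p z) * ennreal (\<bar>G (ln (\<rho> z))\<bar> powr p * w (ln (\<rho> z))) \<partial>lborel)
      = (\<integral>\<^sup>+z. ennreal C * ennreal (\<bar>G (ln (\<rho> z))\<bar> powr p * (dens p z * w (ln (\<rho> z)))) \<partial>lborel)"
    by (simp add: nn_integral_cmult dens_nonneg w0 mult_ac flip: ennreal_mult)
  also have "\<dots> = (\<integral>\<^sup>+z. liminf (\<lambda>j. ennreal C * ennreal (\<bar>u j z\<bar> powr p * (dens p z * w (ln (\<rho> z))))) \<partial>lborel)"
  proof (rule nn_integral_cong_AE)
    show "AE z in lborel. ennreal C * ennreal (\<bar>G (ln (\<rho> z))\<bar> powr p * (dens p z * w (ln (\<rho> z))))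
        = liminf (\<lambda>j. ennreal C * ennreal (\<bar>u j z\<bar> powr p * (dens p z * w (ln (\<rho> z)))))"
      using AE_fst_nonzero
    proof eventually_elim
      case (elim z)
      then have z: "z \<noteq> 0" by auto
      have "(\<lambda>j. u j z) \<longlonglongrightarrow> G (ln (\<rho> z))"
        unfolding u_def
        using continuous_on_tendsto_compose[OF smooth_continuous_on[OF G, of UNIV] lreg_tendsto(1)[OF d0 z]] by simp
      then have "(\<lambda>j. ennreal C * ennreal (\<bar>u j z\<bar> powr p * (dens p z * w (ln (\<rho> z)))))
          \<longlonglongrightarrow> ennreal C * ennreal (\<bar>G (ln (\<rho> z))\<bar> powr p * (dens p z * w (ln (\<rho> z))))"
        using p by (intro ennreal_tendsto_cmult tendsto_ennreal_mult_powr tendsto_rabs) auto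
      then show ?case by (intro lim_imp_Liminf[symmetric]) auto
    qed
  qed
  also have "\<dots> \<le> liminf (\<lambda>j. \<integral>\<^sup>+z. ennreal C * ennreal (\<bar>u j z\<bar> powr p * (dens p z * w (ln (\<rho> z)))) \<partial>lborel)"
    by (rule nn_integral_liminf) simp
  also have "(\<lambda>j. \<integral>\<^sup>+z. ennreal C * ennreal (\<bar>u j z\<bar> powr p * (dens p z * w (ln (\<rho> z)))) \<partial>lborel) = ?a"
  proof
    fix j
    have "(\<integral>\<^sup>+z. ennreal (\<bar>u j z\<bar> powr p * (dens p z * w (ln (\<rho> z)))) \<partial>lborel)
        = (\<integral>\<^sup>+z\<in>\<Omega>. ennreal (\<bar>u j z\<bar> powr p * (dens p z * w (ln (\<rho> z)))) \<partial>lborel)"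
      using test_fun_outside_grad(1)[OF test[of j]] p
      by (intro nn_integral_cong) (auto simp: indicator_def)
    then show "(\<integral>\<^sup>+z. ennreal C * ennreal (\<bar>u j z\<bar> powr p * (dens p z * w (ln (\<rho> z)))) \<partial>lborel) = ?a j"
      by (simp add: nn_integral_cmult)
  qed
  finally have lower: "ennreal C * (\<integral>\<^sup>+z. ennreal (dens p z) * ennreal (\<bar>G (ln (\<rho> z))\<bar> powr p * w (ln (\<rho> z))) \<partial>lborel)
      \<le> liminf ?a" .
  \<comment> \<open>A number strictly between the two limits separates the two sequences
    eventually.\<close>
  obtain y where y: "(\<integral>\<^sup>+z. ennreal (dens p z) * ennreal (\<bar>deriv G (ln (\<rho> z))\<bar> powr p * v (ln (\<rho> z))) \<partial>lborel) < y"
    "y < liminf ?a"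
    using dense[OF less_le_trans[OF less lower]] by blast
  have "\<forall>\<^sub>F j in sequentially. (\<integral>\<^sup>+z. F j z \<partial>lborel) < y \<and> y < ?a j"
    using order_tendstoD(2)[OF Flim y(1)] less_LiminfD[OF y(2)] by (rule eventually_conj)
  then obtain j where "(\<integral>\<^sup>+z. F j z \<partial>lborel) < y" "y < ?a j"
    using eventually_happens' sequentially_bot by blast
  then show thesis
    using that[OF test[of j]] grad_le[of j] by (meson le_less_trans less_trans)
qed

end

section \<open>Sharpness\<close>

context grushin
begin

lemma nn_integral_dens_const_shell:
  "(\<integral>\<^sup>+z. ennreal (dens p z) * (ennreal c * indicator (shell x (x + real j)) z) \<partial>lborel)
    = ennreal c * (of_nat j * shell_mass p)"
proof -
  have "(\<integral>\<^sup>+z. ennreal (dens p z) * (ennreal c * indicator (shell x (x + real j)) z) \<partial>lborel)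
      = (\<integral>\<^sup>+z. ennreal c * (ennreal (dens p z) * indicator (shell x (x + real j)) z) \<partial>lborel)"
    by (simp add: mult_ac)
  then show ?thesis by (simp add: nn_integral_cmult shell_mass_nat)
qed

lemma shell_mass_real:
  assumes "p \<ge> 0" obtains m where "m > 0" "shell_mass p = ennreal m"
  using shell_mass_finite[OF assms] shell_mass_pos[of p]
  by (cases "shell_mass p") (auto simp: ennreal_less_zero_iff)

text \<open>The extremal \<open>exp (- a * l)\<close> is cut off to a plateau of \<open>N\<close>
  unit shells with one transition shell at each end. With unit mass \<open>m\<close> the energy is
  at most \<open>(|a| powr p * N + 2 * B) * m\<close>, while the function side is at least
  \<open>N * m\<close>.\<close>

lemma power_profile:
  assumes p: "1 < p" and C: "C > \<bar>a\<bar> powr p"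
  obtains G l0 where "smooth G" "\<And>l. l \<notin> {l0..l1} \<Longrightarrow> G l = 0"
    "(\<integral>\<^sup>+z. ennreal (dens p z) * ennreal (\<bar>deriv G (ln (\<rho> z))\<bar> powr p * exp (a * p * ln (\<rho> z))) \<partial>lborel)
      < ennreal C * (\<integral>\<^sup>+z. ennreal (dens p z) * ennreal (\<bar>G (ln (\<rho> z))\<bar> powr p * exp (a * p * ln (\<rho> z))) \<partial>lborel)"
proof -
  obtain M where M: "M \<ge> 0" "\<And>x. \<bar>deriv smooth_step x\<bar> \<le> M" using deriv_smooth_step_bounded by blast
  obtain m where m: "m > 0" "shell_mass p = ennreal m" using shell_mass_real[of p] p by auto
  \<comment> \<open>In a transition shell the cutoff is at most 1 and each of the two terms of its
    derivative is at most \<open>M\<close>.\<close>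
  define B where "B = (\<bar>a\<bar> + 2 * M) powr p"
  \<comment> \<open>Exactly the condition \<open>|a| powr p * N + 2 * B < C * N\<close>.\<close>
  obtain N :: nat where N: "2 * B / (C - \<bar>a\<bar> powr p) < real N" using reals_Archimedean2 by blast
  \<comment> \<open>The cutoff rises on \<open>[l1 - N - 2, l1 - N - 1]\<close>, equals 1 up to
    \<open>l1 - 1\<close>, and falls to 0 at \<open>l1\<close>.\<close>
  define \<eta> where "\<eta> l = smooth_step (l - l1 + real N + 2) * (1 - smooth_step (l - l1 + 1))" for l
  define \<eta>' where "\<eta>' l = deriv smooth_step (l - l1 + real N + 2) * (1 - smooth_step (l - l1 + 1))
    - smooth_step (l - l1 + real N + 2) * deriv smooth_step (l - l1 + 1)" for l
  define G where "G l = exp (- a * l) * \<eta> l" for l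
  have shift: "smooth (\<lambda>l::real. smooth_step (l + c))" for c
    using smooth_comp[OF smooth_smooth_step smooth_real_affine[of 1 c]] by simp
  have "smooth (\<lambda>l. exp (- a * l + 0) * (smooth_step (l + (- l1 + real N + 2)) * (1 - smooth_step (l + (- l1 + 1)))))"
    by (intro smooth_mult smooth_diff smooth_const shift smooth_exp smooth_real_affine)
  then have sG: "smooth G" by (simp add: G_def[abs_def] \<eta>_def algebra_simps)
  have d\<eta>: "(\<eta> has_real_derivative \<eta>' l) (at l)" for l
    unfolding \<eta>_def[abs_def] \<eta>'_def
    by (auto intro!: derivative_eq_intros DERIV_chain2[OF smooth_real_deriv(1)[OF smooth_smooth_step]])
  have dG: "deriv G l = exp (- a * l) * (- a * \<eta> l + \<eta>' l)" for l
    unfolding G_def[abs_def]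
    by (intro DERIV_imp_deriv) (auto intro!: derivative_eq_intros d\<eta> simp: algebra_simps)
  have supp: "G l = 0" if "l \<notin> {l1 - real N - 2..l1}" for l
    using that smooth_step_0[of "l - l1 + real N + 2"] smooth_step_1[of "l - l1 + 1"]
    by (auto simp: G_def \<eta>_def not_le)
  \<comment> \<open>The weight cancels the exponential factor of the profile, leaving integrands
    that are constant on the plateau.\<close>
  have canc: "\<bar>exp (- a * l) * x\<bar> powr p * exp (a * p * l) = \<bar>x\<bar> powr p" for l x
    by (simp add: abs_mult powr_mult exp_powr_real mult.commute mult.left_commute flip: exp_add)
  have plateau: "\<eta> l = 1" "\<eta>' l = 0" if "l1 - real N - 1 < l" "l \<le> l1 - 1" for l
    using that smooth_step_1[of "l - l1 + real N + 2"] smooth_step_0[of "l - l1 + 1"]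
      deriv_smooth_step_0[of "l - l1 + real N + 2"] deriv_smooth_step_0[of "l - l1 + 1"]
    by (auto simp: \<eta>_def \<eta>'_def)
  have outside: "\<eta> l = 0" "\<eta>' l = 0" if "l \<le> l1 - real N - 2 \<or> l1 < l" for l
    using that smooth_step_0[of "l - l1 + real N + 2"] smooth_step_1[of "l - l1 + 1"]
      deriv_smooth_step_0[of "l - l1 + real N + 2"] deriv_smooth_step_0[of "l - l1 + 1"]
    by (auto simp: \<eta>_def \<eta>'_def)
  have bound: "\<bar>- a * \<eta> l + \<eta>' l\<bar> powr p \<le> B" for l
  proof -
    let ?h = "smooth_step (l - l1 + real N + 2)" and ?k = "smooth_step (l - l1 + 1)"
    have "\<bar>\<eta> l\<bar> \<le> 1"
      using smooth_step_bounds[of "l - l1 + real N + 2"] smooth_step_bounds[of "l - l1 + 1"]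
      by (simp add: \<eta>_def abs_mult mult_le_one)
    then have "\<bar>a * \<eta> l\<bar> \<le> \<bar>a\<bar>" by (simp add: abs_mult mult_left_le)
    moreover have "\<bar>deriv smooth_step (l - l1 + real N + 2) * (1 - ?k)\<bar> \<le> M * 1"
      "\<bar>?h * deriv smooth_step (l - l1 + 1)\<bar> \<le> 1 * M"
      using smooth_step_bounds[of "l - l1 + real N + 2"] smooth_step_bounds[of "l - l1 + 1"] M
      unfolding abs_mult by (intro mult_mono; simp)+
    ultimately have "\<bar>- a * \<eta> l + \<eta>' l\<bar> \<le> \<bar>a\<bar> + 2 * M"
      unfolding \<eta>'_def by linarith
    then show ?thesis unfolding B_def using p by (intro powr_mono2) auto
  qed
  let ?X = "shell (l1 - real N - 1) (l1 - real N - 1 + real N)"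
    and ?Y = "shell (l1 - real N - 2) (l1 - real N - 2 + real 1)" and ?Z = "shell (l1 - 1) (l1 - 1 + real 1)"
  have "(\<integral>\<^sup>+z. ennreal (dens p z) * ennreal (\<bar>deriv G (ln (\<rho> z))\<bar> powr p * exp (a * p * ln (\<rho> z))) \<partial>lborel)
      \<le> (\<integral>\<^sup>+z. ennreal (dens p z) * (ennreal (\<bar>a\<bar> powr p) * indicator ?X z)
        + (ennreal (dens p z) * (ennreal B * indicator ?Y z) + ennreal (dens p z) * (ennreal B * indicator ?Z z)) \<partial>lborel)"
  proof (rule nn_integral_mono)
    fix z :: "(real^'n) \<times> (real^'k)"
    let ?l = "ln (\<rho> z)"
    have "ennreal (\<bar>- a * \<eta> ?l + \<eta>' ?l\<bar> powr p) \<le> ennreal (\<bar>a\<bar> powr p) * indicator ?X z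
        + (ennreal B * indicator ?Y z + ennreal B * indicator ?Z z)"
    proof -
      consider "?l \<le> l1 - real N - 2 \<or> l1 < ?l" | "l1 - real N - 2 < ?l \<and> ?l \<le> l1 - real N - 1"
        | "l1 - real N - 1 < ?l \<and> ?l \<le> l1 - 1" | "l1 - 1 < ?l \<and> ?l \<le> l1" by linarith
      then show ?thesis
      proof cases
        case 1 then show ?thesis using outside[of ?l] p by simp
      next
        case 2 then show ?thesis using ennreal_leI[OF bound[of ?l]] by (simp add: shell_def indicator_def)
      next
        case 3 then show ?thesis using plateau[of ?l] by (simp add: shell_def indicator_def)
      next
        case 4 then show ?thesis using ennreal_leI[OF bound[of ?l]] by (simp add: shell_def indicator_def)
      qed
    qed
    then show "ennreal (dens p z) * ennreal (\<bar>deriv G ?l\<bar> powr p * exp (a * p * ?l))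
        \<le> ennreal (dens p z) * (ennreal (\<bar>a\<bar> powr p) * indicator ?X z)
        + (ennreal (dens p z) * (ennreal B * indicator ?Y z) + ennreal (dens p z) * (ennreal B * indicator ?Z z))"
      unfolding dG canc distrib_left[symmetric] by (rule mult_left_mono) simp
  qed
  also have "\<dots> = ennreal (\<bar>a\<bar> powr p) * (of_nat N * shell_mass p)
      + (ennreal B * (of_nat 1 * shell_mass p) + ennreal B * (of_nat 1 * shell_mass p))"
    by (subst nn_integral_add; (subst nn_integral_add)?) (simp_all only: nn_integral_dens_const_shell, measurable)
  also have "\<dots> = ennreal ((\<bar>a\<bar> powr p * real N + 2 * B) * m)"
    using m by (simp add: B_def ennreal_of_nat_eq_real_of_nat algebra_simps flip: ennreal_mult ennreal_plus)
  also have "\<dots> < ennreal (C * (real N * m))"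
  proof -
    have "\<bar>a\<bar> powr p * real N + 2 * B < C * real N"
      using N C by (simp add: field_simps)
    then have "(\<bar>a\<bar> powr p * real N + 2 * B) * m < C * real N * m"
      using m by (intro mult_strict_right_mono)
    moreover have "0 \<le> (\<bar>a\<bar> powr p * real N + 2 * B) * m"
      using m by (simp add: B_def)
    ultimately show ?thesis
      by (intro ennreal_lessI) (simp_all only: mult.assoc[of C] le_less_trans)
  qed
  also have "\<dots> = ennreal C * (ennreal 1 * (of_nat N * shell_mass p))"
    using m C by (simp add: ennreal_of_nat_eq_real_of_nat order_trans[OF powr_ge_zero less_imp_le] flip: ennreal_mult)
  also have "\<dots> = ennreal C * (\<integral>\<^sup>+z. ennreal (dens p z) * (ennreal 1 * indicator ?X z) \<partial>lborel)"
    by (simp only: nn_integral_dens_const_shell)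
  also have "\<dots> \<le> ennreal C * (\<integral>\<^sup>+z. ennreal (dens p z) * ennreal (\<bar>G (ln (\<rho> z))\<bar> powr p * exp (a * p * ln (\<rho> z))) \<partial>lborel)"
    unfolding G_def canc
    by (intro mult_left_mono nn_integral_mono) (auto simp: shell_def indicator_def plateau)
  finally show thesis using that[OF sG supp] by blast
qed

lemma sharp_power:
  assumes p: "1 < p" and \<Omega>: "open \<Omega>" "e > 0" "ball 0 e \<subseteq> \<Omega> \<union> {0}" and C: "C > (\<bar>Q + \<beta>\<bar> / p) powr p"
  shows "\<exists>(u, G) \<in> DL \<gamma> p \<Omega> (\<lambda>z. \<rho> z powr (p + \<beta>)).
    ennreal C * (\<integral>\<^sup>+z\<in>\<Omega>. ennreal (\<bar>u z\<bar> powr p * \<rho> z powr \<beta> * rpow (norm (fst z) / \<rho> z) (\<gamma> * p)) \<partial>lborel)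
    > (\<integral>\<^sup>+z\<in>\<Omega>. ennreal (norm (G z) powr p * \<rho> z powr (p + \<beta>)) \<partial>lborel)"
proof -
  define a where "a = (Q + \<beta>) / p"
  have a: "a * p = Q + \<beta>" "\<bar>Q + \<beta>\<bar> / p = \<bar>a\<bar>" using p by (auto simp: a_def)
  \<comment> \<open>The radius \<open>exp l1\<close> is at most 1, as \<open>norm_le_gnorm\<close>
    requires, and less than \<open>e / 2\<close>, so the punctured gauge ball lies in
    \<open>\<Omega>\<close>.\<close>
  define l1 where "l1 = min 0 (ln (e / 3))"
  have l1: "exp l1 \<le> 1" "2 * exp l1 < e"
  proof -
    show "exp l1 \<le> 1" by (simp add: l1_def)
    have "exp l1 \<le> exp (ln (e / 3))" by (simp only: exp_le_cancel_iff) (simp add: l1_def)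
    then show "2 * exp l1 < e" using \<Omega>(2) by simp
  qed
  obtain G l0 where G: "smooth G" "\<And>l. l \<notin> {l0..l1} \<Longrightarrow> G l = 0"
    "(\<integral>\<^sup>+z. ennreal (dens p z) * ennreal (\<bar>deriv G (ln (\<rho> z))\<bar> powr p * exp (a * p * ln (\<rho> z))) \<partial>lborel)
      < ennreal C * (\<integral>\<^sup>+z. ennreal (dens p z) * ennreal (\<bar>G (ln (\<rho> z))\<bar> powr p * exp (a * p * ln (\<rho> z))) \<partial>lborel)"
    using power_profile[OF p C[unfolded a(2)]] by blast
  obtain \<phi> where \<phi>: "test_fun \<Omega> \<phi>"
    "(\<integral>\<^sup>+z\<in>\<Omega>. ennreal (norm (grad_gamma \<gamma> \<phi> z) powr p * (\<rho> z powr (p - Q) * exp (a * p * ln (\<rho> z)))) \<partial>lborel)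
      < ennreal C * (\<integral>\<^sup>+z\<in>\<Omega>. ennreal (\<bar>\<phi> z\<bar> powr p * (dens p z * exp (a * p * ln (\<rho> z)))) \<partial>lborel)"
  proof (rule radial_sharp[OF p G(1,2) _ _ _ _ _ _ _ G(3)])
    show "z \<in> \<Omega>" if "z \<noteq> 0" "ln (\<rho> z) \<le> l1" for z
    proof -
      have "\<rho> z \<le> exp l1" using that gnorm_pos[of z] by (metis exp_le_cancel_iff exp_ln)
      then have "norm z < e" using l1 norm_le_gnorm[of z] by linarith
      then have "z \<in> ball 0 e" by simp
      then show ?thesis using \<Omega>(3) that(1) by blast
    qed
    show "\<exists>K. \<forall>l\<in>{c..l1}. exp (a * p * l) \<le> K" for c
    proof -
      have "compact ((\<lambda>l. exp (a * p * l)) ` {c..l1})"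
        by (intro compact_continuous_image continuous_intros) auto
      then show ?thesis using compact_imp_bounded by (fastforce simp: bounded_iff)
    qed
  qed (use \<Omega> in auto)
  have \<rho>0: "\<rho> 0 = 0" by (simp add: gnorm_eq_0_iff)
  have "(\<integral>\<^sup>+z\<in>\<Omega>. ennreal (norm (grad_gamma \<gamma> \<phi> z) powr p * \<rho> z powr (p + \<beta>)) \<partial>lborel)
      = (\<integral>\<^sup>+z\<in>\<Omega>. ennreal (norm (grad_gamma \<gamma> \<phi> z) powr p * (\<rho> z powr (p - Q) * exp (a * p * ln (\<rho> z)))) \<partial>lborel)"
  proof (rule nn_integral_cong)
    fix z :: "(real^'n) \<times> (real^'k)"
    show "ennreal (norm (grad_gamma \<gamma> \<phi> z) powr p * \<rho> z powr (p + \<beta>)) * indicator \<Omega> z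
      = ennreal (norm (grad_gamma \<gamma> \<phi> z) powr p * (\<rho> z powr (p - Q) * exp (a * p * ln (\<rho> z)))) * indicator \<Omega> z"
      by (cases "z = 0") (simp_all add: \<rho>0, simp add: exp_ln_gnorm a(1) flip: powr_add)
  qed
  moreover have "(\<integral>\<^sup>+z\<in>\<Omega>. ennreal (\<bar>\<phi> z\<bar> powr p * \<rho> z powr \<beta> * rpow (norm (fst z) / \<rho> z) (\<gamma> * p)) \<partial>lborel)
      = (\<integral>\<^sup>+z\<in>\<Omega>. ennreal (\<bar>\<phi> z\<bar> powr p * (dens p z * exp (a * p * ln (\<rho> z)))) \<partial>lborel)"
  proof (rule nn_integral_cong)
    fix z :: "(real^'n) \<times> (real^'k)"
    show "ennreal (\<bar>\<phi> z\<bar> powr p * \<rho> z powr \<beta> * rpow (norm (fst z) / \<rho> z) (\<gamma> * p)) * indicator \<Omega> z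
      = ennreal (\<bar>\<phi> z\<bar> powr p * (dens p z * exp (a * p * ln (\<rho> z)))) * indicator \<Omega> z"
    proof (cases "z = 0")
      case False
      have "\<rho> z powr \<beta> = \<rho> z powr (- Q) * \<rho> z powr (Q + \<beta>)" by (simp flip: powr_add)
      then show ?thesis unfolding exp_ln_gnorm[OF False] a(1) by (simp add: dens_def mult_ac)
    qed (simp add: \<rho>0)
  qed
  ultimately have less: "(\<integral>\<^sup>+z\<in>\<Omega>. ennreal (norm (grad_gamma \<gamma> \<phi> z) powr p * \<rho> z powr (p + \<beta>)) \<partial>lborel)
    < ennreal C * (\<integral>\<^sup>+z\<in>\<Omega>. ennreal (\<bar>\<phi> z\<bar> powr p * \<rho> z powr \<beta> * rpow (norm (fst z) / \<rho> z) (\<gamma> * p)) \<partial>lborel)"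
    using \<phi>(2) by simp
  \<comment> \<open>The strict inequality also provides the finite energy: whatever is below an
    \<open>ennreal\<close> is finite.\<close>
  then have "(\<phi>, grad_gamma \<gamma> \<phi>) \<in> DL \<gamma> p \<Omega> (\<lambda>z. \<rho> z powr (p + \<beta>))"
    using \<phi>(1) by (intro test_fun_in_DL) (auto intro: less_le_trans)
  with less show ?thesis by blast
qed

section \<open>The logarithmic profile and its plateau mass on dyadic shells\<close>

definition dyadic_log_mass :: "real \<Rightarrow> real \<Rightarrow> nat \<Rightarrow> ennreal" where
  "dyadic_log_mass p L n = (\<integral>\<^sup>+z. ennreal (dens p z) *
    (ennreal (1 / (L - ln (\<rho> z))) * indicator (shell (L - 2 ^ (n + 2)) (L - 4)) z) \<partial>lborel)"

text \<open>A discrete form of the divergence of the integral of \<open>1 / s\<close>, with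
  \<open>s = L - ln \<rho>\<close> running over \<open>[4, 2 ^ (n + 2))\<close>; for
  \<open>n = 0\<close> this range is empty.\<close>

lemma dyadic_log_mass_ge: "of_nat n * (ennreal (1 / 2) * shell_mass p) \<le> dyadic_log_mass p L n"
proof (induction n)
  case (Suc n)
  \<comment> \<open>The next dyadic block \<open>2 ^ (n + 2) \<le> s \<le> 2 ^ (n + 3)\<close> has
    length \<open>2 ^ (n + 2)\<close> and there \<open>1 / s \<ge> ?c\<close>, so it contributes at
    least half a unit of mass.\<close>
  let ?c = "1 / 2 ^ (n + 3) :: real" and ?x = "L - 2 ^ (n + 3) :: real"
  let ?S = "shell ?x (?x + real (2 ^ (n + 2)))"
  have half: "ennreal (1 / 2) * shell_mass p = (\<integral>\<^sup>+z. ennreal (dens p z) * (ennreal ?c * indicator ?S z) \<partial>lborel)"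
  proof -
    have "ennreal (1 / 2) = ennreal ?c * ennreal (real (2 ^ (n + 2)))"
      by (subst ennreal_mult[symmetric]) (auto simp: power_add)
    then show ?thesis
      by (simp only: nn_integral_dens_const_shell ennreal_of_nat_eq_real_of_nat mult.assoc)
  qed
  have "of_nat (Suc n) * (ennreal (1 / 2) * shell_mass p)
      = of_nat n * (ennreal (1 / 2) * shell_mass p) + ennreal (1 / 2) * shell_mass p"
    by (simp add: distrib_right add.commute)
  also have "\<dots> \<le> dyadic_log_mass p L n + ennreal (1 / 2) * shell_mass p"
    using Suc by (intro add_right_mono)
  also have "\<dots> = (\<integral>\<^sup>+z. ennreal (dens p z) * (ennreal (1 / (L - ln (\<rho> z)))
      * indicator (shell (L - 2 ^ (n + 2)) (L - 4)) z) + ennreal (dens p z) * (ennreal ?c * indicator ?S z) \<partial>lborel)"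
    unfolding dyadic_log_mass_def half by (rule nn_integral_add[symmetric]) measurable
  also have "\<dots> \<le> dyadic_log_mass p L (Suc n)"
    unfolding dyadic_log_mass_def
  proof (rule nn_integral_mono)
    fix z :: "(real^'n) \<times> (real^'k)"
    let ?l = "ln (\<rho> z)"
    have pow: "(4::real) \<le> 2 ^ (n + 2)" "(2::real) ^ (n + 3) = 2 * 2 ^ (n + 2)"
      and one: "(1::real) \<le> 2 ^ n"
      by (auto simp: power_add)
    have "ennreal (1 / (L - ?l)) * indicator (shell (L - 2 ^ (n + 2)) (L - 4)) z + ennreal ?c * indicator ?S z
        \<le> ennreal (1 / (L - ?l)) * indicator (shell (L - 2 ^ (Suc n + 2)) (L - 4)) z"
    proof -
      consider "?l \<le> ?x \<or> L - 4 < ?l" | "?x < ?l \<and> ?l \<le> L - 2 ^ (n + 2)"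
        | "L - 2 ^ (n + 2) < ?l \<and> ?l \<le> L - 4" by linarith
      then show ?thesis
      proof cases
        case 1
        have "real (2 ^ (n + 2)) = 2 ^ (n + 2)" by simp
        with 1 pow have "\<not> (?x < ?l \<and> ?l \<le> ?x + real (2 ^ (n + 2)))" "\<not> (L - 2 ^ (n + 2) < ?l \<and> ?l \<le> L - 4)"
          by linarith+
        then have "z \<notin> ?S" "z \<notin> shell (L - 2 ^ (n + 2)) (L - 4)"
          unfolding shell_def by blast+
        then show ?thesis by simp
      next
        case 2
        then have "0 < L - ?l" "L - ?l \<le> 2 ^ (n + 3)" using pow by linarith+
        then have "?c \<le> 1 / (L - ?l)" by (intro divide_left_mono) auto
        moreover have "?x < ?l \<and> ?l \<le> ?x + real (2 ^ (n + 2))" "L - 2 ^ (Suc n + 2) < ?l \<and> ?l \<le> L - 4"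
          "\<not> L - 2 ^ (n + 2) < ?l"
        proof -
          have "(2::real) ^ (Suc n + 2) = 2 ^ (n + 3)" "real (2 ^ (n + 2)) = 2 ^ (n + 2)"
            by (simp_all add: power_add)
          with 2 pow show "?x < ?l \<and> ?l \<le> ?x + real (2 ^ (n + 2))" "L - 2 ^ (Suc n + 2) < ?l \<and> ?l \<le> L - 4"
            "\<not> L - 2 ^ (n + 2) < ?l" by linarith+
        qed
        then have "z \<in> ?S" "z \<in> shell (L - 2 ^ (Suc n + 2)) (L - 4)" "z \<notin> shell (L - 2 ^ (n + 2)) (L - 4)"
          unfolding shell_def by blast+
        ultimately show ?thesis by (simp add: ennreal_leI)
      next
        case 3
        then have "z \<notin> ?S" "z \<in> shell (L - 2 ^ (Suc n + 2)) (L - 4)" "z \<in> shell (L - 2 ^ (n + 2)) (L - 4)"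
          using pow one by (auto simp: shell_def)
        then show ?thesis by simp
      qed
    qed
    then show "ennreal (dens p z) * (ennreal (1 / (L - ?l)) * indicator (shell (L - 2 ^ (n + 2)) (L - 4)) z)
        + ennreal (dens p z) * (ennreal ?c * indicator ?S z)
        \<le> ennreal (dens p z) * (ennreal (1 / (L - ?l)) * indicator (shell (L - 2 ^ (Suc n + 2)) (L - 4)) z)"
      unfolding distrib_left[symmetric] by (rule mult_left_mono) simp
  qed
  finally show ?case .
qed simp

lemma dyadic_log_mass_finite:
  assumes "p \<ge> 0" shows "dyadic_log_mass p L n < \<infinity>"
proof -
  let ?x = "L - 2 ^ (n + 2)"
  have "dyadic_log_mass p L n \<le> (\<integral>\<^sup>+z. ennreal (dens p z) * (ennreal 1 * indicator (shell ?x (?x + real (2 ^ (n + 2)))) z) \<partial>lborel)"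
    unfolding dyadic_log_mass_def
    by (intro nn_integral_mono mult_left_mono) (auto simp: shell_def indicator_def)
  also have "\<dots> < \<infinity>"
    unfolding nn_integral_dens_const_shell
    using of_nat_less_top[of "2 ^ (n + 2)"] shell_mass_finite[OF assms]
    by (simp only: ennreal_mult_less_top infinity_ennreal_def ennreal_less_top simp_thms)
  finally show ?thesis .
qed

text \<open>With \<open>s = L - l\<close>, both integrands for \<open>s powr (- a)\<close> reduce to
  \<open>1 / s\<close>, so the plateau must be long in \<open>ln s\<close> rather than in
  \<open>s\<close>. Its mass \<open>I\<close> grows at least like \<open>n * m / 2\<close>, while
  the two transitions together cost at most \<open>2 * D * m\<close>.\<close>

lemma log_profile:
  assumes p: "1 < p" and C: "C > \<bar>a\<bar> powr p"
  obtains G l0 where "smooth G" "\<And>l. l \<notin> {l0..L - 2} \<Longrightarrow> G l = 0"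
    "(\<integral>\<^sup>+z. ennreal (dens p z) * ennreal (\<bar>deriv G (ln (\<rho> z))\<bar> powr p * (L - ln (\<rho> z)) powr (p + (a * p - 1))) \<partial>lborel)
      < ennreal C * (\<integral>\<^sup>+z. ennreal (dens p z) * ennreal (\<bar>G (ln (\<rho> z))\<bar> powr p * (L - ln (\<rho> z)) powr (a * p - 1)) \<partial>lborel)"
proof -
  obtain M where M: "M \<ge> 0" "\<And>x. \<bar>deriv smooth_step x\<bar> \<le> M" using deriv_smooth_step_bounded by blast
  obtain m where m: "m > 0" "shell_mass p = ennreal m" using shell_mass_real[of p] p by auto
  \<comment> \<open>The transitions are controlled by \<open>s * \<eta>' s\<close>: at most
    \<open>4 * M\<close> for \<open>s < 4\<close>, and at most \<open>2 * M\<close> for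
    \<open>b \<le> s < 2 * b\<close>.\<close>
  define D where "D = (\<bar>a\<bar> + 4 * M) powr p"
  have D: "D \<ge> 0" by (simp add: D_def)
  \<comment> \<open>Makes \<open>2 * D * m\<close> smaller than
    \<open>(C - |a| powr p) * n * m / 2\<close>, a lower bound for
    \<open>(C - |a| powr p) * I\<close>.\<close>
  obtain n :: nat where n: "4 * D / (C - \<bar>a\<bar> powr p) < real n" using reals_Archimedean2 by blast
  define b :: real where "b = 2 ^ (n + 2)"
  have b: "b \<ge> 4" by (simp add: b_def power_add)
  \<comment> \<open>The outer cutoff is dilated by \<open>b\<close> instead of shifted: its slope of
    order \<open>1 / b\<close> keeps \<open>s * \<eta>' s\<close> bounded as \<open>b\<close>
    grows.\<close>
  let ?h = "\<lambda>s. smooth_step (s - 2)" and ?k = "\<lambda>s. smooth_step (s / b - 1)"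
  let ?h' = "\<lambda>s. deriv smooth_step (s - 2)" and ?k' = "\<lambda>s. deriv smooth_step (s / b - 1)"
  define \<eta> where "\<eta> s = ?h s * (1 - ?k s)" for s
  define \<eta>' where "\<eta>' s = ?h' s * (1 - ?k s) - ?h s * (?k' s / b)" for s
  \<comment> \<open>\<open>pos_id\<close> makes the power smooth on the whole line; it agrees with
    the identity for arguments above 1, while \<open>\<eta>\<close> already vanishes below
    2.\<close>
  define G where "G l = pos_id (L - l) powr (- a) * \<eta> (L - l)" for l
  have aff: "smooth (\<lambda>l::real. f (c * l + d))" if "smooth f" for f :: "real \<Rightarrow> real" and c d
    by (rule smooth_comp[OF that smooth_real_affine])
  have s1: "smooth (\<lambda>l. pos_id (L - l))" and s2: "smooth (\<lambda>l. smooth_step (L - l - 2))"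
    using aff[OF smooth_pos_id, of "- 1" L] aff[OF smooth_smooth_step, of "- 1" "L - 2"]
    by (simp_all add: algebra_simps)
  have "(- 1 / b) * l + (L / b - 1) = (L - l) / b - 1" for l
    using b by (auto simp: field_simps)
  then have s3: "smooth (\<lambda>l. smooth_step ((L - l) / b - 1))"
    using aff[OF smooth_smooth_step, of "- 1 / b" "L / b - 1"] by (simp only:)
  have sG: "smooth G"
    unfolding G_def[abs_def] \<eta>_def
    by (intro smooth_mult smooth_diff smooth_const smooth_powr s1 s2 s3 pos_id_pos)
  have supp: "G l = 0" if "l \<notin> {L - 2 * b..L - 2}" for l
  proof (cases "L - l < 2")
    case True
    then show ?thesis using smooth_step_0[of "L - l - 2"] by (simp add: G_def \<eta>_def)
  next
    case False
    then have "(L - l) / b - 1 \<ge> 1" using that b by (simp add: field_simps)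
    then show ?thesis by (simp add: G_def \<eta>_def smooth_step_1)
  qed
  have d\<eta>: "(\<eta> has_real_derivative \<eta>' s) (at s)" for s
    unfolding \<eta>_def[abs_def] \<eta>'_def
    using b by (auto intro!: derivative_eq_intros DERIV_chain2[OF smooth_real_deriv(1)[OF smooth_smooth_step]])
  have G1: "G l = (L - l) powr (- a) * \<eta> (L - l)" if "L - l \<ge> 1" for l
    using that by (simp add: G_def pos_id_eq)
  have dG: "deriv G l = - ((L - l) powr (- a - 1) * (- a * \<eta> (L - l) + (L - l) * \<eta>' (L - l)))" if "L - l > 1" for l
  proof (rule DERIV_imp_deriv)
    have "((\<lambda>l. (L - l) powr (- a) * \<eta> (L - l)) has_real_derivative
        (- a * (L - l) powr (- a - 1) * (-1)) * \<eta> (L - l) + (\<eta>' (L - l) * (-1)) * (L - l) powr (- a)) (at l)"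
    proof (rule DERIV_mult)
      have d: "((\<lambda>l. L - l) has_real_derivative -1) (at l)" by (auto intro!: derivative_eq_intros)
      from DERIV_fun_powr[OF this, of "- a"] that
      show "((\<lambda>l. (L - l) powr (- a)) has_real_derivative - a * (L - l) powr (- a - 1) * (-1)) (at l)" by simp
      show "((\<lambda>l. \<eta> (L - l)) has_real_derivative \<eta>' (L - l) * (-1)) (at l)"
        by (rule DERIV_chain2[OF d\<eta> d])
    qed
    also have "(- a * (L - l) powr (- a - 1) * (-1)) * \<eta> (L - l) + (\<eta>' (L - l) * (-1)) * (L - l) powr (- a)
        = - ((L - l) powr (- a - 1) * (- a * \<eta> (L - l) + (L - l) * \<eta>' (L - l)))"
      using that by (simp add: powr_diff field_simps)
    finally show "(G has_real_derivative - ((L - l) powr (- a - 1) * (- a * \<eta> (L - l) + (L - l) * \<eta>' (L - l)))) (at l)"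
      by (rule has_field_derivative_transform_within_open[where S = "{..<L - 1}"]) (use that G1 in auto)
  qed
  have wG: "\<bar>G l\<bar> powr p * (L - l) powr (a * p - 1) = \<bar>\<eta> (L - l)\<bar> powr p * (1 / (L - l))" if "L - l > 1" for l
  proof -
    have "\<bar>G l\<bar> powr p = (L - l) powr (- a * p) * \<bar>\<eta> (L - l)\<bar> powr p"
      using that by (simp add: G1 abs_mult powr_mult powr_powr)
    moreover have "(L - l) powr (- a * p) * (L - l) powr (a * p - 1) = 1 / (L - l)"
      using that by (simp add: powr_neg_one flip: powr_add)
    ultimately show ?thesis by (simp add: mult_ac)
  qed
  have vG: "\<bar>deriv G l\<bar> powr p * (L - l) powr (p + (a * p - 1))
      = \<bar>- a * \<eta> (L - l) + (L - l) * \<eta>' (L - l)\<bar> powr p * (1 / (L - l))" if "L - l > 1" for l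
  proof -
    have e1: "\<bar>deriv G l\<bar> powr p = (L - l) powr ((- a - 1) * p) * \<bar>- a * \<eta> (L - l) + (L - l) * \<eta>' (L - l)\<bar> powr p"
      unfolding dG[OF that] abs_minus_cancel abs_mult by (simp add: powr_mult powr_powr)
    have e2: "(L - l) powr ((- a - 1) * p) * (L - l) powr (p + (a * p - 1)) = 1 / (L - l)"
    proof -
      have "(- a - 1) * p + (p + (a * p - 1)) = - 1" by (simp add: algebra_simps)
      then show ?thesis using that by (simp only: powr_add[symmetric]) (simp add: powr_neg_one)
    qed
    show ?thesis unfolding e1 e2[symmetric] by (simp only: mult_ac)
  qed
  have plateau: "\<eta> s = 1" "\<eta>' s = 0" if "4 \<le> s" "s < b" for s
  proof -
    have "s / b - 1 \<le> 0" using that b by (simp add: field_simps)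
    then show "\<eta> s = 1" "\<eta>' s = 0"
      using that by (auto simp: \<eta>_def \<eta>'_def smooth_step_0 smooth_step_1 deriv_smooth_step_0)
  qed
  have \<eta>1: "\<bar>\<eta> s\<bar> \<le> 1" for s
    using smooth_step_bounds[of "s - 2"] smooth_step_bounds[of "s / b - 1"]
    by (simp add: \<eta>_def abs_mult mult_le_one)
  have bound: "\<bar>- a * \<eta> s + s * \<eta>' s\<bar> powr p \<le> D" if s: "2 \<le> s" "s < 4 \<or> b \<le> s \<and> s < 2 * b" for s
  proof -
    have "\<bar>s * \<eta>' s\<bar> \<le> 4 * M"
    proof (cases "s < 4")
      case True
      then have "s / b - 1 \<le> 0" using b by (simp add: field_simps)
      then have "\<eta>' s = ?h' s" by (simp add: \<eta>'_def smooth_step_0 deriv_smooth_step_0)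
      then show ?thesis using True s M by (simp add: abs_mult mult_mono)
    next
      case False
      then have s': "b \<le> s" "s < 2 * b" using s by auto
      have "\<eta>' s = - (?k' s / b)"
        using False by (simp add: \<eta>'_def smooth_step_1 deriv_smooth_step_0)
      then have "\<bar>s * \<eta>' s\<bar> = s / b * \<bar>?k' s\<bar>" using s b by (simp add: abs_mult)
      also have "\<dots> \<le> 2 * M" using s' b M by (intro mult_mono) (auto simp: field_simps)
      finally show ?thesis using M(1) by linarith
    qed
    moreover have "\<bar>a * \<eta> s\<bar> \<le> \<bar>a\<bar>" using \<eta>1[of s] by (simp add: abs_mult mult_left_le)
    ultimately have "\<bar>- a * \<eta> s + s * \<eta>' s\<bar> \<le> \<bar>a\<bar> + 4 * M" by linarith
    then show ?thesis unfolding D_def using p by (intro powr_mono2) auto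
  qed
  obtain I where I: "I \<ge> 0" "dyadic_log_mass p L n = ennreal I"
    using dyadic_log_mass_finite[of p L n] p by (cases "dyadic_log_mass p L n") auto
  have In: "real n * (m / 2) \<le> I"
  proof -
    have "ennreal (real n * (1 / 2 * m)) = of_nat n * (ennreal (1 / 2) * shell_mass p)"
      using m by (simp only: ennreal_mult' of_nat_0_le_iff zero_le_divide_1_iff zero_le_numeral
          ennreal_of_nat_eq_real_of_nat)
    also have "\<dots> \<le> ennreal I"
      using dyadic_log_mass_ge I by metis
    finally show ?thesis using I by simp
  qed
  \<comment> \<open>In terms of \<open>s\<close>: plateau \<open>[4, b)\<close>, outer transition
    \<open>[b, 2 * b)\<close>, inner transition \<open>[2, 4)\<close>. The transitions have lengths
    \<open>b\<close> and 2 against the bounds \<open>D / b\<close> and \<open>D / 2\<close>, so each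
    costs \<open>D * m\<close>.\<close>
  let ?X = "shell (L - 2 ^ (n + 2)) (L - 4)"
    and ?Y = "shell (L - 2 * b) (L - 2 * b + real (2 ^ (n + 2)))" and ?Z = "shell (L - 4) (L - 4 + real 2)"
  have "(\<integral>\<^sup>+z. ennreal (dens p z) * ennreal (\<bar>deriv G (ln (\<rho> z))\<bar> powr p * (L - ln (\<rho> z)) powr (p + (a * p - 1))) \<partial>lborel)
      \<le> (\<integral>\<^sup>+z. ennreal (\<bar>a\<bar> powr p) * (ennreal (dens p z) * (ennreal (1 / (L - ln (\<rho> z))) * indicator ?X z))
        + (ennreal (dens p z) * (ennreal (D / b) * indicator ?Y z) + ennreal (dens p z) * (ennreal (D / 2) * indicator ?Z z)) \<partial>lborel)"
  proof (rule nn_integral_mono)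
    fix z :: "(real^'n) \<times> (real^'k)"
    let ?l = "ln (\<rho> z)" and ?s = "L - ln (\<rho> z)"
    have "ennreal (\<bar>deriv G ?l\<bar> powr p * ?s powr (p + (a * p - 1)))
        \<le> ennreal (\<bar>a\<bar> powr p) * (ennreal (1 / ?s) * indicator ?X z)
        + (ennreal (D / b) * indicator ?Y z + ennreal (D / 2) * indicator ?Z z)"
    proof -
      consider "?s < 2" | "2 \<le> ?s \<and> ?s < 4" | "4 \<le> ?s \<and> ?s < b" | "b \<le> ?s \<and> ?s < 2 * b" | "2 * b \<le> ?s"
        by linarith
      then show ?thesis
      proof cases
        case 1
        have "deriv G ?l = 0" by (rule deriv_eq_0_outside[OF supp]) (use 1 in auto)
        then show ?thesis using p by simp
      next
        case 2
        have "\<bar>- a * \<eta> ?s + ?s * \<eta>' ?s\<bar> powr p * (1 / ?s) \<le> D * (1 / 2)"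
          using 2 D by (intro mult_mono bound) (auto simp: field_simps)
        moreover have "z \<in> ?Z" using 2 by (simp add: shell_def)
        ultimately show ?thesis
          using 2 vG[of ?l] by (simp add: add_increasing ennreal_leI)
      next
        case 3
        then have "z \<in> ?X" by (simp add: shell_def b_def)
        then show ?thesis
          using 3 vG[of ?l] plateau[of ?s] by (simp add: add_increasing2 flip: ennreal_mult)
      next
        case 4
        have "\<bar>- a * \<eta> ?s + ?s * \<eta>' ?s\<bar> powr p * (1 / ?s) \<le> D * (1 / b)"
          using 4 b D by (intro mult_mono bound) (auto simp: field_simps)
        moreover have "z \<in> ?Y" using 4 by (simp add: shell_def b_def)
        ultimately show ?thesis
          using 4 b vG[of ?l] by (simp add: add_increasing add_increasing2 ennreal_leI)
      next
        case 5
        then have "?s / b - 1 \<ge> 1" using b by (simp add: field_simps)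
        then have "\<eta> ?s = 0" "\<eta>' ?s = 0" by (auto simp: \<eta>_def \<eta>'_def smooth_step_1 deriv_smooth_step_0)
        then show ?thesis using 5 b vG[of ?l] p by simp
      qed
    qed
    from mult_left_mono[OF this, of "ennreal (dens p z)"]
    show "ennreal (dens p z) * ennreal (\<bar>deriv G ?l\<bar> powr p * ?s powr (p + (a * p - 1)))
        \<le> ennreal (\<bar>a\<bar> powr p) * (ennreal (dens p z) * (ennreal (1 / ?s) * indicator ?X z))
        + (ennreal (dens p z) * (ennreal (D / b) * indicator ?Y z) + ennreal (dens p z) * (ennreal (D / 2) * indicator ?Z z))"
      by (simp only: distrib_left mult.left_commute[of "ennreal (dens p z)" "ennreal (\<bar>a\<bar> powr p)"]) simp
  qed
  also have "\<dots> = (\<integral>\<^sup>+z. ennreal (\<bar>a\<bar> powr p) * (ennreal (dens p z) * (ennreal (1 / (L - ln (\<rho> z))) * indicator ?X z)) \<partial>lborel)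
      + (ennreal (D / b) * (of_nat (2 ^ (n + 2)) * shell_mass p) + ennreal (D / 2) * (of_nat 2 * shell_mass p))"
    by (subst nn_integral_add; (subst nn_integral_add)?) (simp_all only: nn_integral_dens_const_shell, measurable)
  also have "(\<integral>\<^sup>+z. ennreal (\<bar>a\<bar> powr p) * (ennreal (dens p z) * (ennreal (1 / (L - ln (\<rho> z))) * indicator ?X z)) \<partial>lborel)
      = ennreal (\<bar>a\<bar> powr p) * ennreal I"
    unfolding I(2)[symmetric] dyadic_log_mass_def by (rule nn_integral_cmult) measurable
  also have "ennreal (D / b) * (of_nat (2 ^ (n + 2)) * shell_mass p) + ennreal (D / 2) * (of_nat 2 * shell_mass p)
      = ennreal (2 * D * m)"
  proof -
    have "ennreal (D / b) * (of_nat (2 ^ (n + 2)) * shell_mass p) = ennreal (D * m)"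
      using m D b by (simp add: ennreal_of_nat_eq_real_of_nat b_def flip: ennreal_mult)
    moreover have "ennreal (D / 2) * (of_nat 2 * shell_mass p) = ennreal (D * m)"
    proof -
      have "of_nat 2 * shell_mass p = ennreal (2 * m)"
        unfolding m(2) ennreal_of_nat_eq_real_of_nat
        by (subst ennreal_mult[symmetric]) (use m in auto)
      then show ?thesis
        using m D by (simp only:) (simp flip: ennreal_mult)
    qed
    ultimately show ?thesis using m D by (simp flip: ennreal_plus)
  qed
  also have "ennreal (\<bar>a\<bar> powr p) * ennreal I + ennreal (2 * D * m) = ennreal (\<bar>a\<bar> powr p * I + 2 * D * m)"
    using m D I by (simp flip: ennreal_mult ennreal_plus)
  also have "\<dots> < ennreal (C * I)"
  proof -
    have "4 * D < (C - \<bar>a\<bar> powr p) * real n"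
      using n C by (simp add: field_simps)
    then have "4 * D * (m / 2) < (C - \<bar>a\<bar> powr p) * real n * (m / 2)"
      using m by (intro mult_strict_right_mono) auto
    also have "\<dots> \<le> (C - \<bar>a\<bar> powr p) * I"
      unfolding mult.assoc using In C by (intro mult_left_mono) auto
    finally have "\<bar>a\<bar> powr p * I + 2 * D * m < C * I"
      by (simp add: algebra_simps)
    moreover have "0 \<le> \<bar>a\<bar> powr p * I + 2 * D * m" using m D I by simp
    ultimately show ?thesis by (intro ennreal_lessI) auto
  qed
  also have "\<dots> = ennreal C * dyadic_log_mass p L n"
    using I C by (simp add: order_trans[OF powr_ge_zero less_imp_le] flip: ennreal_mult)
  also have "\<dots> \<le> ennreal C * (\<integral>\<^sup>+z. ennreal (dens p z) * ennreal (\<bar>G (ln (\<rho> z))\<bar> powr p * (L - ln (\<rho> z)) powr (a * p - 1)) \<partial>lborel)"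
    unfolding dyadic_log_mass_def
  proof (intro mult_left_mono nn_integral_mono)
    fix z :: "(real^'n) \<times> (real^'k)"
    let ?l = "ln (\<rho> z)" and ?s = "L - ln (\<rho> z)"
    show "ennreal (1 / ?s) * indicator ?X z \<le> ennreal (\<bar>G ?l\<bar> powr p * ?s powr (a * p - 1))"
    proof (cases "z \<in> ?X")
      case True
      then have "4 \<le> ?s" "?s < b" by (auto simp: shell_def b_def)
      then show ?thesis using True wG[of ?l] plateau[of ?s] by simp
    qed simp
  qed auto
  finally show thesis using that[OF sG supp] by blast
qed

lemma sharp_log:
  assumes p: "1 < p" "p = Q" and R: "0 < R" and \<beta>: "\<beta> < -1" and C: "C > (\<bar>\<beta> + 1\<bar> / p) powr p"
  shows "\<exists>(u, G) \<in> DL \<gamma> p {z. \<rho> z < R} (\<lambda>z. ln (R / \<rho> z) powr (p + \<beta>)).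
    ennreal C * (\<integral>\<^sup>+z\<in>{z. \<rho> z < R}. ennreal (\<bar>u z\<bar> powr p / \<rho> z powr p * ln (R / \<rho> z) powr \<beta>
        * rpow (norm (fst z) / \<rho> z) (\<gamma> * p)) \<partial>lborel)
    > (\<integral>\<^sup>+z\<in>{z. \<rho> z < R}. ennreal (norm (G z) powr p * ln (R / \<rho> z) powr (p + \<beta>)) \<partial>lborel)"
proof -
  let ?\<Omega> = "{z. \<rho> z < R}"
  \<comment> \<open>This makes \<open>a * p - 1 = \<beta>\<close>, so the exponents of
    \<open>log_profile\<close> become those of the statement.\<close>
  define a where "a = (\<beta> + 1) / p"
  have a: "a * p - 1 = \<beta>" "\<bar>\<beta> + 1\<bar> / p = \<bar>a\<bar>" using p(1) by (auto simp: a_def)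
  obtain G l0 where G: "smooth G" "\<And>l. l \<notin> {l0..ln R - 2} \<Longrightarrow> G l = 0"
    "(\<integral>\<^sup>+z. ennreal (dens p z) * ennreal (\<bar>deriv G (ln (\<rho> z))\<bar> powr p * (ln R - ln (\<rho> z)) powr (p + \<beta>)) \<partial>lborel)
      < ennreal C * (\<integral>\<^sup>+z. ennreal (dens p z) * ennreal (\<bar>G (ln (\<rho> z))\<bar> powr p * (ln R - ln (\<rho> z)) powr \<beta>) \<partial>lborel)"
    using log_profile[OF p(1) C[unfolded a(2)], of "ln R"] unfolding a(1) by blast
  obtain \<phi> where \<phi>: "test_fun ?\<Omega> \<phi>"
    "(\<integral>\<^sup>+z\<in>?\<Omega>. ennreal (norm (grad_gamma \<gamma> \<phi> z) powr p * (\<rho> z powr (p - Q) * (ln R - ln (\<rho> z)) powr (p + \<beta>))) \<partial>lborel)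
      < ennreal C * (\<integral>\<^sup>+z\<in>?\<Omega>. ennreal (\<bar>\<phi> z\<bar> powr p * (dens p z * (ln R - ln (\<rho> z)) powr \<beta>)) \<partial>lborel)"
  proof (rule radial_sharp[OF p(1) G(1,2) _ _ _ _ _ _ _ G(3)])
    show "z \<in> ?\<Omega>" if "z \<noteq> 0" "ln (\<rho> z) \<le> ln R - 2" for z
    proof -
      \<comment> \<open>The profile ends at level \<open>ln R - 2\<close>, which keeps its support
        strictly inside the ball, where the logarithmic weight is continuous.\<close>
      have "ln (\<rho> z) < ln R" using that(2) by simp
      then show ?thesis using gnorm_pos[OF that(1)] R by simp
    qed
    show "\<exists>K. \<forall>l\<in>{c..ln R - 2}. (ln R - l) powr (p + \<beta>) \<le> K" for c
    proof -
      have "compact ((\<lambda>l. (ln R - l) powr (p + \<beta>)) ` {c..ln R - 2})"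
        by (intro compact_continuous_image continuous_intros) auto
      then show ?thesis using compact_imp_bounded by (fastforce simp: bounded_iff)
    qed
  qed auto
  have ln: "ln (R / \<rho> z) = ln R - ln (\<rho> z)" if "z \<noteq> 0" for z
    using gnorm_pos[OF that] R by (simp add: ln_div)
  have "(\<integral>\<^sup>+z\<in>?\<Omega>. ennreal (norm (grad_gamma \<gamma> \<phi> z) powr p * ln (R / \<rho> z) powr (p + \<beta>)) \<partial>lborel)
      = (\<integral>\<^sup>+z\<in>?\<Omega>. ennreal (norm (grad_gamma \<gamma> \<phi> z) powr p * (\<rho> z powr (p - Q) * (ln R - ln (\<rho> z)) powr (p + \<beta>))) \<partial>lborel)"
  proof (rule nn_integral_cong_AE)
    show "AE z in lborel. ennreal (norm (grad_gamma \<gamma> \<phi> z) powr p * ln (R / \<rho> z) powr (p + \<beta>)) * indicator ?\<Omega> z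
      = ennreal (norm (grad_gamma \<gamma> \<phi> z) powr p * (\<rho> z powr (p - Q) * (ln R - ln (\<rho> z)) powr (p + \<beta>))) * indicator ?\<Omega> z"
      using AE_fst_nonzero
    proof eventually_elim
      case (elim z)
      then have "z \<noteq> 0" by auto
      then show ?case using gnorm_pos[of z] p(2) by (simp add: ln)
    qed
  qed
  moreover have "(\<integral>\<^sup>+z\<in>?\<Omega>. ennreal (\<bar>\<phi> z\<bar> powr p / \<rho> z powr p * ln (R / \<rho> z) powr \<beta>
        * rpow (norm (fst z) / \<rho> z) (\<gamma> * p)) \<partial>lborel)
      = (\<integral>\<^sup>+z\<in>?\<Omega>. ennreal (\<bar>\<phi> z\<bar> powr p * (dens p z * (ln R - ln (\<rho> z)) powr \<beta>)) \<partial>lborel)"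
  proof (rule nn_integral_cong_AE)
    show "AE z in lborel. ennreal (\<bar>\<phi> z\<bar> powr p / \<rho> z powr p * ln (R / \<rho> z) powr \<beta>
        * rpow (norm (fst z) / \<rho> z) (\<gamma> * p)) * indicator ?\<Omega> z
      = ennreal (\<bar>\<phi> z\<bar> powr p * (dens p z * (ln R - ln (\<rho> z)) powr \<beta>)) * indicator ?\<Omega> z"
      using AE_fst_nonzero
    proof eventually_elim
      case (elim z)
      then have "z \<noteq> 0" by auto
      then show ?case by (simp add: ln dens_def p(2)[symmetric] powr_minus_divide mult_ac)
    qed
  qed
  ultimately have less: "(\<integral>\<^sup>+z\<in>?\<Omega>. ennreal (norm (grad_gamma \<gamma> \<phi> z) powr p * ln (R / \<rho> z) powr (p + \<beta>)) \<partial>lborel)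
    < ennreal C * (\<integral>\<^sup>+z\<in>?\<Omega>. ennreal (\<bar>\<phi> z\<bar> powr p / \<rho> z powr p * ln (R / \<rho> z) powr \<beta>
        * rpow (norm (fst z) / \<rho> z) (\<gamma> * p)) \<partial>lborel)"
    using \<phi>(2) by simp
  then have "(\<phi>, grad_gamma \<gamma> \<phi>) \<in> DL \<gamma> p ?\<Omega> (\<lambda>z. ln (R / \<rho> z) powr (p + \<beta>))"
    using \<phi>(1) by (intro test_fun_in_DL) (auto intro: less_le_trans)
  with less show ?thesis by blast
qed

end

theorem mainTheorem9:
  fixes \<gamma> \<beta> :: real
    and Ntype :: "((real^'n::finite) \<times> (real^'k::finite)) itself"
  assumes "\<gamma> \<ge> 0"
  defines "Q \<equiv> real CARD('n) + (1 + \<gamma>) * real CARD('k)"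
  shows
  \<comment> \<open>(1) weighted inequality\<close>
  "(\<forall>(p::real) (\<Omega>::((real^'n) \<times> (real^'k)) set).
      1 < p \<and> open \<Omega> \<and> (\<beta> + Q < 0 \<longrightarrow> (0::(real^'n) \<times> (real^'k)) \<notin> \<Omega>) \<longrightarrow>
      (\<forall>(u, G) \<in> DL \<gamma> p \<Omega> (\<lambda>\<xi>. gnorm \<gamma> \<xi> powr (p + \<beta>)).
          ennreal ((\<bar>Q + \<beta>\<bar> / p) powr p) *
            (\<integral>\<^sup>+\<xi>\<in>\<Omega>. ennreal (\<bar>u \<xi>\<bar> powr p * gnorm \<gamma> \<xi> powr \<beta>
                 * rpow (norm (fst \<xi>) / gnorm \<gamma> \<xi>) (\<gamma> * p)) \<partial>lborel)
          \<le> (\<integral>\<^sup>+\<xi>\<in>\<Omega>. ennreal (norm (G \<xi>) powr p * gnorm \<gamma> \<xi> powr (p + \<beta>)) \<partial>lborel))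
      \<and> ((\<exists>e>0. ball 0 e \<subseteq> \<Omega> \<union> {0}) \<longrightarrow>
          (\<forall>C > (\<bar>Q + \<beta>\<bar> / p) powr p.
             \<exists>(u, G) \<in> DL \<gamma> p \<Omega> (\<lambda>\<xi>. gnorm \<gamma> \<xi> powr (p + \<beta>)).
               ennreal C *
                 (\<integral>\<^sup>+\<xi>\<in>\<Omega>. ennreal (\<bar>u \<xi>\<bar> powr p * gnorm \<gamma> \<xi> powr \<beta>
                      * rpow (norm (fst \<xi>) / gnorm \<gamma> \<xi>) (\<gamma> * p)) \<partial>lborel)
               > (\<integral>\<^sup>+\<xi>\<in>\<Omega>. ennreal (norm (G \<xi>) powr p * gnorm \<gamma> \<xi> powr (p + \<beta>)) \<partial>lborel))))
   \<and>
  \<comment> \<open>(1), particular case beta = -p, unweighted space\<close>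
   (\<forall>(p::real) (\<Omega>::((real^'n) \<times> (real^'k)) set).
      1 < p \<and> open \<Omega> \<and> (Q - p < 0 \<longrightarrow> (0::(real^'n) \<times> (real^'k)) \<notin> \<Omega>) \<longrightarrow>
      (\<forall>(u, G) \<in> DL \<gamma> p \<Omega> (\<lambda>\<xi>. 1).
          ennreal ((\<bar>Q - p\<bar> / p) powr p) *
            (\<integral>\<^sup>+\<xi>\<in>\<Omega>. ennreal (\<bar>u \<xi>\<bar> powr p / gnorm \<gamma> \<xi> powr p
                 * rpow (norm (fst \<xi>) / gnorm \<gamma> \<xi>) (\<gamma> * p)) \<partial>lborel)
          \<le> (\<integral>\<^sup>+\<xi>\<in>\<Omega>. ennreal (norm (G \<xi>) powr p) \<partial>lborel)))
   \<and>
  \<comment> \<open>(2) logarithmic inequality, p = Q\<close>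
   (\<forall>(p::real) (R::real). p = Q \<and> 1 < p \<and> 0 < R \<and> \<beta> < -1 \<longrightarrow>
      (let \<Omega> = {\<xi>::(real^'n) \<times> (real^'k). gnorm \<gamma> \<xi> < R} in
      (\<forall>(u, G) \<in> DL \<gamma> p \<Omega> (\<lambda>\<xi>. ln (R / gnorm \<gamma> \<xi>) powr (p + \<beta>)).
          ennreal ((\<bar>\<beta> + 1\<bar> / p) powr p) *
            (\<integral>\<^sup>+\<xi>\<in>\<Omega>. ennreal (\<bar>u \<xi>\<bar> powr p / gnorm \<gamma> \<xi> powr p
                 * ln (R / gnorm \<gamma> \<xi>) powr \<beta>
                 * rpow (norm (fst \<xi>) / gnorm \<gamma> \<xi>) (\<gamma> * p)) \<partial>lborel)
          \<le> (\<integral>\<^sup>+\<xi>\<in>\<Omega>. ennreal (norm (G \<xi>) powr p * ln (R / gnorm \<gamma> \<xi>) powr (p + \<beta>)) \<partial>lborel))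
      \<and> (\<forall>C > (\<bar>\<beta> + 1\<bar> / p) powr p.
             \<exists>(u, G) \<in> DL \<gamma> p \<Omega> (\<lambda>\<xi>. ln (R / gnorm \<gamma> \<xi>) powr (p + \<beta>)).
               ennreal C *
                 (\<integral>\<^sup>+\<xi>\<in>\<Omega>. ennreal (\<bar>u \<xi>\<bar> powr p / gnorm \<gamma> \<xi> powr p
                      * ln (R / gnorm \<gamma> \<xi>) powr \<beta>
                      * rpow (norm (fst \<xi>) / gnorm \<gamma> \<xi>) (\<gamma> * p)) \<partial>lborel)
               > (\<integral>\<^sup>+\<xi>\<in>\<Omega>. ennreal (norm (G \<xi>) powr p * ln (R / gnorm \<gamma> \<xi>) powr (p + \<beta>)) \<partial>lborel))))
   \<and>
  \<comment> \<open>(2), particular case beta = -p, unweighted space\<close>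
   (\<forall>(p::real) (R::real). p = Q \<and> 1 < p \<and> 0 < R \<longrightarrow>
      (let \<Omega> = {\<xi>::(real^'n) \<times> (real^'k). gnorm \<gamma> \<xi> < R} in
      (\<forall>(u, G) \<in> DL \<gamma> p \<Omega> (\<lambda>\<xi>. 1).
          ennreal (((p - 1) / p) powr p) *
            (\<integral>\<^sup>+\<xi>\<in>\<Omega>. ennreal (\<bar>u \<xi>\<bar> powr p / (gnorm \<gamma> \<xi> * ln (R / gnorm \<gamma> \<xi>)) powr p
                 * rpow (norm (fst \<xi>) / gnorm \<gamma> \<xi>) (\<gamma> * p)) \<partial>lborel)
          \<le> (\<integral>\<^sup>+\<xi>\<in>\<Omega>. ennreal (norm (G \<xi>) powr p) \<partial>lborel))))"
proof -
  interpret G: grushin \<gamma> Ntype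
    by unfold_locales (rule assms(1))
  have Q: "G.Q = Q"
    by (simp add: G.Q_def Q_def)
  show ?thesis
    unfolding Let_def
  proof (intro conjI allI impI ballI; (elim conjE)?)
    fix p :: real and \<Omega> :: "((real^'n) \<times> (real^'k)) set" and uG
    assume "1 < p" "open \<Omega>" "\<beta> + Q < 0 \<longrightarrow> 0 \<notin> \<Omega>"
      "uG \<in> DL \<gamma> p \<Omega> (\<lambda>\<xi>. gnorm \<gamma> \<xi> powr (p + \<beta>))"
    then show "case uG of (u, G) \<Rightarrow> ennreal ((\<bar>Q + \<beta>\<bar> / p) powr p) *
            (\<integral>\<^sup>+\<xi>\<in>\<Omega>. ennreal (\<bar>u \<xi>\<bar> powr p * gnorm \<gamma> \<xi> powr \<beta>
                 * rpow (norm (fst \<xi>) / gnorm \<gamma> \<xi>) (\<gamma> * p)) \<partial>lborel)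
          \<le> (\<integral>\<^sup>+\<xi>\<in>\<Omega>. ennreal (norm (G \<xi>) powr p * gnorm \<gamma> \<xi> powr (p + \<beta>)) \<partial>lborel)"
      using G.hardy_power[unfolded Q, of p \<Omega> \<beta>] by (auto simp: add.commute[of \<beta>])
  next
    fix p C :: real and \<Omega> :: "((real^'n) \<times> (real^'k)) set"
    assume "1 < p" "open \<Omega>" "\<exists>e>0. ball 0 e \<subseteq> \<Omega> \<union> {0}" "(\<bar>Q + \<beta>\<bar> / p) powr p < C"
    then show "\<exists>(u, G) \<in> DL \<gamma> p \<Omega> (\<lambda>\<xi>. gnorm \<gamma> \<xi> powr (p + \<beta>)).
               ennreal C *
                 (\<integral>\<^sup>+\<xi>\<in>\<Omega>. ennreal (\<bar>u \<xi>\<bar> powr p * gnorm \<gamma> \<xi> powr \<beta>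
                      * rpow (norm (fst \<xi>) / gnorm \<gamma> \<xi>) (\<gamma> * p)) \<partial>lborel)
               > (\<integral>\<^sup>+\<xi>\<in>\<Omega>. ennreal (norm (G \<xi>) powr p * gnorm \<gamma> \<xi> powr (p + \<beta>)) \<partial>lborel)"
      using G.sharp_power[unfolded Q] by blast
  next
    fix p :: real and \<Omega> :: "((real^'n) \<times> (real^'k)) set" and uG
    assume "1 < p" "open \<Omega>" "Q - p < 0 \<longrightarrow> 0 \<notin> \<Omega>" "uG \<in> DL \<gamma> p \<Omega> (\<lambda>\<xi>. 1)"
    then show "case uG of (u, G) \<Rightarrow> ennreal ((\<bar>Q - p\<bar> / p) powr p) *
            (\<integral>\<^sup>+\<xi>\<in>\<Omega>. ennreal (\<bar>u \<xi>\<bar> powr p / gnorm \<gamma> \<xi> powr p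
                 * rpow (norm (fst \<xi>) / gnorm \<gamma> \<xi>) (\<gamma> * p)) \<partial>lborel)
          \<le> (\<integral>\<^sup>+\<xi>\<in>\<Omega>. ennreal (norm (G \<xi>) powr p) \<partial>lborel)"
      using G.hardy_power_unweighted[unfolded Q] by blast
  next
    fix p R :: real and uG
    assume "p = Q" "1 < p" "0 < R" "\<beta> < -1"
      "uG \<in> DL \<gamma> p {\<xi>::(real^'n) \<times> (real^'k). gnorm \<gamma> \<xi> < R} (\<lambda>\<xi>. ln (R / gnorm \<gamma> \<xi>) powr (p + \<beta>))"
    then show "case uG of (u, G) \<Rightarrow> ennreal ((\<bar>\<beta> + 1\<bar> / p) powr p) *
            (\<integral>\<^sup>+\<xi>\<in>{\<xi>. gnorm \<gamma> \<xi> < R}. ennreal (\<bar>u \<xi>\<bar> powr p / gnorm \<gamma> \<xi> powr p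
                 * ln (R / gnorm \<gamma> \<xi>) powr \<beta>
                 * rpow (norm (fst \<xi>) / gnorm \<gamma> \<xi>) (\<gamma> * p)) \<partial>lborel)
          \<le> (\<integral>\<^sup>+\<xi>\<in>{\<xi>. gnorm \<gamma> \<xi> < R}. ennreal (norm (G \<xi>) powr p * ln (R / gnorm \<gamma> \<xi>) powr (p + \<beta>)) \<partial>lborel)"
      using G.hardy_log[unfolded Q] by blast
  next
    fix p R C :: real
    assume "p = Q" "1 < p" "0 < R" "\<beta> < -1" "(\<bar>\<beta> + 1\<bar> / p) powr p < C"
    then show "\<exists>(u, G) \<in> DL \<gamma> p {\<xi>::(real^'n) \<times> (real^'k). gnorm \<gamma> \<xi> < R} (\<lambda>\<xi>. ln (R / gnorm \<gamma> \<xi>) powr (p + \<beta>)).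
               ennreal C *
                 (\<integral>\<^sup>+\<xi>\<in>{\<xi>. gnorm \<gamma> \<xi> < R}. ennreal (\<bar>u \<xi>\<bar> powr p / gnorm \<gamma> \<xi> powr p
                      * ln (R / gnorm \<gamma> \<xi>) powr \<beta>
                      * rpow (norm (fst \<xi>) / gnorm \<gamma> \<xi>) (\<gamma> * p)) \<partial>lborel)
               > (\<integral>\<^sup>+\<xi>\<in>{\<xi>. gnorm \<gamma> \<xi> < R}. ennreal (norm (G \<xi>) powr p * ln (R / gnorm \<gamma> \<xi>) powr (p + \<beta>)) \<partial>lborel)"
      using G.sharp_log[unfolded Q] by blast
  next
    fix p R :: real and uG
    assume "p = Q" "1 < p" "0 < R"
      "uG \<in> DL \<gamma> p {\<xi>::(real^'n) \<times> (real^'k). gnorm \<gamma> \<xi> < R} (\<lambda>\<xi>. 1)"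
    then show "case uG of (u, G) \<Rightarrow> ennreal (((p - 1) / p) powr p) *
            (\<integral>\<^sup>+\<xi>\<in>{\<xi>. gnorm \<gamma> \<xi> < R}. ennreal (\<bar>u \<xi>\<bar> powr p / (gnorm \<gamma> \<xi> * ln (R / gnorm \<gamma> \<xi>)) powr p
                 * rpow (norm (fst \<xi>) / gnorm \<gamma> \<xi>) (\<gamma> * p)) \<partial>lborel)
          \<le> (\<integral>\<^sup>+\<xi>\<in>{\<xi>. gnorm \<gamma> \<xi> < R}. ennreal (norm (G \<xi>) powr p) \<partial>lborel)"
      using G.hardy_log_unweighted[unfolded Q] by blast
  qed
qed

end
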